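(* Let $\Omega=\{1,2,\dots,d\}^{\mathbb{N}}$, let $J_0,\tilde J_1$ and $J_1$ be Hölder Jacobians on $\Omega$, and let $\mu_1=\mu_{J_1}$. For $\lambda\in[0,1]$ let $\mu^\lambda$ be the equilibrium probability for the potential $\lambda\log\tilde J_1+(1-\lambda)\log J_0$; thus $\mu^0=\mu_{J_0}$ and $\mu^1=\mu_{\tilde J_1}$. Then $$\frac{d}{d\lambda}\Big|_{\lambda=0}D_{KL}(\mu_1,\mu^\lambda)=-\int(\log\tilde J_1-\log J_0)\,d\mu_1+\int(\log\tilde J_1-\log J_0)\,d\mu^0 .$$ Moreover, the inequality $0\le\frac{d}{d\lambda}\big|_{\lambda=0}D_{KL}(\mu_1,\mu^\lambda)$ is equivalent to the Pythagorean inequality $$D_{KL}(\mu_1,\mu^0)+D_{KL}(\mu^0,\mu_{\tilde J_1})\le D_{KL}(\mu_1,\mu_{\tilde J_1}).$$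
   Context: A Hölder Jacobian is a positive Hölder function $J:\Omega\to(0,1)$ such that $\mathscr{L}_{\log J}(1)=1$, where for a Hölder potential $A$ the Ruelle operator is $\mathscr{L}_Af(x)=\sum_{\sigma(y)=x}e^{A(y)}f(y)$ and $\sigma$ is the shift on $\Omega$. To each Hölder Jacobian $J$ corresponds a unique shift-invariant probability $\mu_J$ (the equilibrium probability for $\log J$) with $\mathscr{L}_{\log J}^*(\mu_J)=\mu_J$. The equilibrium probability of a (not necessarily normalized) Hölder potential $A$ is the shift-invariant probability maximizing $h(\mu)+\int A\,d\mu$; it equals $\mu_J$ for the Jacobian $J=e^{\Pi(A)}$, $\Pi(A)=A+\log\varphi_A-\log(\varphi_A\circ\sigma)-\log\alpha_A$, where $\alpha_A$ and $\varphi_A$ are the main eigenvalue and positive eigenfunction of $\mathscr{L}_A$. For Hölder Jacobians $J,J'$, $D_{KL}(\mu_J,\mu_{J'})=\int(\log J-\log J')\,d\mu_J$. The derivative at $\lambda=0$ is that of a function of $\lambda\in[0,1]$. *)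

theory Defs
  imports "HOL-Probability.Probability"
begin

text \<open>
  The space \<open>\<Omega> = {1,\<dots>,d}\<^sup>\<nat>\<close> is the type \<^typ>\<open>nat \<Rightarrow> 'a::finite\<close>, with \<open>d = CARD('a)\<close>.
\<close>

definition left_shift :: "(nat \<Rightarrow> 'a) \<Rightarrow> (nat \<Rightarrow> 'a)" where
  "left_shift x = (\<lambda>n. x (Suc n))"

definition seq_dist :: "(nat \<Rightarrow> 'a) \<Rightarrow> (nat \<Rightarrow> 'a) \<Rightarrow> real" where
  "seq_dist x y = (if x = y then 0 else (1/2) ^ (LEAST n. x n \<noteq> y n))"

definition holder_potential :: "((nat \<Rightarrow> 'a) \<Rightarrow> real) \<Rightarrow> bool" where
  "holder_potential A \<longleftrightarrow>
     (\<exists>C \<alpha>. 0 < \<alpha> \<and> \<alpha> \<le> 1 \<and> (\<forall>x y. \<bar>A x - A y\<bar> \<le> C * seq_dist x y powr \<alpha>))"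

definition seq_topology :: "(nat \<Rightarrow> 'a) topology" where
  "seq_topology = product_topology (\<lambda>_. discrete_topology UNIV) UNIV"

text \<open>
  The product \<open>\<sigma>\<close>-algebra; as the alphabet is finite, it is the Borel \<open>\<sigma>\<close>-algebra of
  \<^const>\<open>seq_topology\<close>. Only its measurable sets are used, not the measure it carries.
\<close>

definition seq_space :: "(nat \<Rightarrow> 'a) measure" where
  "seq_space = Pi\<^sub>M UNIV (\<lambda>_. count_space UNIV)"

definition ruelle :: "((nat \<Rightarrow> 'a::finite) \<Rightarrow> real) \<Rightarrow> ((nat \<Rightarrow> 'a) \<Rightarrow> real) \<Rightarrow> (nat \<Rightarrow> 'a) \<Rightarrow> real" where
  "ruelle A f x = (\<Sum>y | left_shift y = x. exp (A y) * f y)"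

definition holder_jacobian :: "((nat \<Rightarrow> 'a::finite) \<Rightarrow> real) \<Rightarrow> bool" where
  "holder_jacobian J \<longleftrightarrow>
     holder_potential J \<and> (\<forall>x. 0 < J x \<and> J x < 1) \<and>
     ruelle (\<lambda>x. ln (J x)) (\<lambda>_. 1) = (\<lambda>_. 1)"

definition invariant_prob :: "(nat \<Rightarrow> 'a) measure \<Rightarrow> bool" where
  "invariant_prob \<mu> \<longleftrightarrow>
     prob_space \<mu> \<and> sets \<mu> = sets seq_space \<and> distr \<mu> \<mu> left_shift = \<mu>"

text \<open>
  The equation \<open>\<L>\<^sub>A\<^sup>* \<mu> = \<mu>\<close> for the dual of the Ruelle operator on continuous functions.
\<close>

definition ruelle_dual_fixed :: "((nat \<Rightarrow> 'a::finite) \<Rightarrow> real) \<Rightarrow> (nat \<Rightarrow> 'a) measure \<Rightarrow> bool" where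
  "ruelle_dual_fixed A \<mu> \<longleftrightarrow>
     (\<forall>f. continuous_map seq_topology euclideanreal f \<longrightarrow>
        (\<integral>x. ruelle A f x \<partial>\<mu>) = (\<integral>x. f x \<partial>\<mu>))"

definition jacobian_measure :: "((nat \<Rightarrow> 'a::finite) \<Rightarrow> real) \<Rightarrow> (nat \<Rightarrow> 'a) measure" where
  "jacobian_measure J = (THE \<mu>. invariant_prob \<mu> \<and> ruelle_dual_fixed (\<lambda>x. ln (J x)) \<mu>)"

text \<open>
  Kolmogorov--Sinai entropy of the shift. A finite measurable partition is encoded by a simple
  function \<open>\<xi>\<close>, whose fibres are the atoms; the \<open>n\<close>-fold refinement
  \<open>\<xi> \<squnion> \<sigma>\<^sup>-\<^sup>1\<xi> \<squnion> \<dots> \<squnion> \<sigma>\<^sup>-\<^sup>n\<^sup>+\<^sup>1\<xi>\<close> is then the partition into the fibres of the itinerary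
  \<open>x \<mapsto> (\<xi> x, \<dots>, \<xi> (\<sigma>\<^sup>n\<^sup>-\<^sup>1 x))\<close>. Logarithms are natural.
\<close>

definition itinerary :: "((nat \<Rightarrow> 'a) \<Rightarrow> nat) \<Rightarrow> nat \<Rightarrow> (nat \<Rightarrow> 'a) \<Rightarrow> nat list" where
  "itinerary \<xi> n x = map (\<lambda>i. \<xi> ((left_shift ^^ i) x)) [0..<n]"

definition block_entropy :: "(nat \<Rightarrow> 'a) measure \<Rightarrow> ((nat \<Rightarrow> 'a) \<Rightarrow> nat) \<Rightarrow> nat \<Rightarrow> real" where
  "block_entropy \<mu> \<xi> n =
     prob_space.entropy \<mu> (exp 1) (count_space (itinerary \<xi> n ` space \<mu>)) (itinerary \<xi> n)"

definition partition_entropy :: "(nat \<Rightarrow> 'a) measure \<Rightarrow> ((nat \<Rightarrow> 'a) \<Rightarrow> nat) \<Rightarrow> real" where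
  "partition_entropy \<mu> \<xi> = lim (\<lambda>n. block_entropy \<mu> \<xi> n / real n)"

definition ks_entropy :: "(nat \<Rightarrow> 'a) measure \<Rightarrow> ereal" where
  "ks_entropy \<mu> = (SUP \<xi> \<in> {\<xi>. simple_function \<mu> \<xi>}. ereal (partition_entropy \<mu> \<xi>))"

definition is_equilibrium :: "((nat \<Rightarrow> 'a) \<Rightarrow> real) \<Rightarrow> (nat \<Rightarrow> 'a) measure \<Rightarrow> bool" where
  "is_equilibrium A \<mu> \<longleftrightarrow>
     invariant_prob \<mu> \<and>
     (\<forall>\<nu>. invariant_prob \<nu> \<longrightarrow>
        ks_entropy \<nu> + ereal (\<integral>x. A x \<partial>\<nu>) \<le> ks_entropy \<mu> + ereal (\<integral>x. A x \<partial>\<mu>))"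

definition equilibrium :: "((nat \<Rightarrow> 'a) \<Rightarrow> real) \<Rightarrow> (nat \<Rightarrow> 'a) measure" where
  "equilibrium A = (THE \<mu>. is_equilibrium A \<mu>)"

text \<open>
  \<open>D\<^sub>K\<^sub>L(\<mu>\<^sub>J, \<mu>\<^sub>J\<^sub>') = \<integral> (log J - log J') d\<mu>\<^sub>J\<close> is written as a function of the two measures:
  a Hoelder Jacobian \<open>J\<close> is determined by \<open>\<mu>\<^sub>J\<close>, being a continuous version of a
  Radon--Nikodym derivative with respect to a measure of full support.
\<close>

definition jacobian_of :: "(nat \<Rightarrow> 'a::finite) measure \<Rightarrow> (nat \<Rightarrow> 'a) \<Rightarrow> real" where
  "jacobian_of \<mu> = (THE J. holder_jacobian J \<and> jacobian_measure J = \<mu>)"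

definition D_KL :: "(nat \<Rightarrow> 'a::finite) measure \<Rightarrow> (nat \<Rightarrow> 'a) measure \<Rightarrow> real" where
  "D_KL \<mu> \<nu> = (\<integral>x. (ln (jacobian_of \<mu> x) - ln (jacobian_of \<nu> x)) \<partial>\<mu>)"

end

theory Submission
  imports Defs
begin

text \<open>
  The Jacobian \<open>J\<^sub>l\<close> of \<open>\<mu>\<^sup>l\<close> satisfies \<open>ln J\<^sub>l = A\<^sub>l + ln \<phi> - ln (\<phi> \<circ> \<sigma>) - ln \<alpha>\<^sub>l\<close>, where
  \<open>A\<^sub>l = ln J\<^sub>0 + l g\<close> and \<open>g\<close> is the difference of the logarithms of the two Jacobians that are
  interpolated. The coboundary has integral zero for the invariant measure \<open>\<mu>\<^sub>1\<close>, so
  \<open>D\<^sub>K\<^sub>L \<mu>\<^sub>1 \<mu>\<^sup>l = \<integral> ln J\<^sub>1 d\<mu>\<^sub>1 - \<integral> A\<^sub>l d\<mu>\<^sub>1 + ln \<alpha>\<^sub>l\<close> depends on \<open>l\<close> only through an affine function and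
  the eigenvalue \<open>\<alpha>\<^sub>l\<close>. The derivative of \<open>ln \<alpha>\<^sub>l\<close> at \<open>0\<close> is \<open>\<integral> g d\<mu>\<^sup>0\<close>, and the Pythagorean inequality
  is then a rearrangement of the three divergences.

  The derivative of the eigenvalue is found without perturbation theory. Any positive test function
  \<open>\<psi>\<close> bounds \<open>\<alpha>\<^sub>l\<close> by the extreme values of \<open>L\<^sub>l \<psi> / \<psi>\<close> (\<open>ex_normalization\<close>). Since the iterates of the
  normalized operator converge uniformly to the integral (\<open>transfer_pow_uniform_limit\<close>), the
  equation \<open>g + u - u \<circ> \<sigma> = \<integral> g d\<mu>\<^sup>0\<close> can be solved approximately in the mean over preimages, and
  \<open>\<psi> = exp (l u)\<close> gives bounds that agree to first order (\<open>transfer_test_function\<close>,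
  \<open>eigenvalue_derivative\<close>).

  Three parts of the thermodynamic formalism support this. Convergence of the iterates comes from a
  coupling that makes sequences agree on longer and longer words, with summable failure probabilities
  (\<open>osc_transfer_pow_tendsto_0\<close>); it yields the measure \<open>\<mu>\<^sub>J\<close> through Caratheodory's theorem. The
  positive eigenfunction is found as a maximizer in a compact set (\<open>ex_eigenfunction\<close>). Finally, the
  equilibrium state of \<open>A\<close> is unique and equals \<open>\<mu>\<^sub>J\<close> for the normalization \<open>J\<close> of \<open>A\<close>
  (\<open>equilibrium_eq\<close>): the entropy of an invariant
  measure is at most the conditional information of one letter given the next \<open>k\<close>
  (\<open>ks_entropy_le_cond_info\<close>), the variational inequality is the positivity of a relative entropy
  between distributions on words, and in the case of equality these distributions become close in
  the Hellinger distance, which forces the measure to be fixed by the dual operator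
  (\<open>ks_entropy_eq_imp\<close>). For \<open>\<mu>\<^sub>J\<close> itself equality follows from the Gibbs property
  (\<open>ks_entropy_jacobian_measure\<close>).
\<close>

section \<open>Words, cylinders and uniform continuity\<close>

type_synonym 'a \<Omega> = "nat \<Rightarrow> 'a"

text \<open>
  Words of length \<open>n\<close> are represented by the sequences in the range of \<open>trunc n\<close>: all letters
  from position \<open>n\<close> on are replaced by one arbitrary fixed letter. Two sequences agree on their
  first \<open>n\<close> letters iff their truncations are equal, and functions on \<open>\<Omega>\<close> apply to words.
\<close>

definition trunc :: "nat \<Rightarrow> 'a \<Omega> \<Rightarrow> 'a \<Omega>" where
  "trunc n x = (\<lambda>i. if i < n then x i else undefined)"

definition scons :: "'a \<Rightarrow> 'a \<Omega> \<Rightarrow> 'a \<Omega>" where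
  "scons a x = case_nat a x"

lemma scons_0 [simp]: "scons a x 0 = a"
  and scons_Suc [simp]: "scons a x (Suc n) = x n"
  by (simp_all add: scons_def)

lemma left_shift_scons [simp]: "left_shift (scons a x) = x"
  by (simp add: left_shift_def)

lemma scons_left_shift [simp]: "scons (x 0) (left_shift x) = x"
  by (rule ext) (simp add: left_shift_def scons_def split: nat.split)

lemma scons_eq_iff [simp]: "scons a x = scons b y \<longleftrightarrow> a = b \<and> x = y"
  by (metis scons_0 left_shift_scons)

lemma trunc_eq_iff: "trunc n x = trunc n y \<longleftrightarrow> (\<forall>i<n. x i = y i)"
  by (auto simp: trunc_def fun_eq_iff)

lemma trunc_trunc [simp]: "trunc m (trunc n x) = trunc (min m n) x"
  by (auto simp: trunc_def fun_eq_iff)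

lemma trunc_0_eq [simp]: "trunc 0 x = trunc 0 y"
  by (simp add: trunc_eq_iff)

lemma trunc_eq_mono: "trunc n x = trunc n y \<Longrightarrow> m \<le> n \<Longrightarrow> trunc m x = trunc m y"
  by (simp add: trunc_eq_iff)

lemma trunc_scons: "trunc (Suc n) (scons a x) = scons a (trunc n x)"
  by (auto simp: fun_eq_iff trunc_def scons_def split: nat.split)

lemma left_shift_trunc: "left_shift (trunc (Suc n) x) = trunc n (left_shift x)"
  by (auto simp: left_shift_def trunc_def)

lemma trunc_Suc: "trunc (Suc n) x = scons (x 0) (trunc n (left_shift x))"
  by (metis trunc_scons scons_left_shift)

lemma finite_range_trunc: "finite (range (trunc n :: 'a::finite \<Omega> \<Rightarrow> _))"
proof (induction n)
  case 0
  have "range (trunc 0 :: 'a \<Omega> \<Rightarrow> _) \<subseteq> {trunc 0 undefined}" by auto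
  then show ?case by (rule finite_subset) simp
next
  case (Suc n)
  have "range (trunc (Suc n) :: 'a \<Omega> \<Rightarrow> _) \<subseteq> (\<lambda>(a, w). scons a w) ` (UNIV \<times> range (trunc n))"
    by (auto simp: trunc_Suc)
  then show ?case by (rule finite_subset) (use Suc in simp)
qed

lemma vimage_left_shift: "{y. left_shift y = x} = range (\<lambda>a. scons a x)"
  by (auto simp: image_iff) (metis scons_left_shift)

lemma ruelle_scons: "ruelle A f x = (\<Sum>a\<in>UNIV. exp (A (scons a x)) * f (scons a x))"
proof -
  have "inj (\<lambda>a. scons a x)" by (auto simp: inj_def)
  then show ?thesis
    by (simp add: ruelle_def vimage_left_shift sum.reindex)
qed

definition ucont :: "('a \<Omega> \<Rightarrow> real) \<Rightarrow> bool" where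
  "ucont f \<longleftrightarrow> (\<forall>e>0. \<exists>n. \<forall>x y. trunc n x = trunc n y \<longrightarrow> \<bar>f x - f y\<bar> \<le> e)"

lemma ucontD:
  assumes "ucont f" "e > 0"
  obtains n where "\<And>x y. trunc n x = trunc n y \<Longrightarrow> \<bar>f x - f y\<bar> \<le> e"
  using assms unfolding ucont_def by blast

text \<open>
  The sets that are determined by finitely many letters. As the alphabet is finite, they are the
  clopen sets of the product topology.
\<close>

definition cylinders :: "'a \<Omega> set set" where
  "cylinders = {A. \<exists>n. \<forall>x. trunc n x \<in> A \<longleftrightarrow> x \<in> A}"

lemma topspace_seq [simp]: "topspace seq_topology = UNIV"
  by (simp add: seq_topology_def)

lemma compact_space_seq: "compact_space (seq_topology :: 'a::finite \<Omega> topology)"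
  by (simp add: seq_topology_def compact_space_product_topology compact_space_discrete_topology)

lemma openin_cylinder:
  assumes "\<And>x y. trunc n x = trunc n y \<Longrightarrow> x \<in> A \<Longrightarrow> y \<in> A"
  shows "openin seq_topology A"
proof (subst openin_subopen, intro ballI)
  fix x assume "x \<in> A"
  let ?T = "{y. \<forall>i<n. y i = x i}"
  let ?U = "\<lambda>i. if i < n then {x i} else UNIV"
  have *: "?T = Pi\<^sub>E UNIV ?U"
    by (auto simp: PiE_iff split: if_splits)
  have "{i. ?U i \<noteq> UNIV} \<subseteq> {..<n}" by auto
  then have "finite {i. ?U i \<noteq> UNIV}" by (rule finite_subset) simp
  then have "openin seq_topology ?T"
    unfolding * seq_topology_def by (simp add: openin_PiE_gen)
  moreover have "?T \<subseteq> A"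
    using assms[of x] \<open>x \<in> A\<close> by (auto simp: trunc_eq_iff)
  ultimately show "\<exists>T. openin seq_topology T \<and> x \<in> T \<and> T \<subseteq> A" by blast
qed

lemma closedin_cylinder:
  assumes "\<And>x y. trunc n x = trunc n y \<Longrightarrow> x \<in> A \<Longrightarrow> y \<in> A"
  shows "closedin seq_topology A"
proof -
  have "openin seq_topology (- A)"
    using assms by (intro openin_cylinder[of n]) (metis ComplD ComplI)
  then show ?thesis by (simp add: closedin_def Compl_eq_Diff_UNIV)
qed

lemma cylinders_nested:
  fixes C :: "nat \<Rightarrow> 'a::finite \<Omega> set"
  assumes "\<And>n. C n \<in> cylinders" "\<And>n. C n \<noteq> {}" "decseq C"
  shows "(\<Inter>n. C n) \<noteq> {}"
proof (rule compact_space_imp_nest[OF compact_space_seq _ assms(2,3)])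
  fix n
  from assms(1)[of n] obtain k where "\<And>x. trunc k x \<in> C n \<longleftrightarrow> x \<in> C n"
    by (auto simp: cylinders_def)
  then show "closedin seq_topology (C n)"
    by (intro closedin_cylinder[of k]) metis
qed

lemma continuous_if_ucont:
  assumes "ucont f"
  shows "continuous_map seq_topology euclideanreal f"
proof (subst continuous_map_eq_topcontinuous_at, intro ballI)
  fix x :: "'a \<Omega>"
  show "topcontinuous_at seq_topology euclideanreal f x"
    unfolding topcontinuous_at_def
  proof (intro conjI allI impI)
    fix V assume "openin euclideanreal V \<and> f x \<in> V"
    then obtain e where e: "e > 0" "\<And>y. \<bar>y - f x\<bar> < e \<Longrightarrow> y \<in> V"
      by (auto simp: open_dist dist_real_def)
    obtain n where n: "\<And>x y. trunc n x = trunc n y \<Longrightarrow> \<bar>f x - f y\<bar> \<le> e/2"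
      using ucontD[OF assms, of "e/2"] e by auto
    have "openin seq_topology {y. trunc n y = trunc n x}"
      by (rule openin_cylinder[of n]) auto
    moreover have "f y \<in> V" if "trunc n y = trunc n x" for y
      using n[OF that] e by (intro e(2)) linarith
    ultimately show "\<exists>U. openin seq_topology U \<and> x \<in> U \<and> (\<forall>y\<in>U. f y \<in> V)"
      by (intro exI[of _ "{y. trunc n y = trunc n x}"]) auto
  qed auto
qed

text \<open>
  Heine--Cantor. The points around which \<open>f\<close> oscillates by more than \<open>e\<close> inside the cylinder of
  length \<open>n\<close> form a clopen set which decreases with \<open>n\<close>; if none of these sets were empty, a common
  point would be a discontinuity.
\<close>

lemma ucont_if_continuous:
  fixes f :: "'a::finite \<Omega> \<Rightarrow> real"
  assumes "continuous_map seq_topology euclideanreal f"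
  shows "ucont f"
proof (rule ccontr)
  assume "\<not> ucont f"
  then obtain e where e: "e > 0" "\<And>n. \<exists>x y. trunc n x = trunc n y \<and> \<bar>f x - f y\<bar> > e"
    unfolding ucont_def by (meson not_le)
  define C where "C n = {x. \<exists>y z. trunc n y = trunc n x \<and> trunc n z = trunc n x \<and> \<bar>f y - f z\<bar> > e}" for n
  have "(\<Inter>n. C n) \<noteq> {}"
  proof (rule cylinders_nested)
    show "C n \<in> cylinders" for n
      unfolding cylinders_def C_def mem_Collect_eq by (rule exI[of _ n]) simp
    show "C n \<noteq> {}" for n
      using e(2)[of n] by (fastforce simp: C_def)
    show "decseq C"
      unfolding decseq_def C_def by (blast intro: trunc_eq_mono)
  qed
  then obtain x where x: "\<And>n. x \<in> C n" by auto
  have "openin seq_topology {y. f y \<in> ball (f x) (e/2)}"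
    using openin_continuous_map_preimage[OF assms, of "ball (f x) (e/2)"] by simp
  then obtain U where U: "finite {i. U i \<noteq> UNIV}" "x \<in> Pi\<^sub>E UNIV U" "Pi\<^sub>E UNIV U \<subseteq> {y. f y \<in> ball (f x) (e/2)}"
    unfolding seq_topology_def openin_product_topology_alt using e(1) by fastforce
  obtain n where n: "{i. U i \<noteq> UNIV} \<subseteq> {..<n}"
    using U(1) by (meson finite_nat_bounded)
  have near: "\<bar>f y - f x\<bar> < e/2" if "trunc n y = trunc n x" for y
  proof -
    have "y i \<in> U i" for i
    proof (cases "U i = UNIV")
      case False
      then have "i < n" using n by auto
      then have "y i = x i" using that by (simp add: trunc_eq_iff)
      then show ?thesis using U(2) by auto
    qed auto
    then have "y \<in> Pi\<^sub>E UNIV U" by auto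
    then show ?thesis using U(3) by (auto simp: dist_real_def abs_minus_commute)
  qed
  from x[of n] obtain y z where "trunc n y = trunc n x" "trunc n z = trunc n x" "\<bar>f y - f z\<bar> > e"
    by (auto simp: C_def)
  then show False using near[of y] near[of z] by linarith
qed

lemma ucont_iff:
  fixes f :: "'a::finite \<Omega> \<Rightarrow> real"
  shows "ucont f \<longleftrightarrow> continuous_map seq_topology euclideanreal f"
  using continuous_if_ucont ucont_if_continuous by blast

lemma ucont_bounded:
  fixes f :: "'a::finite \<Omega> \<Rightarrow> real"
  assumes "ucont f"
  obtains B where "B > 0" "\<And>x. \<bar>f x\<bar> \<le> B"
proof -
  obtain n where n: "\<And>x y. trunc n x = trunc n y \<Longrightarrow> \<bar>f x - f y\<bar> \<le> 1"
    using ucontD[OF assms, of 1] by auto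
  define M where "M = Max ((\<lambda>w. \<bar>f w\<bar>) ` range (trunc n))"
  have M: "\<bar>f (trunc n x)\<bar> \<le> M" for x
    unfolding M_def by (intro Max_ge) (auto simp: finite_range_trunc)
  have "\<bar>f x\<bar> \<le> M + 1" for x
    using n[of x "trunc n x"] M[of x] by simp
  moreover have "M + 1 > 0" using M[of undefined] by linarith
  ultimately show ?thesis using that by blast
qed

lemma ucont_trunc: "ucont (\<lambda>x. f (trunc n x))"
  unfolding ucont_def by (intro allI impI exI[of _ n]) auto

lemma ucont_scons:
  assumes "ucont f" shows "ucont (\<lambda>x. f (scons a x))"
  unfolding ucont_def
proof (intro allI impI)
  fix e :: real assume "e > 0"
  then obtain n where n: "\<And>x y. trunc n x = trunc n y \<Longrightarrow> \<bar>f x - f y\<bar> \<le> e"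
    using ucontD[OF assms] by blast
  have "\<bar>f (scons a x) - f (scons a y)\<bar> \<le> e" if "trunc n x = trunc n y" for x y
    by (rule n, rule trunc_eq_mono[of "Suc n"]) (simp_all add: trunc_scons that)
  then show "\<exists>n. \<forall>x y. trunc n x = trunc n y \<longrightarrow> \<bar>f (scons a x) - f (scons a y)\<bar> \<le> e" by blast
qed

lemma ucont_left_shift:
  assumes "ucont f" shows "ucont (\<lambda>x. f (left_shift x))"
  unfolding ucont_def
proof (intro allI impI)
  fix e :: real assume "e > 0"
  then obtain n where n: "\<And>x y. trunc n x = trunc n y \<Longrightarrow> \<bar>f x - f y\<bar> \<le> e"
    using ucontD[OF assms] by blast
  then show "\<exists>n. \<forall>x y. trunc n x = trunc n y \<longrightarrow> \<bar>f (left_shift x) - f (left_shift y)\<bar> \<le> e"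
    by (intro exI[of _ "Suc n"]) (simp add: trunc_Suc)
qed

lemma ucont_const [simp]: "ucont (\<lambda>_. c)"
  unfolding ucont_def by auto

lemma
  fixes f g :: "'a::finite \<Omega> \<Rightarrow> real"
  assumes "ucont f" "ucont g"
  shows ucont_add: "ucont (\<lambda>x. f x + g x)"
    and ucont_diff: "ucont (\<lambda>x. f x - g x)"
    and ucont_mult: "ucont (\<lambda>x. f x * g x)"
  using assms unfolding ucont_iff
  by (auto intro: continuous_map_add continuous_map_diff continuous_map_real_mult)

lemma ucont_exp:
  fixes f :: "'a::finite \<Omega> \<Rightarrow> real"
  assumes "ucont f" shows "ucont (\<lambda>x. exp (f x))"
  using assms continuous_map_compose[of seq_topology euclideanreal f euclideanreal exp]
  unfolding ucont_iff by (simp add: comp_def continuous_on_exp)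

lemma ucont_ln:
  fixes f :: "'a::finite \<Omega> \<Rightarrow> real"
  assumes "ucont f" "\<And>x. f x > 0" shows "ucont (\<lambda>x. ln (f x))"
proof -
  have "continuous_map seq_topology (top_of_set {0<..}) f"
    using assms by (auto simp: ucont_iff continuous_map_in_subtopology)
  then show ?thesis
    using continuous_map_compose[of seq_topology "top_of_set {0<..}" f euclideanreal ln]
    unfolding ucont_iff by (simp add: comp_def continuous_on_ln)
qed

lemma ucont_cmult:
  fixes f :: "'a::finite \<Omega> \<Rightarrow> real"
  shows "ucont f \<Longrightarrow> ucont (\<lambda>x. c * f x)"
  by (rule ucont_mult) auto

lemma ucont_sum:
  fixes f :: "'b \<Rightarrow> 'a::finite \<Omega> \<Rightarrow> real"
  shows "(\<And>i. i \<in> I \<Longrightarrow> ucont (f i)) \<Longrightarrow> ucont (\<lambda>x. \<Sum>i\<in>I. f i x)"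
  by (induction I rule: infinite_finite_induct) (auto intro: ucont_add)

section \<open>Hoelder functions\<close>

text \<open>
  Two sequences that first differ at position \<open>n\<close> have distance \<open>(1/2)\<^sup>n\<close>, so Hoelder continuity with
  exponent \<open>a\<close> says that the variation on cylinders of length \<open>n\<close> decays like \<open>\<theta>\<^sup>n\<close>, with
  \<open>\<theta> = (1/2) powr a\<close>. All estimates use this form, which survives shifting and prepending letters.
\<close>

definition exp_var :: "real \<Rightarrow> real \<Rightarrow> ('a \<Omega> \<Rightarrow> real) \<Rightarrow> bool" where
  "exp_var C \<theta> f \<longleftrightarrow> (\<forall>n x y. trunc n x = trunc n y \<longrightarrow> \<bar>f x - f y\<bar> \<le> C * \<theta> ^ n)"

lemma exp_varD: "exp_var C \<theta> f \<Longrightarrow> trunc n x = trunc n y \<Longrightarrow> \<bar>f x - f y\<bar> \<le> C * \<theta> ^ n"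
  by (simp add: exp_var_def)

lemma seq_dist_trunc:
  assumes "x \<noteq> y"
  obtains N where "seq_dist x y = (1/2) ^ N" "\<And>n. trunc n x = trunc n y \<longleftrightarrow> n \<le> N"
proof -
  define N where "N = (LEAST n. x n \<noteq> y n)"
  from assms obtain k where "x k \<noteq> y k" by auto
  then have N: "x N \<noteq> y N" unfolding N_def by (rule LeastI)
  have "x i = y i" if "i < N" for i using not_less_Least[OF that[unfolded N_def]] by simp
  then have "trunc n x = trunc n y \<longleftrightarrow> n \<le> N" for n
    unfolding trunc_eq_iff using N by (metis leI less_le_trans)
  moreover have "seq_dist x y = (1/2) ^ N" using assms by (simp add: seq_dist_def N_def)
  ultimately show ?thesis using that by blast
qed

lemma exp_var_if_holder:
  assumes "holder_potential f"
  obtains C \<theta> where "0 < \<theta>" "\<theta> < 1" "0 \<le> C" "exp_var C \<theta> f"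
proof -
  from assms obtain C \<alpha> where a: "0 < \<alpha>" "\<alpha> \<le> 1" and f: "\<And>x y. \<bar>f x - f y\<bar> \<le> C * seq_dist x y powr \<alpha>"
    unfolding holder_potential_def by blast
  define \<theta> where "\<theta> = (1/2::real) powr \<alpha>"
  have t: "0 < \<theta>" "\<theta> < 1" using a by (simp_all add: \<theta>_def powr01_less_one)
  have pow: "((1/2::real) ^ N) powr \<alpha> = \<theta> ^ N" for N
    by (simp add: \<theta>_def powr_powr powr_realpow[symmetric] mult.commute)
  have "exp_var \<bar>C\<bar> \<theta> f"
    unfolding exp_var_def
  proof (intro allI impI)
    fix n x y assume eq: "trunc n x = (trunc n y :: 'a \<Omega>)"
    show "\<bar>f x - f y\<bar> \<le> \<bar>C\<bar> * \<theta> ^ n"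
    proof (cases "x = y")
      case True then show ?thesis using t by simp
    next
      case False
      then obtain N where N: "seq_dist x y = (1/2) ^ N" "\<And>n. trunc n x = trunc n y \<longleftrightarrow> n \<le> N"
        by (rule seq_dist_trunc) blast
      have "\<bar>f x - f y\<bar> \<le> \<bar>C\<bar> * \<theta> ^ N"
        using f[of x y] by (simp add: N(1) pow) (smt (verit) abs_mult mult_right_mono abs_ge_self t zero_le_power)
      also have "\<dots> \<le> \<bar>C\<bar> * \<theta> ^ n"
        using N(2)[of n] eq t by (intro mult_left_mono power_decreasing) auto
      finally show ?thesis .
    qed
  qed
  then show ?thesis by (rule that[OF t abs_ge_zero])
qed

lemma exp_var_mono:
  assumes "exp_var C \<theta> f" "C \<le> C'" "0 \<le> C'" "0 \<le> \<theta>" "\<theta> \<le> \<theta>'"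
  shows "exp_var C' \<theta>' f"
  unfolding exp_var_def
proof (intro allI impI)
  fix n x y assume "trunc n x = (trunc n y :: 'a \<Omega>)"
  then have "\<bar>f x - f y\<bar> \<le> C * \<theta> ^ n" by (rule exp_varD[OF assms(1)])
  also have "\<dots> \<le> C' * \<theta>' ^ n" using assms by (intro mult_mono power_mono) auto
  finally show "\<bar>f x - f y\<bar> \<le> C' * \<theta>' ^ n" .
qed

lemma holder_if_exp_var:
  assumes "0 < \<theta>" "\<theta> < 1" "0 \<le> C" "exp_var C \<theta> f"
  shows "holder_potential f"
proof -
  \<comment> \<open>Rates below \<open>1/2\<close> would give a Hoelder exponent above 1.\<close>
  define t where "t = max \<theta> (1/2)"
  have t: "1/2 \<le> t" "t < 1" using assms by (auto simp: t_def)
  have f: "exp_var C t f" using assms by (intro exp_var_mono[OF assms(4)]) (auto simp: t_def)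
  define \<alpha> where "\<alpha> = log (1/2) t"
  have a: "(1/2) powr \<alpha> = t" using t by (simp add: \<alpha>_def)
  have "0 < \<alpha>" using t unfolding \<alpha>_def by (simp add: log_def divide_neg_neg)
  moreover have "\<alpha> \<le> 1"
  proof (rule ccontr)
    assume "\<not> \<alpha> \<le> 1"
    then have "(1/2::real) powr \<alpha> < (1/2) powr 1" by (intro powr_less_mono') auto
    then show False using a t by simp
  qed
  moreover have "\<bar>f x - f y\<bar> \<le> C * seq_dist x y powr \<alpha>" for x y
  proof (cases "x = y")
    case False
    then obtain N where N: "seq_dist x y = (1/2) ^ N" "\<And>n. trunc n x = trunc n y \<longleftrightarrow> n \<le> N"
      by (rule seq_dist_trunc) blast
    have "seq_dist x y powr \<alpha> = t ^ N"
      by (simp add: N(1) a[symmetric] powr_powr powr_realpow[symmetric] mult.commute)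
    then show ?thesis using exp_varD[OF f, of N x y] N(2)[of N] by simp
  qed (simp add: seq_dist_def)
  ultimately show ?thesis unfolding holder_potential_def by blast
qed

lemma ucont_if_exp_var:
  assumes "0 < \<theta>" "\<theta> < 1" "exp_var C \<theta> f"
  shows "ucont f"
  unfolding ucont_def
proof (intro allI impI)
  fix e :: real assume "e > 0"
  have "(\<lambda>n. C * \<theta> ^ n) \<longlonglongrightarrow> C * 0"
    using assms by (intro tendsto_intros LIMSEQ_power_zero) auto
  then have "eventually (\<lambda>n. C * \<theta> ^ n < e) sequentially"
    using \<open>e > 0\<close> by (simp add: order_tendstoD)
  then obtain n where "C * \<theta> ^ n < e" by (auto simp: eventually_sequentially)
  then show "\<exists>n. \<forall>x y. trunc n x = trunc n y \<longrightarrow> \<bar>f x - f y\<bar> \<le> e"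
    using exp_varD[OF assms(3)] by (intro exI[of _ n]) (meson less_imp_le order_trans)
qed

lemma ucont_if_holder: "holder_potential f \<Longrightarrow> ucont f"
  by (metis exp_var_if_holder ucont_if_exp_var)

lemma holder_combination:
  assumes "holder_potential f" "holder_potential g"
  shows "holder_potential (\<lambda>x. a * f x + b * g x)"
proof -
  obtain C \<theta> where f: "0 < \<theta>" "\<theta> < 1" "0 \<le> C" "exp_var C \<theta> f" using assms(1) by (rule exp_var_if_holder) blast
  obtain D \<eta> where g: "0 < \<eta>" "\<eta> < 1" "0 \<le> D" "exp_var D \<eta> g" using assms(2) by (rule exp_var_if_holder) blast
  let ?t = "max \<theta> \<eta>"
  have f': "exp_var C ?t f" and g': "exp_var D ?t g"
    using f g by (auto intro: exp_var_mono)
  have "exp_var (\<bar>a\<bar> * C + \<bar>b\<bar> * D) ?t (\<lambda>x. a * f x + b * g x)"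
    unfolding exp_var_def
  proof (intro allI impI)
    fix n x y assume eq: "trunc n x = (trunc n y :: 'a \<Omega>)"
    have "\<bar>a * f x + b * g x - (a * f y + b * g y)\<bar> = \<bar>a * (f x - f y) + b * (g x - g y)\<bar>"
      by (simp add: algebra_simps)
    also have "\<dots> \<le> \<bar>a\<bar> * \<bar>f x - f y\<bar> + \<bar>b\<bar> * \<bar>g x - g y\<bar>"
      using abs_triangle_ineq[of "a * (f x - f y)" "b * (g x - g y)"] by (simp add: abs_mult)
    also have "\<dots> \<le> \<bar>a\<bar> * (C * ?t ^ n) + \<bar>b\<bar> * (D * ?t ^ n)"
      by (intro add_mono mult_left_mono exp_varD[OF f' eq] exp_varD[OF g' eq]) auto
    finally show "\<bar>a * f x + b * g x - (a * f y + b * g y)\<bar> \<le> (\<bar>a\<bar> * C + \<bar>b\<bar> * D) * ?t ^ n"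
      by (simp add: algebra_simps)
  qed
  then show ?thesis using f g by (intro holder_if_exp_var[of ?t]) auto
qed

section \<open>Measures on the sequence space\<close>

lemma space_seq_space [simp]: "space seq_space = UNIV"
  by (simp add: seq_space_def space_PiM)

lemma measurable_coord [measurable]: "(\<lambda>x. x i) \<in> seq_space \<rightarrow>\<^sub>M count_space UNIV"
  unfolding seq_space_def by (rule measurable_component_singleton) simp

lemma measurable_trunc: "trunc n \<in> seq_space \<rightarrow>\<^sub>M count_space (range (trunc n :: 'a::finite \<Omega> \<Rightarrow> _))"
proof (subst measurable_count_space_eq2[OF finite_range_trunc], intro conjI ballI)
  fix w :: "'a \<Omega>" assume "w \<in> range (trunc n)"
  then have "trunc n -` {w} \<inter> space seq_space = {x \<in> space seq_space. \<forall>i<n. x i = w i}"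
    by (auto simp: trunc_eq_iff) (auto simp: trunc_def fun_eq_iff split: if_splits)
  also have "\<dots> \<in> sets seq_space" by measurable
  finally show "trunc n -` {w} \<inter> space seq_space \<in> sets seq_space" .
qed auto

lemma measurable_finitary:
  fixes X :: "'a::finite \<Omega> \<Rightarrow> 'b"
  assumes "\<And>x. X (trunc n x) = X x"
  shows "X \<in> seq_space \<rightarrow>\<^sub>M count_space UNIV"
proof -
  have "(\<lambda>x. X (trunc n x)) \<in> seq_space \<rightarrow>\<^sub>M count_space UNIV"
    by (rule measurable_compose[OF measurable_trunc]) auto
  then show ?thesis using assms by simp
qed

lemma cylinders_sets: "A \<in> cylinders \<Longrightarrow> A \<in> sets (seq_space :: 'a::finite \<Omega> measure)"
proof -
  assume "A \<in> cylinders"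
  then obtain n where n: "\<And>x. trunc n x \<in> A \<longleftrightarrow> x \<in> A" by (auto simp: cylinders_def)
  then have [measurable]: "(\<lambda>x. x \<in> A) \<in> seq_space \<rightarrow>\<^sub>M count_space UNIV" by (intro measurable_finitary[of _ n]) simp
  have "{x \<in> space seq_space. x \<in> A} \<in> sets seq_space" by measurable
  then show ?thesis by simp
qed

lemma cylinders_iff: "A \<in> cylinders \<longleftrightarrow> (\<exists>n. \<forall>x y. trunc n x = trunc n y \<longrightarrow> (x \<in> A \<longleftrightarrow> y \<in> A))"
proof
  assume "A \<in> cylinders"
  then show "\<exists>n. \<forall>x y. trunc n x = trunc n y \<longrightarrow> (x \<in> A \<longleftrightarrow> y \<in> A)"
    unfolding cylinders_def mem_Collect_eq by metis
next
  assume "\<exists>n. \<forall>x y. trunc n x = trunc n y \<longrightarrow> (x \<in> A \<longleftrightarrow> y \<in> A)"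
  then obtain n where "\<And>x y. trunc n x = trunc n y \<Longrightarrow> (x \<in> A \<longleftrightarrow> y \<in> A)" by blast
  then have "trunc n x \<in> A \<longleftrightarrow> x \<in> A" for x by (metis trunc_trunc min.idem)
  then show "A \<in> cylinders" unfolding cylinders_def by blast
qed

lemma cylinders_Compl: "A \<in> cylinders \<Longrightarrow> - A \<in> cylinders"
  unfolding cylinders_def by auto

lemma cylinders_Int:
  assumes "A \<in> cylinders" "B \<in> cylinders" shows "A \<inter> B \<in> cylinders"
proof -
  obtain m where m: "\<And>x y. trunc m x = trunc m y \<Longrightarrow> (x \<in> A \<longleftrightarrow> y \<in> A)"
    using assms(1) cylinders_iff by blast
  obtain n where n: "\<And>x y. trunc n x = trunc n y \<Longrightarrow> (x \<in> B \<longleftrightarrow> y \<in> B)"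
    using assms(2) cylinders_iff by blast
  have "x \<in> A \<inter> B \<longleftrightarrow> y \<in> A \<inter> B" if "trunc (max m n) x = trunc (max m n) y" for x y
    using m n trunc_eq_mono[OF that] by (metis IntE IntI max.cobounded1 max.cobounded2)
  then show ?thesis unfolding cylinders_iff by blast
qed

lemma cylinders_UNIV [simp]: "UNIV \<in> cylinders" and cylinders_empty [simp]: "{} \<in> cylinders"
  by (simp_all add: cylinders_def)

lemma cylinders_Un: "A \<in> cylinders \<Longrightarrow> B \<in> cylinders \<Longrightarrow> A \<union> B \<in> cylinders"
  by (metis Compl_Un cylinders_Compl cylinders_Int double_complement)

lemma ucont_indicator: "A \<in> cylinders \<Longrightarrow> ucont (indicator A :: 'a \<Omega> \<Rightarrow> real)"
proof -
  assume "A \<in> cylinders"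
  then obtain n where "\<And>x. trunc n x \<in> A \<longleftrightarrow> x \<in> A" by (auto simp: cylinders_def)
  then have "(indicator A :: 'a \<Omega> \<Rightarrow> real) = (\<lambda>x. indicator A (trunc n x))"
    by (auto simp: indicator_def fun_eq_iff)
  then show ?thesis by (metis ucont_trunc)
qed

lemma algebra_cylinders: "algebra UNIV cylinders"
  unfolding algebra_iff_Int
  by (auto simp: cylinders_Int cylinders_Compl Compl_eq_Diff_UNIV[symmetric])

lemma sets_seq_space: "sets (seq_space :: 'a::finite \<Omega> measure) = sigma_sets UNIV cylinders"
proof
  show "sets (seq_space :: 'a \<Omega> measure) \<subseteq> sigma_sets UNIV cylinders"
    unfolding seq_space_def sets_PiM_single
  proof (simp, intro sigma_sets_mono', safe)
    fix i and A :: "'a set"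
    show "{f. f i \<in> A} \<in> cylinders"
      unfolding cylinders_iff by (intro exI[of _ "Suc i"]) (simp add: trunc_eq_iff)
  qed
  show "sigma_sets UNIV cylinders \<subseteq> sets (seq_space :: 'a \<Omega> measure)"
    using sets.sigma_sets_subset[of cylinders seq_space] cylinders_sets by auto
qed

lemma measurable_left_shift [measurable]: "left_shift \<in> seq_space \<rightarrow>\<^sub>M seq_space"
proof -
  have "left_shift \<in> seq_space \<rightarrow>\<^sub>M Pi\<^sub>M UNIV (\<lambda>_. count_space UNIV)"
    by (rule measurable_PiM_single') (auto simp: left_shift_def)
  then show ?thesis by (simp add: seq_space_def)
qed

lemma borel_measurable_ucont:
  fixes f :: "'a::finite \<Omega> \<Rightarrow> real"
  assumes "ucont f"
  shows "f \<in> borel_measurable seq_space"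
proof (rule borel_measurable_LIMSEQ_real)
  show "(\<lambda>x. f (trunc n x)) \<in> borel_measurable seq_space" for n
    by (rule measurable_compose[OF measurable_trunc]) auto
  show "(\<lambda>n. f (trunc n x)) \<longlonglongrightarrow> f x" for x
  proof (rule LIMSEQ_I)
    fix r :: real assume "r > 0"
    obtain n where n: "\<And>x y. trunc n x = trunc n y \<Longrightarrow> \<bar>f x - f y\<bar> \<le> r/2"
      using ucontD[OF assms, of "r/2"] \<open>r > 0\<close> by auto
    have "\<bar>f (trunc m x) - f x\<bar> < r" if "m \<ge> n" for m
      using n[of "trunc m x" x] that \<open>r > 0\<close> by simp
    then show "\<exists>no. \<forall>m\<ge>no. norm (f (trunc m x) - f x) < r" by auto
  qed
qed

locale seq_prob = prob_space \<mu> for \<mu> :: "'a::finite \<Omega> measure" +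
  assumes sets_eq [measurable_cong]: "sets \<mu> = sets seq_space"
begin

lemma space_eq [simp]: "space \<mu> = UNIV"
  using sets_eq_imp_space_eq[OF sets_eq] by simp

lemma integrable_ucont [simp]:
  assumes "ucont f" shows "integrable \<mu> f"
proof -
  obtain B where "\<And>x. \<bar>f x\<bar> \<le> B" using ucont_bounded[OF assms] by blast
  moreover have "f \<in> borel_measurable \<mu>"
    using borel_measurable_ucont[OF assms] by measurable
  ultimately show ?thesis by (intro integrable_const_bound[of _ B]) auto
qed

lemma prob_UNIV [simp]: "prob UNIV = 1"
  using prob_space by simp

lemma integral_bounds:
  assumes "ucont f"
  shows "(\<And>x. f x \<le> B) \<Longrightarrow> (\<integral>x. f x \<partial>\<mu>) \<le> B" and "(\<And>x. B \<le> f x) \<Longrightarrow> B \<le> (\<integral>x. f x \<partial>\<mu>)"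
  using integral_mono[of \<mu> f "\<lambda>_. B"] integral_mono[of \<mu> "\<lambda>_. B" f] assms by auto

lemma sets_cylinder [measurable]: "A \<in> cylinders \<Longrightarrow> A \<in> sets \<mu>"
  by (simp add: sets_eq cylinders_sets)

end

lemma seq_prob_eqI:
  fixes \<mu> \<nu> :: "'a::finite \<Omega> measure"
  assumes "seq_prob \<mu>" "seq_prob \<nu>"
    and eq: "\<And>A. A \<in> cylinders \<Longrightarrow> measure \<mu> A = measure \<nu> A"
  shows "\<mu> = \<nu>"
proof -
  interpret m: seq_prob \<mu> by fact
  interpret n: seq_prob \<nu> by fact
  show ?thesis
  proof (rule measure_eqI_generator_eq[where E = cylinders and \<Omega> = UNIV and A = "\<lambda>_. UNIV"])
    show "Int_stable cylinders" by (auto simp: Int_stable_def cylinders_Int)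
    show "emeasure \<mu> X = emeasure \<nu> X" if "X \<in> cylinders" for X
      using eq[OF that] by (simp add: m.emeasure_eq_measure n.emeasure_eq_measure)
  qed (auto simp: m.sets_eq n.sets_eq sets_seq_space m.emeasure_eq_measure)
qed

lemma seq_prob_eqI_integral:
  fixes \<mu> \<nu> :: "'a::finite \<Omega> measure"
  assumes "seq_prob \<mu>" "seq_prob \<nu>"
    and eq: "\<And>f. ucont f \<Longrightarrow> (\<integral>x. f x \<partial>\<mu>) = (\<integral>x. f x \<partial>\<nu>)"
  shows "\<mu> = \<nu>"
proof (rule seq_prob_eqI[OF assms(1,2)])
  interpret m: seq_prob \<mu> by fact
  interpret n: seq_prob \<nu> by fact
  show "measure \<mu> A = measure \<nu> A" if "A \<in> cylinders" for A
    using eq[OF ucont_indicator[OF that]] that by simp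
qed

text \<open>
  Caratheodory's extension theorem applies to every finitely additive probability on the
  clopen sets: by compactness a decreasing sequence of clopen sets with empty intersection is
  eventually empty.
\<close>

lemma ex_seq_prob:
  fixes m :: "'a::finite \<Omega> set \<Rightarrow> real"
  assumes nonneg: "\<And>A. A \<in> cylinders \<Longrightarrow> 0 \<le> m A"
    and add: "\<And>A B. A \<in> cylinders \<Longrightarrow> B \<in> cylinders \<Longrightarrow> A \<inter> B = {} \<Longrightarrow> m (A \<union> B) = m A + m B"
    and one: "m UNIV = 1"
  obtains \<mu> where "seq_prob \<mu>" "\<And>A. A \<in> cylinders \<Longrightarrow> measure \<mu> A = m A"
proof -
  interpret C: algebra "UNIV :: 'a \<Omega> set" cylinders by (rule algebra_cylinders)
  have empty: "m {} = 0" using add[of "{}" "{}"] by simp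
  have "\<exists>\<mu>. (\<forall>s\<in>cylinders. \<mu> s = ennreal (m s)) \<and> measure_space UNIV (sigma_sets UNIV cylinders) \<mu>"
  proof (rule C.caratheodory_empty_continuous)
    show "positive cylinders (\<lambda>s. ennreal (m s))" by (simp add: positive_def empty)
    show "additive cylinders (\<lambda>s. ennreal (m s))"
      by (auto simp: additive_def add nonneg)
    show "ennreal (m A) \<noteq> \<infinity>" for A by simp
    fix A :: "nat \<Rightarrow> 'a \<Omega> set"
    assume A: "range A \<subseteq> cylinders" "decseq A" "(\<Inter>i. A i) = {}"
    then obtain n where n: "A n = {}" using cylinders_nested[of A] by auto
    have "A i = {}" if "n \<le> i" for i using decseqD[OF A(2) that] n by auto
    then have "eventually (\<lambda>i. ennreal (m (A i)) = 0) sequentially"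
      using empty by (intro eventually_sequentiallyI[of n]) auto
    then show "(\<lambda>i. ennreal (m (A i))) \<longlonglongrightarrow> 0" by (rule tendsto_eventually)
  qed
  then obtain \<mu>' where \<mu>': "\<And>s. s \<in> cylinders \<Longrightarrow> \<mu>' s = ennreal (m s)"
    and ms: "measure_space UNIV (sigma_sets UNIV cylinders) \<mu>'" by blast
  define \<mu> where "\<mu> = measure_of UNIV (sigma_sets UNIV cylinders) \<mu>'"
  have sets: "sets \<mu> = sets seq_space"
    by (simp add: \<mu>_def sets_seq_space sigma_sets_sigma_sets_eq)
  have em: "emeasure \<mu> A = ennreal (m A)" if "A \<in> cylinders" for A
    using ms that unfolding \<mu>_def
    by (subst emeasure_measure_of_sigma) (auto simp: measure_space_def \<mu>' intro: sigma_sets.Basic)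
  interpret prob_space \<mu>
    by (rule prob_spaceI) (simp add: \<mu>_def space_measure_of_conv em[unfolded \<mu>_def] one)
  have "seq_prob \<mu>" by unfold_locales (rule sets)
  moreover have "measure \<mu> A = m A" if "A \<in> cylinders" for A
    using em[OF that] nonneg[OF that] by (simp add: measure_def)
  ultimately show ?thesis using that by blast
qed

context seq_prob
begin

lemma simple_finite: "simple_function \<mu> X \<Longrightarrow> finite (range X)"
  by (simp add: simple_function_def)

lemma simple_sets [measurable]: "simple_function \<mu> X \<Longrightarrow> {x. X x = v} \<in> sets \<mu>"
proof -
  assume "simple_function \<mu> X"
  then have [measurable]: "X \<in> \<mu> \<rightarrow>\<^sub>M count_space UNIV" by (rule measurable_simple_function)
  have "{x \<in> space \<mu>. X x = v} \<in> sets \<mu>" by measurable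
  then show ?thesis by simp
qed

lemma simple_functionI:
  assumes "finite (range X)" "X \<in> \<mu> \<rightarrow>\<^sub>M count_space UNIV" shows "simple_function \<mu> X"
proof -
  have "X -` {v} \<inter> space \<mu> \<in> sets \<mu>" for v
    by (rule measurable_sets[OF assms(2)]) simp
  moreover have "finite (X ` space \<mu>)" using assms(1) by (simp only: space_eq)
  ultimately show ?thesis unfolding simple_function_def by blast
qed

lemma simple_finitary:
  assumes "\<And>x. X (trunc n x) = X x" shows "simple_function \<mu> X"
proof (rule simple_functionI)
  have "X x \<in> X ` range (trunc n)" for x
    by (rule image_eqI[of _ _ "trunc n x"]) (simp_all add: assms)
  then have "range X \<subseteq> X ` range (trunc n)" by blast
  then show "finite (range X)" by (rule finite_subset) (simp add: finite_range_trunc)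
  show "X \<in> \<mu> \<rightarrow>\<^sub>M count_space UNIV"
    using measurable_finitary[of X, OF assms] by measurable
qed

lemma simple_trunc: "simple_function \<mu> (trunc n)"
  by (rule simple_finitary[of _ n]) simp

lemma simple_map: "simple_function \<mu> X \<Longrightarrow> simple_function \<mu> (\<lambda>x. g (X x))"
  using simple_function_compose[of \<mu> X g] by (simp add: comp_def)

lemma simple_integral_sum:
  fixes X :: "'a \<Omega> \<Rightarrow> 'b" and F :: "'b \<Rightarrow> real"
  assumes X: "simple_function \<mu> X"
  shows "(\<integral>x. F (X x) \<partial>\<mu>) = (\<Sum>v\<in>range X. prob {x. X x = v} * F v)"
    and "integrable \<mu> (\<lambda>x. F (X x))"
proof -
  note S = simple_sets[OF X]
  have *: "F (X x) = (\<Sum>v\<in>range X. indicator {x. X x = v} x * F v)" for x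
  proof -
    have "(\<Sum>v\<in>range X. indicator {x. X x = v} x * F v) = (\<Sum>v\<in>{X x}. indicator {x. X x = v} x * F v)"
      using simple_finite[OF X] by (intro sum.mono_neutral_right) (auto simp: indicator_def)
    then show ?thesis by simp
  qed
  have i: "integrable \<mu> (\<lambda>x. indicator {x. X x = v} x * F v)" for v
    using S by (intro integrable_mult_left integrable_real_indicator) (auto simp: emeasure_eq_measure)
  show "(\<integral>x. F (X x) \<partial>\<mu>) = (\<Sum>v\<in>range X. prob {x. X x = v} * F v)"
    unfolding * using S i by (subst Bochner_Integration.integral_sum) auto
  show "integrable \<mu> (\<lambda>x. F (X x))"
    unfolding * using i by (intro Bochner_Integration.integrable_sum)
qed

lemma measure_sym_diff_triangle:
  assumes [measurable]: "A \<in> sets \<mu>" "B \<in> sets \<mu>" "C \<in> sets \<mu>"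
  shows "prob (sym_diff A C) \<le> prob (sym_diff A B) + prob (sym_diff B C)"
proof -
  have "prob (sym_diff A C) \<le> prob (sym_diff A B \<union> sym_diff B C)"
    by (intro finite_measure_mono) auto
  also have "\<dots> \<le> prob (sym_diff A B) + prob (sym_diff B C)"
    by (intro measure_Un_le) auto
  finally show ?thesis .
qed

text \<open>
  The sets that can be approximated by clopen ones form a \<open>\<sigma>\<close>-algebra: a countable union is
  approximated by a finite one, by continuity of the measure.
\<close>

lemma approx_cylinder:
  assumes "A \<in> sets \<mu>" "e > 0"
  shows "\<exists>B\<in>cylinders. prob (sym_diff A B) < e"
proof -
  have "A \<in> sigma_sets UNIV cylinders" using assms by (simp add: sets_eq sets_seq_space)
  then show ?thesis using assms(2)
  proof (induction arbitrary: e rule: sigma_sets.induct)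
    case (Basic a)
    then show ?case by (intro bexI[of _ a]) auto
  next
    case Empty
    then show ?case by (intro bexI[of _ "{}"]) auto
  next
    case (Compl a)
    then obtain B where B: "B \<in> cylinders" "prob (sym_diff a B) < e" by blast
    have "sym_diff (UNIV - a) (- B) = sym_diff a B" by auto
    with B show ?case by (intro bexI[of _ "- B"]) (auto intro: cylinders_Compl)
  next
    case (Union a)
    have [measurable]: "a i \<in> sets \<mu>" for i using Union.hyps by (simp add: sets_eq sets_seq_space)
    let ?U = "\<lambda>n. \<Union>i<n. a i"
    have fin: "\<exists>B\<in>cylinders. prob (sym_diff (?U n) B) < d" if "d > 0" for n d
      using that
    proof (induction n arbitrary: d)
      case 0
      then show ?case by (intro bexI[of _ "{}"]) auto
    next
      case (Suc n)
      obtain B where B: "B \<in> cylinders" "prob (sym_diff (?U n) B) < d/2"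
        using Suc.IH[of "d/2"] Suc.prems by auto
      obtain B' where B': "B' \<in> cylinders" "prob (sym_diff (a n) B') < d/2"
        using Union.IH[of "d/2" n] Suc.prems by auto
      note [measurable] = B(1) B'(1)
      have "prob (sym_diff (?U (Suc n)) (B \<union> B'))
          \<le> prob (sym_diff (?U n) B \<union> sym_diff (a n) B')"
        by (intro finite_measure_mono) (auto simp: lessThan_Suc)
      also have "\<dots> \<le> prob (sym_diff (?U n) B) + prob (sym_diff (a n) B')"
        by (intro measure_Un_le) auto
      also have "\<dots> < d" using B(2) B'(2) by linarith
      finally show ?case using B(1) B'(1) by (intro bexI[of _ "B \<union> B'"]) (auto intro: cylinders_Un)
    qed
    have lim: "(\<lambda>n. prob (?U n)) \<longlonglongrightarrow> prob (\<Union>n. ?U n)"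
      by (intro finite_Lim_measure_incseq) (auto simp: lessThan_Suc intro!: incseq_SucI)
    have eqU: "(\<Union>n. ?U n) = (\<Union>i. a i)" by auto
    have "eventually (\<lambda>n. prob (\<Union>i. a i) - e/2 < prob (?U n)) sequentially"
      using Union.prems by (intro order_tendstoD(1)[OF lim]) (simp add: eqU)
    then obtain n where "prob (\<Union>i. a i) - e/2 < prob (?U n)"
      by (meson eventually_sequentially order_refl)
    then have n: "prob (\<Union>i. a i) - prob (?U n) < e/2" by linarith
    obtain B where B: "B \<in> cylinders" "prob (sym_diff (?U n) B) < e/2"
      using fin[of "e/2" n] Union.prems by auto
    have "prob (sym_diff (\<Union>i. a i) (?U n)) = prob ((\<Union>i. a i) - ?U n)"
      by (rule arg_cong[where f = "measure \<mu>"]) auto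
    also have "\<dots> = prob (\<Union>i. a i) - prob (?U n)"
      by (intro finite_measure_Diff) auto
    finally have "prob (sym_diff (\<Union>i. a i) (?U n)) < e/2" using n by simp
    moreover have "prob (sym_diff (\<Union>i. a i) B)
        \<le> prob (sym_diff (\<Union>i. a i) (?U n)) + prob (sym_diff (?U n) B)"
      using B(1) by (intro measure_sym_diff_triangle) auto
    ultimately show ?case using B by (intro bexI[of _ B]) linarith+
  qed
qed

text \<open>
  Each fibre of \<open>\<xi>\<close> is close to a clopen set, and \<open>\<zeta>\<close> returns the first value whose clopen set
  contains the point. This agrees with \<open>\<xi>\<close> outside the symmetric differences.
\<close>

lemma approx_finitary:
  fixes \<xi> :: "'a \<Omega> \<Rightarrow> nat"
  assumes \<xi>: "simple_function \<mu> \<xi>" and "d > 0"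
  obtains \<zeta> m where "\<And>x. \<zeta> (trunc m x) = \<zeta> x" "range \<zeta> \<subseteq> range \<xi>" "prob {x. \<xi> x \<noteq> \<zeta> x} < d"
proof -
  define V where "V = range \<xi>"
  have V: "finite V" "V \<noteq> {}" using simple_finite[OF \<xi>] by (auto simp: V_def)
  define d' where "d' = d / card V"
  have "d' > 0" using V \<open>d > 0\<close> by (simp add: d'_def card_gt_0_iff)
  have "\<exists>B\<in>cylinders. prob (sym_diff {x. \<xi> x = v} B) < d'" for v
    by (rule approx_cylinder[OF simple_sets[OF \<xi>] \<open>d' > 0\<close>])
  then obtain B where B: "\<And>v. B v \<in> cylinders" "\<And>v. prob (sym_diff {x. \<xi> x = v} (B v)) < d'"
    by metis
  from B(1) have "\<exists>n. \<forall>x y. trunc n x = trunc n y \<longrightarrow> (x \<in> B v \<longleftrightarrow> y \<in> B v)" for v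
    by (simp add: cylinders_iff)
  then obtain n where n: "\<And>v x y. trunc (n v) x = trunc (n v) y \<Longrightarrow> (x \<in> B v \<longleftrightarrow> y \<in> B v)"
    by metis
  define m where "m = Max (n ` V)"
  have m: "trunc m x \<in> B v \<longleftrightarrow> x \<in> B v" if "v \<in> V" for v x
  proof (rule n)
    have "n v \<le> m" unfolding m_def using that V by (intro Max_ge) auto
    then show "trunc (n v) (trunc m x) = trunc (n v) x" by simp
  qed
  obtain v0 where v0: "v0 \<in> V" using V by auto
  define \<zeta> where "\<zeta> x = (if \<exists>v\<in>V. x \<in> B v then LEAST v. v \<in> V \<and> x \<in> B v else v0)" for x
  have "\<zeta> x \<in> V" for x
  proof (cases "\<exists>v\<in>V. x \<in> B v")
    case True
    then obtain v where "v \<in> V \<and> x \<in> B v" by blast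
    then have "(LEAST v. v \<in> V \<and> x \<in> B v) \<in> V \<and> x \<in> B (LEAST v. v \<in> V \<and> x \<in> B v)" by (rule LeastI)
    with True show ?thesis by (simp add: \<zeta>_def)
  qed (auto simp: \<zeta>_def v0)
  moreover have "\<zeta> (trunc m x) = \<zeta> x" for x
    unfolding \<zeta>_def using m by (auto cong: conj_cong)
  moreover have "prob {x. \<xi> x \<noteq> \<zeta> x} < d"
  proof -
    have S: "sym_diff {x. \<xi> x = v} (B v) \<in> sets \<mu>" for v
    using simple_sets[OF \<xi>] B(1)[of v] by auto
    have sub: "{x. \<xi> x \<noteq> \<zeta> x} \<subseteq> (\<Union>v\<in>V. sym_diff {x. \<xi> x = v} (B v))"
    proof
      fix x assume x: "x \<in> {x. \<xi> x \<noteq> \<zeta> x}"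
      show "x \<in> (\<Union>v\<in>V. sym_diff {x. \<xi> x = v} (B v))"
      proof (rule ccontr)
        assume *: "\<not> ?thesis"
        have in_V: "\<xi> x \<in> V" by (simp add: V_def)
        have "x \<in> B v \<longleftrightarrow> \<xi> x = v" if "v \<in> V" for v
          using * that by blast
        then have eq: "v \<in> V \<and> x \<in> B v \<longleftrightarrow> v = \<xi> x" for v using in_V by metis
        have "(LEAST v. v \<in> V \<and> x \<in> B v) = \<xi> x"
          unfolding eq by (rule Least_equality) simp_all
        moreover have "\<exists>v\<in>V. x \<in> B v" using eq by blast
        ultimately have "\<zeta> x = \<xi> x" by (simp add: \<zeta>_def)
        then show False using x by simp
      qed
    qed
    have "prob {x. \<xi> x \<noteq> \<zeta> x} \<le> prob (\<Union>v\<in>V. sym_diff {x. \<xi> x = v} (B v))"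
      by (intro finite_measure_mono sub sets.finite_UN V S)
    also have "\<dots> \<le> (\<Sum>v\<in>V. prob (sym_diff {x. \<xi> x = v} (B v)))"
      using V S by (intro finite_measure_subadditive_finite) auto
    also have "\<dots> < (\<Sum>v\<in>V. d')" using V B(2) by (intro sum_strict_mono) auto
    also have "\<dots> = d" using V by (simp add: d'_def)
    finally show ?thesis .
  qed
  ultimately show ?thesis using that[of \<zeta> m] unfolding V_def by blast
qed

end

locale shift_inv = seq_prob +
  assumes inv: "distr \<mu> \<mu> left_shift = \<mu>"
begin

lemma integral_left_shift:
  fixes f :: "_ \<Rightarrow> real"
  assumes [measurable]: "f \<in> borel_measurable \<mu>"
  shows "(\<integral>x. f (left_shift x) \<partial>\<mu>) = (\<integral>x. f x \<partial>\<mu>)"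
proof -
  have "(\<integral>x. f x \<partial>\<mu>) = (\<integral>x. f x \<partial>distr \<mu> \<mu> left_shift)" by (simp add: inv)
  also have "\<dots> = (\<integral>x. f (left_shift x) \<partial>\<mu>)"
    by (subst integral_distr) (auto intro: measurable_left_shift)
  finally show ?thesis ..
qed

lemma measure_left_shift:
  assumes "A \<in> sets \<mu>" shows "measure \<mu> {x. left_shift x \<in> A} = measure \<mu> A"
proof -
  have "measure \<mu> A = measure (distr \<mu> \<mu> left_shift) A" by (simp add: inv)
  also have "\<dots> = measure \<mu> (left_shift -` A \<inter> space \<mu>)" using assms by (subst measure_distr) auto
  also have "left_shift -` A \<inter> space \<mu> = {x. left_shift x \<in> A}" by auto
  finally show ?thesis ..
qed

end

lemma invariant_prob_iff: "invariant_prob \<mu> \<longleftrightarrow> shift_inv \<mu>"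
  by (auto simp: invariant_prob_def shift_inv_def shift_inv_axioms_def seq_prob_def seq_prob_axioms_def)

section \<open>Transfer operators of Jacobians\<close>

definition transfer :: "('a::finite \<Omega> \<Rightarrow> real) \<Rightarrow> ('a \<Omega> \<Rightarrow> real) \<Rightarrow> 'a \<Omega> \<Rightarrow> real" where
  "transfer J f x = (\<Sum>a\<in>UNIV. J (scons a x) * f (scons a x))"

lemma ruelle_ln: "(\<And>x. J x > 0) \<Longrightarrow> ruelle (\<lambda>x. ln (J x)) = transfer J"
  by (simp add: fun_eq_iff ruelle_scons transfer_def)

lemma ucont_transfer: "ucont J \<Longrightarrow> ucont f \<Longrightarrow> ucont (transfer J f)"
  unfolding transfer_def[abs_def] by (intro ucont_sum ucont_mult ucont_scons)

lemma transfer_pow_add: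
  "(transfer J ^^ n) (\<lambda>x. f x + g x) x = (transfer J ^^ n) f x + (transfer J ^^ n) g x"
  by (induction n arbitrary: x) (simp_all add: transfer_def sum.distrib distrib_left)

lemma transfer_pow_cmult:
  "(transfer J ^^ n) (\<lambda>x. c * f x) x = c * (transfer J ^^ n) f x"
  by (induction n arbitrary: x) (simp_all add: transfer_def sum_distrib_left mult_ac)

lemma ucont_transfer_pow: "ucont J \<Longrightarrow> ucont f \<Longrightarrow> ucont ((transfer J ^^ n) f)"
  by (induction n) (simp_all add: ucont_transfer)

subsection \<open>Oscillation on cylinders\<close>

definition osc :: "nat \<Rightarrow> ('a \<Omega> \<Rightarrow> real) \<Rightarrow> real" where
  "osc n f = (SUP p\<in>{(x, y). trunc n x = trunc n y}. f (fst p) - f (snd p))"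

lemma osc_least:
  assumes "\<And>x y. trunc n x = trunc n y \<Longrightarrow> f x - f y \<le> b"
  shows "osc n f \<le> b"
  unfolding osc_def by (rule cSUP_least) (use assms in auto)

lemma osc_upper:
  fixes f :: "'a::finite \<Omega> \<Rightarrow> real"
  assumes "ucont f" "trunc n x = trunc n y"
  shows "f x - f y \<le> osc n f"
proof -
  obtain B where B: "\<And>x. \<bar>f x\<bar> \<le> B" using ucont_bounded[OF assms(1)] by blast
  have "bdd_above ((\<lambda>p. f (fst p) - f (snd p)) ` {(x, y). trunc n x = trunc n y})"
  proof (rule bdd_aboveI)
    fix z assume "z \<in> (\<lambda>p. f (fst p) - f (snd p)) ` {(x, y). trunc n x = trunc n y}"
    then obtain x y where "z = f x - f y" by auto
    then show "z \<le> 2 * B" using B[of x] B[of y] by linarith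
  qed
  from cSUP_upper[OF _ this, of "(x, y)"] show ?thesis
    unfolding osc_def using assms(2) by simp
qed

lemma osc_nonneg:
  fixes f :: "'a::finite \<Omega> \<Rightarrow> real"
  shows "ucont f \<Longrightarrow> 0 \<le> osc n f"
  using osc_upper[of f n undefined undefined] by simp

lemma osc_antimono:
  fixes f :: "'a::finite \<Omega> \<Rightarrow> real"
  assumes "ucont f" "m \<le> n" shows "osc n f \<le> osc m f"
  by (intro osc_least osc_upper assms) (rule trunc_eq_mono[OF _ assms(2)])

lemma osc_tendsto_0:
  fixes f :: "'a::finite \<Omega> \<Rightarrow> real"
  assumes "ucont f" shows "(\<lambda>n. osc n f) \<longlonglongrightarrow> 0"
proof (rule LIMSEQ_I)
  fix r :: real assume "r > 0"
  then obtain n where n: "\<And>x y. trunc n x = trunc n y \<Longrightarrow> \<bar>f x - f y\<bar> \<le> r/2"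
    using ucontD[OF assms, of "r/2"] by auto
  have "osc n f \<le> r/2" by (rule osc_least) (use n in \<open>fastforce dest: abs_le_D1\<close>)
  then have "norm (osc m f - 0) < r" if "m \<ge> n" for m
    using osc_antimono[OF assms that] osc_nonneg[OF assms, of m] \<open>r > 0\<close> by auto
  then show "\<exists>no. \<forall>m\<ge>no. norm (osc m f - 0) < r" by blast
qed

locale jacobian =
  fixes J :: "'a::finite \<Omega> \<Rightarrow> real"
  assumes holder_J: "holder_jacobian J"
begin

abbreviation L :: "('a \<Omega> \<Rightarrow> real) \<Rightarrow> 'a \<Omega> \<Rightarrow> real" where
  "L \<equiv> transfer J"

abbreviation \<mu>J :: "'a \<Omega> measure" where
  "\<mu>J \<equiv> jacobian_measure J"

lemma pos [simp]: "0 < J x" and less_1: "J x < 1"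
  using holder_J by (auto simp: holder_jacobian_def)

lemma nonneg [simp]: "0 \<le> J x"
  using pos[of x] by linarith

lemma ruelle_eq_transfer: "ruelle (\<lambda>x. ln (J x)) = transfer J"
  by (rule ruelle_ln) simp

lemma sum_eq_1: "(\<Sum>a\<in>UNIV. J (scons a x)) = 1"
proof -
  have "ruelle (\<lambda>x. ln (J x)) (\<lambda>_. 1) x = 1"
    using holder_J unfolding holder_jacobian_def by metis
  then show ?thesis by (simp add: ruelle_eq_transfer transfer_def)
qed

lemma transfer_const [simp]: "L (\<lambda>_. c) = (\<lambda>_. c)"
  by (simp add: transfer_def fun_eq_iff sum_distrib_right[symmetric] sum_eq_1)

lemma transfer_pow_const [simp]: "(L ^^ n) (\<lambda>_. c) = (\<lambda>_. c)"
  by (induction n) simp_all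

lemma holder_potential_J: "holder_potential J"
  using holder_J by (simp add: holder_jacobian_def)

lemma ucont_J: "ucont J"
  by (rule ucont_if_holder[OF holder_potential_J])

lemma ucont_ln_J: "ucont (\<lambda>x. ln (J x))"
  by (intro ucont_ln ucont_J pos)

lemma lower_bound: obtains d where "0 < d" "d < 1" "\<And>x. d \<le> J x"
proof -
  obtain B where B: "\<And>x. \<bar>ln (J x)\<bar> \<le> B" using ucont_bounded[OF ucont_ln_J] by blast
  have "exp (- B) \<le> J x" for x
  proof -
    have "- B \<le> ln (J x)" using B[of x] by (simp add: abs_le_iff)
    then have "exp (- B) \<le> exp (ln (J x))" by (simp only: exp_le_cancel_iff)
    then show ?thesis by simp
  qed
  moreover from this[of undefined] have "exp (- B) < 1" using less_1[of undefined] by linarith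
  ultimately show ?thesis using that[of "exp (- B)"] by simp
qed

lemma holder_ln_J: obtains C \<theta> where "0 < \<theta>" "\<theta> < 1" "0 \<le> C" "exp_var C \<theta> (\<lambda>x. ln (J x))"
proof -
  obtain d where d: "0 < d" "d < 1" "\<And>x. d \<le> J x" by (rule lower_bound) blast
  obtain C \<theta> where c: "0 < \<theta>" "\<theta> < 1" "0 \<le> C" "exp_var C \<theta> J"
    by (rule exp_var_if_holder[OF holder_potential_J]) blast
  have ln_le: "ln (J x) - ln (J y) \<le> \<bar>J x - J y\<bar> / d" for x y
  proof -
    have "ln (J x) - ln (J y) = ln (J x / J y)" by (simp add: ln_divide_pos)
    also have "\<dots> \<le> J x / J y - 1" by (intro ln_le_minus_one) simp
    also have "\<dots> = (J x - J y) / J y" by (simp add: diff_divide_distrib less_imp_neq[OF pos, symmetric])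
    also have "\<dots> \<le> \<bar>J x - J y\<bar> / d" using d by (intro frac_le) auto
    finally show ?thesis .
  qed
  have "exp_var (C / d) \<theta> (\<lambda>x. ln (J x))"
    unfolding exp_var_def
  proof (intro allI impI)
    fix n x y assume eq: "trunc n x = (trunc n y :: 'a \<Omega>)"
    have "\<bar>ln (J x) - ln (J y)\<bar> \<le> \<bar>J x - J y\<bar> / d"
      using ln_le[of x y] ln_le[of y x] by (simp add: abs_minus_commute abs_le_iff)
    also have "\<dots> \<le> C * \<theta> ^ n / d" using exp_varD[OF c(4) eq] d by (intro divide_right_mono) auto
    finally show "\<bar>ln (J x) - ln (J y)\<bar> \<le> C / d * \<theta> ^ n" by simp
  qed
  then show ?thesis using that c d by (metis divide_nonneg_pos)
qed

lemma holder_potential_ln_J: "holder_potential (\<lambda>x. ln (J x))"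
  by (rule holder_ln_J) (rule holder_if_exp_var)

lemma two_letters: "2 \<le> CARD('a)"
proof (rule ccontr)
  assume "\<not> 2 \<le> CARD('a)"
  then have "CARD('a) = 1" using zero_less_card_finite[where 'a = 'a] by linarith
  then obtain b :: 'a where b: "UNIV = {b}" by (auto simp: card_1_singleton_iff)
  have "J (scons b undefined) = 1" using sum_eq_1[of undefined] unfolding b by simp
  then show False using less_1[of "scons b undefined"] by simp
qed

abbreviation overlap :: "'a \<Omega> \<Rightarrow> 'a \<Omega> \<Rightarrow> real" where
  "overlap x y \<equiv> (\<Sum>a\<in>UNIV. min (J (scons a x)) (J (scons a y)))"

text \<open>
  The transition probabilities \<open>J (a x)\<close> and \<open>J (a y)\<close> from two sequences that agree on \<open>k\<close>
  letters can be coupled so that with probability at least \<open>1 - b k\<close> the same letter is prepended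
  to both of them. Hence the length of agreement dominates a Markov chain that moves from \<open>k\<close> to
  \<open>k + 1\<close> with probability \<open>1 - b k\<close> and otherwise falls back to \<open>0\<close>.
\<close>

lemma coupling:
  obtains b D \<theta> where "\<And>k. 0 \<le> b k" "\<And>k. b k < 1" "0 < \<theta>" "\<theta> < 1" "0 \<le> D" "\<And>k. b k \<le> D * \<theta> ^ k"
    "\<And>k x y. trunc k x = trunc k y \<Longrightarrow> 1 - b k \<le> overlap x y"
proof -
  obtain d where d: "0 < d" "d < 1" "\<And>x. d \<le> J x" by (rule lower_bound) blast
  obtain C \<theta> where c: "0 < \<theta>" "\<theta> < 1" "0 \<le> C" "exp_var C \<theta> J"
    by (rule exp_var_if_holder[OF holder_potential_J]) blast
  let ?N = "real CARD('a)"
  define b where "b k = min (1 - d) (?N * C * \<theta> ^ k)" for k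
  have "1 - b k \<le> overlap x y" if "trunc k x = trunc k y" for k x y
  proof -
    have "d \<le> ?N * d" using d(1) by (simp add: Suc_leI)
    also have "\<dots> \<le> (\<Sum>a\<in>(UNIV::'a set). min (J (scons a x)) (J (scons a y)))"
      using d(3) sum_mono[of UNIV "\<lambda>_. d" "\<lambda>a::'a. min (J (scons a x)) (J (scons a y))"] by simp
    finally have 1: "d \<le> overlap x y" .
    have "J (scons a x) - C * \<theta> ^ k \<le> min (J (scons a x)) (J (scons a y))" for a
    proof -
      have "trunc (Suc k) (scons a x) = trunc (Suc k) (scons a y)" using that by (simp add: trunc_scons)
      then have "trunc k (scons a x) = trunc k (scons a y)" by (rule trunc_eq_mono) simp
      from exp_varD[OF c(4) this] show ?thesis using c by (auto simp: min_def)
    qed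
    then have "(\<Sum>a\<in>UNIV. J (scons a x) - C * \<theta> ^ k) \<le> overlap x y"
      by (intro sum_mono)
    then have 2: "1 - ?N * C * \<theta> ^ k \<le> overlap x y"
      by (simp add: sum_subtractf sum_eq_1)
    show ?thesis using 1 2 by (auto simp: b_def min_def)
  qed
  moreover have "0 \<le> b k" "b k < 1" "b k \<le> ?N * C * \<theta> ^ k" for k
    using c d by (auto simp: b_def)
  ultimately show ?thesis using that[of b \<theta> "?N * C"] c by force
qed

lemma osc_transfer_coupled:
  assumes f: "ucont f"
    and c: "\<And>x y :: 'a \<Omega>. trunc k x = trunc k y \<Longrightarrow> 1 - b \<le> overlap x y"
  shows "osc k (L f) \<le> (1 - b) * osc (Suc k) f + b * osc 0 f"
proof (rule osc_least)
  fix x y :: "'a \<Omega>" assume eq: "trunc k x = trunc k y"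
  define m where "m a = min (J (scons a x)) (J (scons a y))" for a
  define M where "M = (\<Sum>a\<in>UNIV. m a)"
  define S where "S = Max (range (\<lambda>a. f (scons a x)))"
  have S: "f (scons a x) \<le> S" for a unfolding S_def by (rule Max_ge) auto
  have "S \<in> range (\<lambda>a. f (scons a x))" unfolding S_def by (rule Max_in) auto
  then obtain a0 where a0: "S = f (scons a0 x)" by auto
  have low: "S - osc 0 f \<le> f (scons a y)" for a
    using osc_upper[OF f trunc_0_eq, of "scons a0 x" "scons a y"] a0 by linarith
  have "L f x = (\<Sum>a\<in>UNIV. m a * f (scons a x)) + (\<Sum>a\<in>UNIV. (J (scons a x) - m a) * f (scons a x))"
    by (simp add: transfer_def sum.distrib[symmetric] algebra_simps)
  also have "\<dots> \<le> (\<Sum>a\<in>UNIV. m a * f (scons a x)) + (\<Sum>a\<in>UNIV. (J (scons a x) - m a) * S)"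
    by (intro add_mono sum_mono mult_left_mono S order_refl) (simp add: m_def)
  also have "(\<Sum>a\<in>UNIV. (J (scons a x) - m a) * S) = (1 - M) * S"
    by (simp add: sum_distrib_right[symmetric] sum_subtractf sum_eq_1 M_def)
  finally have 1: "L f x \<le> (\<Sum>a\<in>UNIV. m a * f (scons a x)) + (1 - M) * S" .
  have "(1 - M) * (S - osc 0 f) = (\<Sum>a\<in>UNIV. (J (scons a y) - m a) * (S - osc 0 f))"
    by (simp add: sum_distrib_right[symmetric] sum_subtractf sum_eq_1 M_def)
  also have "\<dots> \<le> (\<Sum>a\<in>UNIV. (J (scons a y) - m a) * f (scons a y))"
    by (intro sum_mono mult_left_mono low) (simp add: m_def)
  also have "\<dots> = L f y - (\<Sum>a\<in>UNIV. m a * f (scons a y))"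
    by (simp add: transfer_def sum_subtractf[symmetric] algebra_simps)
  finally have 2: "(1 - M) * (S - osc 0 f) \<le> L f y - (\<Sum>a\<in>UNIV. m a * f (scons a y))" .
  have "(\<Sum>a\<in>UNIV. m a * f (scons a x)) - (\<Sum>a\<in>UNIV. m a * f (scons a y))
      = (\<Sum>a\<in>UNIV. m a * (f (scons a x) - f (scons a y)))"
    by (simp add: sum_subtractf[symmetric] algebra_simps)
  also have "\<dots> \<le> (\<Sum>a\<in>UNIV. m a * osc (Suc k) f)"
    by (intro sum_mono mult_left_mono osc_upper f) (simp_all add: m_def trunc_scons eq)
  also have "\<dots> = M * osc (Suc k) f" by (simp add: M_def sum_distrib_right)
  finally have 3: "(\<Sum>a\<in>UNIV. m a * f (scons a x)) - (\<Sum>a\<in>UNIV. m a * f (scons a y)) \<le> M * osc (Suc k) f" .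
  have "L f x - L f y \<le> M * osc (Suc k) f + (1 - M) * osc 0 f"
    using 1 2 3 by (simp add: algebra_simps)
  also have "\<dots> = (1 - b) * osc (Suc k) f + b * osc 0 f - (M - (1 - b)) * (osc 0 f - osc (Suc k) f)"
    by (simp add: algebra_simps)
  also have "\<dots> \<le> (1 - b) * osc (Suc k) f + b * osc 0 f"
    using c[OF eq] osc_antimono[OF f, of 0 "Suc k"] by (simp add: M_def m_def)
  finally show "L f x - L f y \<le> (1 - b) * osc (Suc k) f + b * osc 0 f" .
qed

lemma osc_transfer_le:
  assumes "ucont f" shows "osc 0 (L f) \<le> osc 0 f"
proof -
  have "0 \<le> overlap x y" for x y
    by (intro sum_nonneg) simp
  then show ?thesis using osc_transfer_coupled[OF assms, of 0 1] by simp
qed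

text \<open>
  The dominating chain escapes to infinity because \<open>b\<close> is summable and \<open>b k < 1\<close>, so the
  oscillation of the iterates vanishes in the limit. If \<open>v\<close> is the limit of the oscillations and
  \<open>T m\<close> bounds the oscillation of all iterates on cylinders of length \<open>m\<close>, then \<open>m\<close> coupled steps,
  which succeed with a positive probability \<open>P\<close>, give \<open>v \<le> P * T m + (1 - P) * v\<close>, that is
  \<open>v \<le> T m\<close>.
\<close>

lemma osc_transfer_pow_tendsto_0:
  assumes f: "ucont f"
  shows "(\<lambda>n. osc 0 ((L ^^ n) f)) \<longlonglongrightarrow> 0"
proof -
  obtain b D \<theta> where b: "\<And>k. 0 \<le> b k" "\<And>k. b k < 1" "0 < \<theta>" "\<theta> < 1" "0 \<le> D" "\<And>k. b k \<le> D * \<theta> ^ k"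
    and c: "\<And>k x y. trunc k x = trunc k y \<Longrightarrow> 1 - b k \<le> overlap x y"
    by (rule coupling) blast
  note uc = ucont_transfer_pow[OF ucont_J]
  have step: "osc k (L g) \<le> (1 - b k) * osc (Suc k) g + b k * osc 0 g" if "ucont g" for g k
    by (rule osc_transfer_coupled[OF that c])
  note mono = osc_transfer_le
  define v where "v n = osc 0 ((L ^^ n) f)" for n
  have v_Suc: "v (Suc n) \<le> v n" for n unfolding v_def using mono[OF uc[OF f]] by simp
  have "decseq v" by (rule decseq_SucI) (rule v_Suc)
  moreover have v_nonneg: "0 \<le> v n" for n unfolding v_def by (intro osc_nonneg uc f)
  ultimately obtain l where l: "v \<longlonglongrightarrow> l" using decseq_convergent[of v 0] by metis
  \<comment> \<open>\<open>t m\<close> bounds the sum of \<open>b k\<close> over \<open>k \<ge> m\<close>.\<close>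
  define t where "t m = D * \<theta> ^ m / (1 - \<theta>)" for m
  have t_Suc: "b m + t (Suc m) \<le> t m" for m
  proof -
    have "t m - t (Suc m) = D * \<theta> ^ m"
      using b(4) by (simp add: t_def diff_divide_distrib[symmetric]) (simp add: field_simps)
    then show ?thesis using b(6)[of m] by linarith
  qed
  have t_nonneg: "0 \<le> t m" for m using b by (simp add: t_def)
  define T where "T m = osc m f + t m * osc 0 f" for m
  have equi: "osc m ((L ^^ n) f) \<le> T m" for m n
  proof (induction n arbitrary: m)
    case 0
    then show ?case using t_nonneg osc_nonneg[OF f, of 0] by (simp add: T_def)
  next
    case (Suc n)
    let ?g = "(L ^^ n) f"
    have "osc m ((L ^^ Suc n) f) \<le> (1 - b m) * osc (Suc m) ?g + b m * osc 0 ?g"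
      using step[OF uc[OF f]] by simp
    also have "\<dots> \<le> 1 * T (Suc m) + b m * osc 0 f"
    proof (intro add_mono mult_mono Suc.IH)
      have "v n \<le> v 0" using \<open>decseq v\<close> by (simp add: decseq_def)
      then show "osc 0 ?g \<le> osc 0 f" by (simp add: v_def)
      show "0 \<le> osc (Suc m) ?g" "0 \<le> osc 0 ?g" by (intro osc_nonneg uc f)+
    qed (use b in auto)
    also have "\<dots> = osc (Suc m) f + (b m + t (Suc m)) * osc 0 f" by (simp add: T_def algebra_simps)
    also have "\<dots> \<le> T m"
      unfolding T_def using osc_antimono[OF f, of m "Suc m"] t_Suc osc_nonneg[OF f, of 0]
      by (intro add_mono mult_right_mono) auto
    finally show ?case .
  qed
  define P where "P m = (\<Prod>j<m. 1 - b j)" for m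
  have P: "0 < P m" "P m \<le> 1" for m
    unfolding P_def using b by (auto intro!: prod_pos prod_le_1 simp: less_imp_le)
  have iter: "osc 0 ((L ^^ m) g) \<le> P m * osc m g + (1 - P m) * osc 0 g" if "ucont g" for m g
    using that
  proof (induction m arbitrary: g)
    case 0
    then show ?case by (simp add: P_def)
  next
    case (Suc m)
    have Tg: "ucont (L g)" by (intro ucont_transfer ucont_J Suc.prems)
    have "osc 0 ((L ^^ Suc m) g) \<le> P m * osc m (L g) + (1 - P m) * osc 0 (L g)"
      using Suc.IH[OF Tg] by (simp add: funpow_swap1)
    also have "\<dots> \<le> P m * ((1 - b m) * osc (Suc m) g + b m * osc 0 g) + (1 - P m) * osc 0 g"
      using P[of m] by (intro add_mono mult_left_mono step mono Suc.prems) auto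
    also have "\<dots> = P (Suc m) * osc (Suc m) g + (1 - P (Suc m)) * osc 0 g"
      by (simp add: P_def algebra_simps)
    finally show ?case .
  qed
  have l_le: "l \<le> T m" for m
  proof -
    have "v (n + m) \<le> P m * T m + (1 - P m) * v n" for n
    proof -
      have "v (n + m) = osc 0 ((L ^^ m) ((L ^^ n) f))"
        by (simp add: v_def funpow_add add.commute[of n m])
      also have "\<dots> \<le> P m * osc m ((L ^^ n) f) + (1 - P m) * v n"
        using iter[OF uc[OF f]] by (simp add: v_def)
      also have "\<dots> \<le> P m * T m + (1 - P m) * v n"
        using equi P[of m] by (intro add_mono mult_left_mono) auto
      finally show ?thesis .
    qed
    moreover have "(\<lambda>n. v (n + m)) \<longlonglongrightarrow> l" using l by (rule LIMSEQ_ignore_initial_segment)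
    moreover have "(\<lambda>n. P m * T m + (1 - P m) * v n) \<longlonglongrightarrow> P m * T m + (1 - P m) * l"
      by (intro tendsto_intros l)
    ultimately have "l \<le> P m * T m + (1 - P m) * l" by (intro LIMSEQ_le) auto
    then have "P m * l \<le> P m * T m" by (simp add: algebra_simps)
    then show ?thesis using P[of m] by simp
  qed
  have "T \<longlonglongrightarrow> 0 + D * 0 / (1 - \<theta>) * osc 0 f"
    unfolding T_def[abs_def] t_def using b
    by (intro tendsto_intros osc_tendsto_0 f LIMSEQ_power_zero) auto
  then have "l \<le> 0" using l_le by (intro LIMSEQ_le_const) auto
  moreover have "0 \<le> l" using l v_nonneg by (intro LIMSEQ_le_const) auto
  ultimately have "l = 0" by simp
  with l show ?thesis by (simp add: v_def[abs_def])
qed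

subsection \<open>The invariant measure of a Jacobian\<close>

lemma transfer_mono: "(\<And>x. f x \<le> g x) \<Longrightarrow> L f x \<le> L g x"
  unfolding transfer_def by (intro sum_mono mult_left_mono) auto

lemma transfer_pow_mono: "(\<And>x. f x \<le> g x) \<Longrightarrow> (L ^^ n) f x \<le> (L ^^ n) g x"
  by (induction n arbitrary: x) (auto intro: transfer_mono)

lemma transfer_pow_near:
  assumes "\<And>x. \<bar>f x - c\<bar> \<le> e" shows "\<bar>(L ^^ n) f x - c\<bar> \<le> e"
proof -
  have 1: "c - e \<le> f x" and 2: "f x \<le> c + e" for x using assms[of x] by (simp_all add: abs_le_iff)
  have "c - e \<le> (L ^^ n) f x" "(L ^^ n) f x \<le> c + e"
    using transfer_pow_mono[of "\<lambda>_. c - e" f n x, OF 1] transfer_pow_mono[of f "\<lambda>_. c + e" n x, OF 2] by simp_all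
  then show ?thesis by linarith
qed

text \<open>
  The iterates converge uniformly to a constant, so the point at which they are evaluated is
  arbitrary.
\<close>

definition limit_value :: "('a \<Omega> \<Rightarrow> real) \<Rightarrow> real" where
  "limit_value f = lim (\<lambda>n. (L ^^ n) f undefined)"

lemma limit_value_bound:
  assumes f: "ucont f"
  shows "\<bar>(L ^^ n) f x - limit_value f\<bar> \<le> osc 0 ((L ^^ n) f)"
    and "(\<lambda>n. (L ^^ n) f x) \<longlonglongrightarrow> limit_value f"
proof -
  note uc = ucont_transfer_pow[OF ucont_J f]
  let ?v = "\<lambda>n. osc 0 ((L ^^ n) f)"
  have near: "\<bar>(L ^^ p) f x - (L ^^ n) f y\<bar> \<le> ?v n" if "n \<le> p" for n p x y
  proof -
    have "\<bar>(L ^^ n) f z - (L ^^ n) f y\<bar> \<le> ?v n" for z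
    proof -
      have "(L ^^ n) f z - (L ^^ n) f y \<le> ?v n"
        "(L ^^ n) f y - (L ^^ n) f z \<le> ?v n"
        by (rule osc_upper[OF uc trunc_0_eq])+
      then show ?thesis by (simp add: abs_le_iff)
    qed
    from transfer_pow_near[OF this, where n = "p - n" and x = x]
    have "\<bar>((L ^^ (p - n)) \<circ> (L ^^ n)) f x - (L ^^ n) f y\<bar> \<le> ?v n" by simp
    then show ?thesis using that by (simp flip: funpow_add)
  qed
  have "Cauchy (\<lambda>n. (L ^^ n) f undefined)"
  proof (rule CauchyI')
    fix e :: real assume "e > 0"
    then obtain n where n: "?v n < e"
      using eventually_happens[OF order_tendstoD(2)[OF osc_transfer_pow_tendsto_0[OF f]], of e] by auto
    have vd: "?v p \<le> ?v n" if "n \<le> p" for p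
    proof -
      have "?v (n + k) \<le> ?v n" for k
      proof (induction k)
        case (Suc k)
        then show ?case using osc_transfer_le[OF uc, of "n + k"] by simp
      qed simp
      then show ?thesis using that by (metis le_add_diff_inverse)
    qed
    show "\<exists>M. \<forall>m\<ge>M. \<forall>n>m. dist ((L ^^ m) f undefined) ((L ^^ n) f undefined) < e"
    proof (intro exI[of _ n] allI impI)
      fix m p assume "m \<ge> n" "p > m"
      then show "dist ((L ^^ m) f undefined) ((L ^^ p) f undefined) < e"
        using near[of m p undefined undefined] vd[of m] n by (simp add: dist_real_def abs_minus_commute)
    qed
  qed
  then have lim: "(\<lambda>n. (L ^^ n) f undefined) \<longlonglongrightarrow> limit_value f"
    unfolding limit_value_def by (simp add: convergent_LIMSEQ_iff[symmetric] Cauchy_convergent)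
  have bound: "\<bar>(L ^^ n) f x - limit_value f\<bar> \<le> ?v n" for n x
  proof (rule LIMSEQ_le_const2)
    show "(\<lambda>p. \<bar>(L ^^ n) f x - (L ^^ p) f undefined\<bar>) \<longlonglongrightarrow> \<bar>(L ^^ n) f x - limit_value f\<bar>"
      by (intro tendsto_intros lim)
    show "\<exists>N. \<forall>p\<ge>N. \<bar>(L ^^ n) f x - (L ^^ p) f undefined\<bar> \<le> ?v n"
      using near[of n _ undefined x] by (intro exI[of _ n]) (simp add: abs_minus_commute)
  qed
  then show "\<bar>(L ^^ n) f x - limit_value f\<bar> \<le> ?v n" .
  have "(\<lambda>n. (L ^^ n) f x - limit_value f) \<longlonglongrightarrow> 0"
    by (rule Lim_null_comparison[OF _ osc_transfer_pow_tendsto_0[OF f]]) (simp add: bound)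
  then show "(\<lambda>n. (L ^^ n) f x) \<longlonglongrightarrow> limit_value f" by (simp add: LIM_zero_iff)
qed

lemma limit_value_eqI:
  "ucont f \<Longrightarrow> (\<lambda>n. (L ^^ n) f x) \<longlonglongrightarrow> l \<Longrightarrow> limit_value f = l"
  using limit_value_bound(2) LIMSEQ_unique by blast

lemma limit_value_add:
  assumes "ucont f" "ucont g"
  shows "limit_value (\<lambda>x. f x + g x) = limit_value f + limit_value g"
  using assms limit_value_bound(2)[of _ undefined]
  by (intro limit_value_eqI[of _ undefined] ucont_add) (auto simp: transfer_pow_add intro!: tendsto_add)

lemma limit_value_cmult:
  assumes "ucont f" shows "limit_value (\<lambda>x. c * f x) = c * limit_value f"
  using assms limit_value_bound(2)[of _ undefined]
  by (intro limit_value_eqI[of _ undefined] ucont_cmult) (auto simp: transfer_pow_cmult intro!: tendsto_mult_left)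

lemma limit_value_const [simp]: "limit_value (\<lambda>_. c) = c"
  by (rule limit_value_eqI[of _ undefined]) auto

lemma limit_value_sum:
  "(\<And>i. i \<in> I \<Longrightarrow> ucont (f i)) \<Longrightarrow> limit_value (\<lambda>x. \<Sum>i\<in>I. f i x) = (\<Sum>i\<in>I. limit_value (f i))"
  by (induction I rule: infinite_finite_induct) (auto simp: limit_value_add ucont_sum)

lemma limit_value_mono:
  assumes "ucont f" "ucont g" "\<And>x. f x \<le> g x" shows "limit_value f \<le> limit_value g"
  by (rule LIMSEQ_le[OF limit_value_bound(2)[OF assms(1)] limit_value_bound(2)[OF assms(2)]])
     (auto intro!: transfer_pow_mono assms(3))

lemma limit_value_transfer:
  assumes "ucont f" shows "limit_value (L f) = limit_value f"
proof (rule limit_value_eqI)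
  show "ucont (L f)" by (intro ucont_transfer ucont_J assms)
  have "(\<lambda>n. (L ^^ Suc n) f undefined) \<longlonglongrightarrow> limit_value f"
    by (rule LIMSEQ_Suc[OF limit_value_bound(2)[OF assms]])
  then show "(\<lambda>n. (L ^^ n) (L f) undefined) \<longlonglongrightarrow> limit_value f"
    by (simp add: funpow_swap1)
qed

lemma transfer_left_shift: "L (\<lambda>x. f (left_shift x)) = f"
  by (simp add: transfer_def fun_eq_iff sum_distrib_right[symmetric] sum_eq_1)

lemma limit_value_left_shift:
  assumes "ucont f" shows "limit_value (\<lambda>x. f (left_shift x)) = limit_value f"
  using limit_value_transfer[OF ucont_left_shift[OF assms]] by (simp add: transfer_left_shift)

text \<open>
  The limit is a positive normalized linear functional. Its values on indicators of clopen sets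
  define the measure, and uniform approximation by functions of finitely many letters identifies
  the integral.
\<close>

lemma ex_limit_measure:
  "\<exists>\<mu>. seq_prob \<mu> \<and> (\<forall>f. ucont f \<longrightarrow> (\<integral>x. f x \<partial>\<mu>) = limit_value f)"
proof -
  obtain \<mu> where "seq_prob \<mu>" and \<mu>: "\<And>A. A \<in> cylinders \<Longrightarrow> measure \<mu> A = limit_value (indicator A)"
  proof (rule ex_seq_prob[of "\<lambda>A. limit_value (indicator A)"])
    show "0 \<le> limit_value (indicator A)" if "A \<in> cylinders" for A
      using limit_value_mono[of "\<lambda>_. 0" "indicator A"] ucont_indicator[OF that] by simp
    show "limit_value (indicator (A \<union> B)) = limit_value (indicator A) + limit_value (indicator B)"
      if "A \<in> cylinders" "B \<in> cylinders" "A \<inter> B = {}" for A B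
    proof -
      have "(indicator (A \<union> B) :: 'a \<Omega> \<Rightarrow> real) = (\<lambda>x. indicator A x + indicator B x)"
        using that(3) by (auto simp: indicator_def fun_eq_iff)
      then show ?thesis using limit_value_add[OF ucont_indicator[OF that(1)] ucont_indicator[OF that(2)]] by simp
    qed
    show "limit_value (indicator UNIV) = 1"
      by (simp add: indicator_def)
  qed blast
  interpret seq_prob \<mu> by fact
  have fin: "(\<integral>x. f (trunc n x) \<partial>\<mu>) = limit_value (\<lambda>x. f (trunc n x))" for f :: "'a \<Omega> \<Rightarrow> real" and n
  proof -
    let ?C = "\<lambda>w. {x. trunc n x = w}"
    have C: "?C w \<in> cylinders" for w unfolding cylinders_iff by (intro exI[of _ n]) simp
    have "(\<integral>x. f (trunc n x) \<partial>\<mu>) = (\<Sum>w\<in>range (trunc n). measure \<mu> (?C w) * f w)"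
      by (rule simple_integral_sum(1)[OF simple_trunc])
    also have "\<dots> = (\<Sum>w\<in>range (trunc n). limit_value (\<lambda>x. f w * indicator (?C w) x))"
      by (intro sum.cong refl) (simp only: limit_value_cmult[OF ucont_indicator[OF C]] \<mu>[OF C] mult.commute)
    also have "\<dots> = limit_value (\<lambda>x. \<Sum>w\<in>range (trunc n). f w * indicator (?C w) x)"
      using C by (intro limit_value_sum[symmetric] ucont_cmult ucont_indicator)
    also have "(\<lambda>x. \<Sum>w\<in>range (trunc n). f w * indicator (?C w) x) = (\<lambda>x. f (trunc n x))"
    proof
      fix x :: "'a \<Omega>"
      have "(\<Sum>w\<in>range (trunc n). f w * indicator (?C w) x) = (\<Sum>w\<in>{trunc n x}. f w * indicator (?C w) x)"
        by (intro sum.mono_neutral_right) (auto simp: indicator_def finite_range_trunc)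
      then show "(\<Sum>w\<in>range (trunc n). f w * indicator (?C w) x) = f (trunc n x)" by simp
    qed
    finally show ?thesis .
  qed
  have "(\<integral>x. f x \<partial>\<mu>) = limit_value f" if f: "ucont f" for f
  proof -
    have "\<bar>(\<integral>x. f x \<partial>\<mu>) - limit_value f\<bar> \<le> 0 + e" if "e > 0" for e
    proof -
      obtain n where n: "\<And>x y. trunc n x = trunc n y \<Longrightarrow> \<bar>f x - f y\<bar> \<le> e/2"
        using ucontD[OF f, of "e/2"] \<open>e > 0\<close> by auto
      have near: "f x \<le> f (trunc n x) + e/2" "f (trunc n x) \<le> f x + e/2" for x
      proof -
        have "\<bar>f x - f (trunc n x)\<bar> \<le> e/2" by (rule n) simp
        then show "f x \<le> f (trunc n x) + e/2" "f (trunc n x) \<le> f x + e/2" by linarith+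
      qed
      let ?g = "\<lambda>x. f (trunc n x)"
      have g: "ucont ?g" by (rule ucont_trunc)
      have "(\<integral>x. f x \<partial>\<mu>) \<le> (\<integral>x. ?g x + e/2 \<partial>\<mu>)" "(\<integral>x. ?g x \<partial>\<mu>) \<le> (\<integral>x. f x + e/2 \<partial>\<mu>)"
        using near f g by (intro integral_mono integrable_ucont ucont_add; simp)+
      moreover have "limit_value f \<le> limit_value (\<lambda>x. ?g x + e/2)" "limit_value ?g \<le> limit_value (\<lambda>x. f x + e/2)"
        using near f g by (intro limit_value_mono ucont_add; simp)+
      ultimately show ?thesis
        using f g fin[of f n] by (simp add: limit_value_add abs_le_iff)
    qed
    then have "\<bar>(\<integral>x. f x \<partial>\<mu>) - limit_value f\<bar> \<le> 0" by (rule field_le_epsilon)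
    then show ?thesis by simp
  qed
  with \<open>seq_prob \<mu>\<close> show ?thesis by blast
qed

text \<open>
  Integrating the iterates against a fixed measure does not change the integral, while the
  iterates become constant; so a fixed measure is unique.
\<close>

lemma fixed_imp_limit_value:
  assumes "seq_prob \<nu>" and fixed: "\<And>f. ucont f \<Longrightarrow> (\<integral>x. L f x \<partial>\<nu>) = (\<integral>x. f x \<partial>\<nu>)"
    and f: "ucont f"
  shows "(\<integral>x. f x \<partial>\<nu>) = limit_value f"
proof -
  interpret seq_prob \<nu> by fact
  note uc = ucont_transfer_pow[OF ucont_J f]
  have eq: "(\<integral>x. (L ^^ n) f x \<partial>\<nu>) = (\<integral>x. f x \<partial>\<nu>)" for n
    by (induction n) (simp_all add: fixed uc)
  have "\<bar>(\<integral>x. f x \<partial>\<nu>) - limit_value f\<bar> \<le> osc 0 ((L ^^ n) f)" for n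
  proof -
    note b = limit_value_bound(1)[OF f, of n]
    have "(\<integral>x. (L ^^ n) f x \<partial>\<nu>) \<le> limit_value f + osc 0 ((L ^^ n) f)"
      by (rule integral_bounds(1)[OF uc]) (use b in \<open>simp add: abs_le_iff algebra_simps\<close>)
    moreover have "limit_value f - osc 0 ((L ^^ n) f) \<le> (\<integral>x. (L ^^ n) f x \<partial>\<nu>)"
      by (rule integral_bounds(2)[OF uc]) (use b in \<open>simp add: abs_le_iff algebra_simps\<close>)
    ultimately show ?thesis by (simp add: eq abs_le_iff)
  qed
  then have "\<bar>(\<integral>x. f x \<partial>\<nu>) - limit_value f\<bar> \<le> 0"
    by (intro LIMSEQ_le_const[OF osc_transfer_pow_tendsto_0[OF f]]) auto
  then show ?thesis by simp
qed

lemma ruelle_dual_fixed_iff: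
  "ruelle_dual_fixed (\<lambda>x. ln (J x)) \<nu> \<longleftrightarrow> (\<forall>f. ucont f \<longrightarrow> (\<integral>x. L f x \<partial>\<nu>) = (\<integral>x. f x \<partial>\<nu>))"
  by (simp add: ruelle_dual_fixed_def ucont_iff ruelle_eq_transfer)

lemma jacobian_measure_props:
  "shift_inv \<mu>J \<and> ruelle_dual_fixed (\<lambda>x. ln (J x)) \<mu>J"
proof -
  obtain \<mu> where \<mu>: "seq_prob \<mu>" "\<And>f. ucont f \<Longrightarrow> (\<integral>x. f x \<partial>\<mu>) = limit_value f"
    using ex_limit_measure by blast
  interpret seq_prob \<mu> by fact
  have meas [measurable]: "f \<in> borel_measurable \<mu>" if "ucont f" for f :: "'a \<Omega> \<Rightarrow> real"
    using borel_measurable_ucont[OF that] by measurable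
  have inv: "distr \<mu> \<mu> left_shift = \<mu>"
  proof (rule seq_prob_eqI_integral[OF _ \<mu>(1)])
    show "seq_prob (distr \<mu> \<mu> left_shift)"
      by (intro seq_prob.intro prob_space_distr seq_prob_axioms.intro) (simp_all add: sets_eq)
    fix f :: "'a \<Omega> \<Rightarrow> real" assume f: "ucont f"
    have "(\<integral>x. f x \<partial>distr \<mu> \<mu> left_shift) = (\<integral>x. f (left_shift x) \<partial>\<mu>)"
      by (rule integral_distr) (use meas[OF f] in measurable)
    then show "(\<integral>x. f x \<partial>distr \<mu> \<mu> left_shift) = (\<integral>x. f x \<partial>\<mu>)"
      using f by (simp add: \<mu> limit_value_left_shift ucont_left_shift)
  qed
  have "invariant_prob \<mu> \<and> ruelle_dual_fixed (\<lambda>x. ln (J x)) \<mu>"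
    unfolding invariant_prob_iff ruelle_dual_fixed_iff
    using inv \<mu> by (auto simp: shift_inv_def shift_inv_axioms_def limit_value_transfer ucont_transfer ucont_J)
  moreover have "\<nu> = \<mu>" if "invariant_prob \<nu> \<and> ruelle_dual_fixed (\<lambda>x. ln (J x)) \<nu>" for \<nu>
  proof (rule seq_prob_eqI_integral)
    show \<nu>: "seq_prob \<nu>" using that by (simp add: invariant_prob_iff shift_inv_def)
    show "seq_prob \<mu>" by fact
    fix f :: "'a \<Omega> \<Rightarrow> real" assume f: "ucont f"
    have "(\<integral>x. f x \<partial>\<nu>) = limit_value f"
      using that by (intro fixed_imp_limit_value[OF \<nu> _ f]) (simp add: ruelle_dual_fixed_iff)
    then show "(\<integral>x. f x \<partial>\<nu>) = (\<integral>x. f x \<partial>\<mu>)" using \<mu>(2)[OF f] by simp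
  qed
  ultimately have "invariant_prob \<mu>J \<and> ruelle_dual_fixed (\<lambda>x. ln (J x)) \<mu>J"
    unfolding jacobian_measure_def by (rule theI[of _ \<mu>])
  then show ?thesis by (simp add: invariant_prob_iff)
qed

sublocale jm: shift_inv "\<mu>J"
  using jacobian_measure_props by blast

lemma integral_transfer:
  "ucont f \<Longrightarrow> (\<integral>x. L f x \<partial>\<mu>J) = (\<integral>x. f x \<partial>\<mu>J)"
  using jacobian_measure_props by (simp add: ruelle_dual_fixed_iff)

lemma limit_value_eq: "ucont f \<Longrightarrow> limit_value f = (\<integral>x. f x \<partial>\<mu>J)"
  using fixed_imp_limit_value[OF jm.seq_prob_axioms integral_transfer] by simp

lemma jacobian_measure_unique:
  assumes "seq_prob \<nu>" "\<And>f. ucont f \<Longrightarrow> (\<integral>x. L f x \<partial>\<nu>) = (\<integral>x. f x \<partial>\<nu>)"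
  shows "\<nu> = \<mu>J"
  by (rule seq_prob_eqI_integral[OF assms(1) jm.seq_prob_axioms])
     (simp add: fixed_imp_limit_value[OF assms] limit_value_eq)

lemma transfer_pow_uniform_limit:
  assumes "ucont f" "e > 0"
  shows "\<exists>n. \<forall>x. \<bar>(L ^^ n) f x - (\<integral>x. f x \<partial>\<mu>J)\<bar> \<le> e"
proof -
  obtain n where "osc 0 ((L ^^ n) f) < e"
    using eventually_happens[OF order_tendstoD(2)[OF osc_transfer_pow_tendsto_0[OF assms(1)] assms(2)]] by auto
  then have "\<bar>(L ^^ n) f x - (\<integral>x. f x \<partial>\<mu>J)\<bar> \<le> e" for x
    using limit_value_bound(1)[OF assms(1), of n x] limit_value_eq[OF assms(1)] by simp
  then show ?thesis by blast
qed

end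

subsection \<open>A Jacobian is determined by its measure\<close>

definition cyl :: "nat \<Rightarrow> 'a \<Omega> \<Rightarrow> 'a \<Omega> set" where
  "cyl n w = {x. trunc n x = trunc n w}"

lemma cyl_in_cylinders [simp]: "cyl n w \<in> cylinders"
  unfolding cylinders_iff cyl_def by (intro exI[of _ n]) simp

lemma ucont_indicator_cyl [simp]: "ucont (indicator (cyl n w) :: 'a \<Omega> \<Rightarrow> real)"
  by (intro ucont_indicator cyl_in_cylinders)

context jacobian
begin

lemma measure_cyl_Suc:
  "measure \<mu>J (cyl (Suc n) w)
    = (\<integral>x. J (scons (w 0) x) * indicator (cyl n (left_shift w)) x \<partial>\<mu>J)"
proof -
  have "L (indicator (cyl (Suc n) w)) x = J (scons (w 0) x) * indicator (cyl n (left_shift w)) x" for x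
  proof -
    have *: "indicator (cyl (Suc n) w) (scons a x) = (if a = w 0 then indicator (cyl n (left_shift w)) x else (0::real))" for a
      by (auto simp: indicator_def cyl_def trunc_Suc)
    show ?thesis unfolding transfer_def * by (simp add: if_distrib[of "\<lambda>t. _ * t"] cong: if_cong)
  qed
  then show ?thesis
    using integral_transfer[of "indicator (cyl (Suc n) w)"] by simp
qed

lemma ucont_J_scons_indicator: "ucont (\<lambda>x. J (scons a x) * indicator (cyl n w) x)"
  by (intro ucont_mult ucont_scons ucont_J ucont_indicator_cyl)

lemma measure_cyl_pos: "0 < measure \<mu>J (cyl n w)"
proof (induction n arbitrary: w)
  case 0
  have "cyl 0 w = UNIV" by (simp add: cyl_def)
  then show ?case by simp
next
  case (Suc n)
  obtain d where d: "0 < d" "d < 1" "\<And>x. d \<le> J x" by (rule lower_bound) blast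
  have "0 < d * measure \<mu>J (cyl n (left_shift w))" using d Suc by simp
  also have "\<dots> = (\<integral>x. d * indicator (cyl n (left_shift w)) x \<partial>\<mu>J)"
    by simp
  also have "\<dots> \<le> measure \<mu>J (cyl (Suc n) w)"
    unfolding measure_cyl_Suc using d(3)
    by (intro integral_mono jm.integrable_ucont ucont_cmult ucont_J_scons_indicator ucont_indicator_cyl mult_right_mono) auto
  finally show ?case .
qed

end

text \<open>
  If \<open>J\<close> exceeded \<open>J'\<close> at \<open>z\<close>, it would do so by a fixed amount for all sequences that agree with \<open>z\<close> on
  many letters, and the cylinder of these sequences, which has positive measure, would have a
  larger measure for \<open>J\<close> than for \<open>J'\<close>.
\<close>

lemma jacobian_le_if_same_measure:
  assumes "jacobian J" "jacobian J'" "jacobian_measure J = jacobian_measure J'"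
  shows "J z \<le> J' z"
proof (rule ccontr)
  interpret j: jacobian J by fact
  interpret j': jacobian J' by fact
  assume "\<not> J z \<le> J' z"
  define e where "e = (J z - J' z) / 2"
  have e: "e > 0" using \<open>\<not> J z \<le> J' z\<close> by (simp add: e_def)
  have "ucont (\<lambda>x. J x - J' x)" by (intro ucont_diff j.ucont_J j'.ucont_J)
  then obtain n where n: "\<And>x y. trunc n x = trunc n y \<Longrightarrow> \<bar>(J x - J' x) - (J y - J' y)\<bar> \<le> e"
    using ucontD[OF _ e] by blast
  let ?w = "left_shift z" and ?m = "jacobian_measure J"
  have big: "J' (scons (z 0) x) + e \<le> J (scons (z 0) x)" if "x \<in> cyl n ?w" for x
  proof -
    have "trunc (Suc n) (scons (z 0) x) = trunc (Suc n) z"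
      using that by (simp add: trunc_Suc cyl_def)
    then have "trunc n (scons (z 0) x) = trunc n z" by (rule trunc_eq_mono) simp
    moreover have "J z - J' z = 2 * e" by (simp add: e_def)
    ultimately show ?thesis using n[of "scons (z 0) x" z] by linarith
  qed
  have "measure ?m (cyl (Suc n) z) + e * measure ?m (cyl n ?w)
      = (\<integral>x. J' (scons (z 0) x) * indicator (cyl n ?w) x + e * indicator (cyl n ?w) x \<partial>?m)"
    using j.jm.integrable_ucont[OF j'.ucont_J_scons_indicator]
    by (subst Bochner_Integration.integral_add)
       (simp_all add: j'.measure_cyl_Suc[folded assms(3)] j.jm.integrable_ucont ucont_cmult)
  also have "\<dots> \<le> (\<integral>x. J (scons (z 0) x) * indicator (cyl n ?w) x \<partial>?m)"
    by (intro integral_mono j.jm.integrable_ucont ucont_add ucont_cmult ucont_indicator_cyl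
          j.ucont_J_scons_indicator j'.ucont_J_scons_indicator) (use big in \<open>auto simp: indicator_def\<close>)
  also have "\<dots> = measure ?m (cyl (Suc n) z)" by (rule j.measure_cyl_Suc[symmetric])
  finally have "e * measure ?m (cyl n ?w) \<le> 0" by simp
  then show False using e j.measure_cyl_pos[of n ?w] by (simp add: mult_le_0_iff)
qed

lemma jacobian_of_jacobian_measure:
  assumes "holder_jacobian J"
  shows "jacobian_of (jacobian_measure J) = J"
  unfolding jacobian_of_def
proof (rule the_equality)
  fix J' :: "'a \<Omega> \<Rightarrow> real" assume J': "holder_jacobian J' \<and> jacobian_measure J' = jacobian_measure J"
  then have "J' z \<le> J z" "J z \<le> J' z" for z
    using assms by (auto intro!: jacobian_le_if_same_measure jacobian.intro)
  then show "J' = J" by (intro ext antisym)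
qed (use assms in simp)

lemma (in jacobian) D_KL_eq:
  assumes "shift_inv \<nu>" "\<nu> = jacobian_measure J'" "holder_jacobian J'"
  shows "D_KL \<nu> (jacobian_measure J) = (\<integral>x. ln (J' x) \<partial>\<nu>) - (\<integral>x. ln (J x) \<partial>\<nu>)"
proof -
  interpret J': jacobian J' by unfold_locales fact
  interpret N: shift_inv \<nu> by fact
  have "D_KL \<nu> (jacobian_measure J) = (\<integral>x. ln (J' x) - ln (J x) \<partial>\<nu>)"
    by (simp add: D_KL_def assms(2) jacobian_of_jacobian_measure assms(3) holder_J)
  also have "\<dots> = (\<integral>x. ln (J' x) \<partial>\<nu>) - (\<integral>x. ln (J x) \<partial>\<nu>)"
    by (intro Bochner_Integration.integral_diff N.integrable_ucont ucont_ln_J J'.ucont_ln_J)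
  finally show ?thesis .
qed

section \<open>Normalizing a potential\<close>

text \<open>
  For positive \<open>\<phi>\<close> this is a bound on the variation of \<open>ln \<phi>\<close>. In this multiplicative form it is
  inherited by sums with positive coefficients and by pointwise limits.
\<close>

definition log_holder :: "real \<Rightarrow> real \<Rightarrow> ('a \<Omega> \<Rightarrow> real) \<Rightarrow> bool" where
  "log_holder B \<theta> \<phi> \<longleftrightarrow> (\<forall>n x y. trunc n x = trunc n y \<longrightarrow> \<phi> x \<le> exp (B * \<theta> ^ n) * \<phi> y)"

lemma log_holderD: "log_holder B \<theta> \<phi> \<Longrightarrow> trunc n x = trunc n y \<Longrightarrow> \<phi> x \<le> exp (B * \<theta> ^ n) * \<phi> y"
  by (simp add: log_holder_def)

lemma log_holder_compare: "log_holder B \<theta> \<phi> \<Longrightarrow> \<phi> x \<le> exp B * \<phi> y"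
  using log_holderD[of B \<theta> \<phi> 0 x y] by simp

definition normalized_cone :: "real \<Rightarrow> real \<Rightarrow> ('a \<Omega> \<Rightarrow> real) set" where
  "normalized_cone B \<theta> = {\<phi>. \<phi> undefined = 1 \<and> log_holder B \<theta> \<phi>}"

lemma normalized_cone_bounds:
  assumes "\<phi> \<in> normalized_cone B \<theta>"
  shows "exp (- B) \<le> \<phi> x" "\<phi> x \<le> exp B"
  using assms log_holder_compare[of B \<theta> \<phi> undefined x] log_holder_compare[of B \<theta> \<phi> x undefined]
  by (simp_all add: normalized_cone_def exp_minus field_simps)

text \<open>
  Compactness for pointwise convergence is enough below, because the transfer operator only
  evaluates a function at finitely many points for each argument. It follows from Tychonoff's theorem.
\<close>

lemma compact_normalized_cone: "compact (normalized_cone B \<theta>)"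
proof -
  have c: "continuous_on UNIV (\<lambda>\<phi> :: 'a \<Omega> \<Rightarrow> real. \<phi> x)" for x
    by (rule continuous_on_product_coordinates)
  let ?P = "Pi\<^sub>E UNIV (\<lambda>_ :: 'a \<Omega>. {exp (- B)..exp B})"
  have "compactin (product_topology (\<lambda>_ :: 'a \<Omega>. euclideanreal) UNIV) ?P"
    by (subst compactin_PiE) auto
  then have "compact ?P"
    by (simp add: euclidean_product_topology flip: compactin_euclidean_iff)
  moreover have "closed (normalized_cone B \<theta> :: ('a \<Omega> \<Rightarrow> real) set)"
    unfolding normalized_cone_def log_holder_def
    by (intro closed_Collect_conj closed_Collect_all closed_Collect_imp open_Collect_const
          closed_Collect_eq closed_Collect_le continuous_intros c)
  moreover have "normalized_cone B \<theta> \<subseteq> ?P"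
    using normalized_cone_bounds by (fastforce simp: PiE_iff)
  ultimately show ?thesis by (metis compact_Int_closed inf.absorb_iff2)
qed

lemma ucont_if_log_holder:
  fixes \<phi> :: "'a::finite \<Omega> \<Rightarrow> real"
  assumes \<theta>: "0 < \<theta>" "\<theta> < 1" and \<phi>: "log_holder B \<theta> \<phi>" "\<And>x. 0 < \<phi> x"
  shows "exp_var B \<theta> (\<lambda>x. ln (\<phi> x))" "ucont \<phi>"
proof -
  have le: "ln (\<phi> x) - ln (\<phi> y) \<le> B * \<theta> ^ n" if "trunc n x = trunc n y" for n x y
  proof -
    have "ln (\<phi> x) \<le> ln (exp (B * \<theta> ^ n) * \<phi> y)"
      using log_holderD[OF \<phi>(1) that] \<phi>(2) by (intro ln_mono) auto
    also have "\<dots> = B * \<theta> ^ n + ln (\<phi> y)" using \<phi>(2) by (subst ln_mult_pos) auto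
    finally show ?thesis by simp
  qed
  show ev: "exp_var B \<theta> (\<lambda>x. ln (\<phi> x))"
    unfolding exp_var_def
  proof (intro allI impI)
    fix n x y assume "trunc n x = (trunc n y :: 'a \<Omega>)"
    then show "\<bar>ln (\<phi> x) - ln (\<phi> y)\<bar> \<le> B * \<theta> ^ n" using le[of n x y] le[of n y x] by simp
  qed
  have "ucont (\<lambda>x. exp (ln (\<phi> x)))"
    by (intro ucont_exp ucont_if_exp_var[OF \<theta> ev])
  then show "ucont \<phi>" using \<phi>(2) by simp
qed

text \<open>
  Among the branches of the iterated operator, the one that prepends the first \<open>n\<close> letters of \<open>w\<close>
  already gives this lower bound.
\<close>

lemma transfer_pow_lower:
  assumes low: "\<And>x. m \<le> E x" "0 < m" and f: "\<And>x. 0 \<le> f x"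
  shows "\<exists>y. trunc n y = trunc n w \<and> m ^ n * f y \<le> (transfer E ^^ n) f x"
  using f
proof (induction n arbitrary: f w)
  case 0
  then show ?case by (intro exI[of _ x]) simp
next
  case (Suc n)
  have E: "0 \<le> E z" for z using low(1)[of z] low(2) by linarith
  have "0 \<le> transfer E f z" for z
    unfolding transfer_def using E Suc.prems by (intro sum_nonneg) auto
  from Suc.IH[of "transfer E f" "left_shift w", OF this]
  obtain y where y: "trunc n y = trunc n (left_shift w)" "m ^ n * transfer E f y \<le> (transfer E ^^ n) (transfer E f) x"
    by (elim exE conjE)
  let ?y = "scons (w 0) y"
  have "m * f ?y \<le> E ?y * f ?y" using low(1) Suc.prems by (intro mult_right_mono) auto
  also have "\<dots> \<le> transfer E f y"
    unfolding transfer_def using E Suc.prems by (intro member_le_sum) auto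
  finally have "m ^ n * (m * f ?y) \<le> m ^ n * transfer E f y"
    using low(2) by (intro mult_left_mono) auto
  also note y(2)
  finally have "m ^ Suc n * f ?y \<le> (transfer E ^^ Suc n) f x"
    by (simp add: funpow_swap1 mult_ac)
  moreover have "trunc (Suc n) ?y = trunc (Suc n) w" using y(1) by (simp add: trunc_Suc)
  ultimately show ?case by blast
qed

text \<open>
  The existence of the positive eigenfunction, after Collatz and Wielandt: \<open>\<alpha>\<close> is the largest number
  for which some \<open>\<phi>\<close> of the cone satisfies \<open>L \<phi> \<ge> \<alpha> \<phi>\<close>, and the maximum is attained by
  compactness. If \<open>L \<phi> - \<alpha> \<phi>\<close> were positive somewhere, a power of \<open>L\<close> would make it bounded below
  by a positive constant, and the image of \<open>\<phi>\<close> under this power would admit a larger \<open>\<alpha>\<close>.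
\<close>

lemma ex_eigenfunction:
  fixes A :: "'a::finite \<Omega> \<Rightarrow> real"
  assumes \<theta>: "0 < \<theta>" "\<theta> < 1" and C: "0 \<le> C" and A: "exp_var C \<theta> A"
  obtains B \<alpha> \<phi> where "0 < \<alpha>" "\<And>x. 0 < \<phi> x" "0 \<le> B" "log_holder B \<theta> \<phi>"
    "\<And>x. transfer (\<lambda>x. exp (A x)) \<phi> x = \<alpha> * \<phi> x"
proof -
  \<comment> \<open>The fixed point of \<open>B \<mapsto> (C + B) * \<theta>\<close>, so that the operator preserves the cone.\<close>
  define B where "B = C * \<theta> / (1 - \<theta>)"
  have "B * (1 - \<theta>) = C * \<theta>" using \<theta> by (simp add: B_def)
  then have B2: "(C + B) * \<theta> = B" by (simp add: algebra_simps)
  have B1: "0 \<le> B" using \<theta> C by (simp add: B_def)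
  note B = B1 B2
  define L where "L = transfer (\<lambda>x. exp (A x))"
  let ?K = "normalized_cone B \<theta> :: ('a \<Omega> \<Rightarrow> real) set"
  obtain M where M: "\<And>x. \<bar>A x\<bar> \<le> M"
    using ucont_bounded[OF ucont_if_exp_var[OF \<theta> A]] by blast
  have eM: "exp (- M) \<le> exp (A x)" "exp (A x) \<le> exp M" for x using M[of x] by (simp_all add: abs_le_iff)
  have pos: "0 < L \<phi> x" if "\<And>x. 0 < \<phi> x" for \<phi> x
    unfolding L_def transfer_def using that by (intro sum_pos) auto
  have cone: "log_holder B \<theta> (L \<phi>)" if "log_holder B \<theta> \<phi>" "\<And>x. 0 < \<phi> x" for \<phi>
    unfolding log_holder_def
  proof (intro allI impI)
    fix n x y assume eq: "trunc n x = (trunc n y :: 'a \<Omega>)"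
    have "exp (A (scons a x)) * \<phi> (scons a x) \<le> exp (B * \<theta> ^ n) * (exp (A (scons a y)) * \<phi> (scons a y))" for a
    proof -
      have eq': "trunc (Suc n) (scons a x) = trunc (Suc n) (scons a y)" by (simp add: trunc_scons eq)
      have "exp (A (scons a x)) \<le> exp (A (scons a y) + C * \<theta> ^ Suc n)"
        using exp_varD[OF A eq'] by (simp add: abs_le_iff)
      moreover have "\<phi> (scons a x) \<le> exp (B * \<theta> ^ Suc n) * \<phi> (scons a y)"
        by (rule log_holderD[OF that(1) eq'])
      ultimately have "exp (A (scons a x)) * \<phi> (scons a x)
          \<le> exp (A (scons a y) + C * \<theta> ^ Suc n) * (exp (B * \<theta> ^ Suc n) * \<phi> (scons a y))"
        using that(2) by (intro mult_mono) (auto simp: less_imp_le)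
      also have "\<dots> = exp ((C + B) * \<theta> * \<theta> ^ n) * (exp (A (scons a y)) * \<phi> (scons a y))"
        by (simp add: exp_add[symmetric] algebra_simps)
      finally show ?thesis by (simp add: B)
    qed
    then show "L \<phi> x \<le> exp (B * \<theta> ^ n) * L \<phi> y"
      unfolding L_def transfer_def sum_distrib_left by (intro sum_mono)
  qed
  have one: "(\<lambda>_. 1) \<in> ?K"
    using B \<theta> by (simp add: normalized_cone_def log_holder_def)
  define F where "F c = {\<phi> :: 'a \<Omega> \<Rightarrow> real. \<forall>x. c * \<phi> x \<le> L \<phi> x}" for c
  define I where "I = {c. ?K \<inter> F c \<noteq> {}}"
  have Kpos: "0 < \<phi> x" if "\<phi> \<in> ?K" for \<phi> x
    using normalized_cone_bounds(1)[OF that, of x] exp_gt_zero[of "- B"] by linarith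
  have upper: "c \<le> CARD('a) * exp M * exp B" if "c \<in> I" for c
  proof -
    from that obtain \<phi> where \<phi>: "\<phi> \<in> ?K" "\<And>x. c * \<phi> x \<le> L \<phi> x" by (auto simp: I_def F_def)
    have "L \<phi> undefined \<le> (\<Sum>a\<in>(UNIV::'a set). exp M * exp B)"
      unfolding L_def transfer_def using eM normalized_cone_bounds(2)[OF \<phi>(1)] Kpos[OF \<phi>(1)]
      by (intro sum_mono mult_mono) (auto simp: less_imp_le)
    then show ?thesis using \<phi>(2)[of undefined] \<phi>(1) by (simp add: normalized_cone_def)
  qed
  then have bdd: "bdd_above I" by (rule bdd_aboveI)
  have lowI: "exp (- M) \<in> I"
  proof -
    have "exp (- M) \<le> L (\<lambda>_. 1) x" for x
    proof -
      have "exp (- M) \<le> exp (A (scons undefined x)) * 1" using eM by simp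
      also have "\<dots> \<le> L (\<lambda>_. 1) x" unfolding L_def transfer_def by (intro member_le_sum) auto
      finally show ?thesis .
    qed
    then show ?thesis using one by (auto simp: I_def F_def)
  qed
  define \<alpha> where "\<alpha> = Sup I"
  have \<alpha>_ge: "c \<le> \<alpha>" if "c \<in> I" for c unfolding \<alpha>_def by (rule cSup_upper[OF that bdd])
  have \<alpha>: "0 < \<alpha>" using \<alpha>_ge[OF lowI] exp_gt_zero[of "- M"] by linarith
  have c: "continuous_on UNIV (\<lambda>\<phi> :: 'a \<Omega> \<Rightarrow> real. \<phi> x)" for x
    by (rule continuous_on_product_coordinates)
  have "?K \<inter> (\<Inter>c\<in>I. F c) \<noteq> {}"
  proof (rule compact_imp_fip_image[OF compact_normalized_cone])
    show "closed (F c)" for c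
      unfolding F_def L_def transfer_def
      by (intro closed_Collect_all closed_Collect_le continuous_intros c)
    fix I' assume I': "finite I'" "I' \<subseteq> I"
    show "?K \<inter> (\<Inter>c\<in>I'. F c) \<noteq> {}"
    proof (cases "I' = {}")
      case False
      then have "Max I' \<in> I" using I' Max_in by blast
      then obtain \<phi> where \<phi>: "\<phi> \<in> ?K" "\<And>x. Max I' * \<phi> x \<le> L \<phi> x" by (auto simp: I_def F_def)
      have "c * \<phi> x \<le> L \<phi> x" if "c \<in> I'" for c x
      proof -
        have "c * \<phi> x \<le> Max I' * \<phi> x"
          using that I' Kpos[OF \<phi>(1)] by (intro mult_right_mono) (auto simp: less_imp_le)
        then show ?thesis using \<phi>(2)[of x] by linarith
      qed
      then show ?thesis using \<phi>(1) by (auto simp: F_def)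
    qed (use one in auto)
  qed
  then obtain \<phi> where \<phi>: "\<phi> \<in> ?K" "\<And>c x. c \<in> I \<Longrightarrow> c * \<phi> x \<le> L \<phi> x"
    by (auto simp: F_def)
  note \<phi>_pos = Kpos[OF \<phi>(1)]
  have lh: "log_holder B \<theta> \<phi>" using \<phi>(1) by (simp add: normalized_cone_def)
  have ge: "\<alpha> * \<phi> x \<le> L \<phi> x" for x
  proof -
    have "c \<le> L \<phi> x / \<phi> x" if "c \<in> I" for c using \<phi>(2)[OF that, of x] \<phi>_pos[of x] by (simp add: field_simps)
    then have "\<alpha> \<le> L \<phi> x / \<phi> x" unfolding \<alpha>_def using lowI by (intro cSup_least) auto
    then show ?thesis using \<phi>_pos[of x] by (simp add: field_simps)
  qed
  define \<psi> where "\<psi> x = L \<phi> x - \<alpha> * \<phi> x" for x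
  have "ucont (L \<phi>)" "ucont \<phi>"
    using ucont_if_log_holder(2)[OF \<theta>] cone[OF lh \<phi>_pos] pos \<phi>_pos lh by blast+
  then have u\<psi>: "ucont \<psi>"
    unfolding \<psi>_def[abs_def] by (intro ucont_diff ucont_cmult)
  have "\<psi> w = 0" for w
  proof (rule ccontr)
    assume "\<psi> w \<noteq> 0"
    then have e: "\<psi> w / 2 > 0" using ge[of w] by (simp add: \<psi>_def)
    obtain n where n: "\<And>x y. trunc n x = trunc n y \<Longrightarrow> \<bar>\<psi> x - \<psi> y\<bar> \<le> \<psi> w / 2"
      using ucontD[OF u\<psi> e] by blast
    define d where "d = exp (- M) ^ n * (\<psi> w / 2)"
    have d: "0 < d" using e by (simp add: d_def)
    have low: "d \<le> (L ^^ n) \<psi> x" for x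
    proof -
      obtain y where y: "trunc n y = trunc n w" "exp (- M) ^ n * \<psi> y \<le> (L ^^ n) \<psi> x"
        using transfer_pow_lower[of "exp (- M)" "\<lambda>x. exp (A x)" \<psi> n w x] eM ge
        unfolding L_def[symmetric] by (auto simp: \<psi>_def)
      have "\<psi> w / 2 \<le> \<psi> y" using n[OF y(1)] by linarith
      then have "d \<le> exp (- M) ^ n * \<psi> y" unfolding d_def by (intro mult_left_mono) auto
      then show ?thesis using y(2) by linarith
    qed
    have it: "log_holder B \<theta> ((L ^^ k) \<phi>) \<and> (\<forall>x. 0 < (L ^^ k) \<phi> x)" for k
    proof (induction k)
      case 0
      then show ?case using lh \<phi>_pos by simp
    next
      case (Suc k)
      then show ?case using cone pos by simp
    qed
    define s where "s = (L ^^ n) \<phi> undefined"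
    have s: "0 < s" using it by (simp add: s_def)
    define \<phi>' where "\<phi>' x = (L ^^ n) \<phi> x / s" for x
    have K': "\<phi>' \<in> ?K"
      using it s unfolding normalized_cone_def log_holder_def \<phi>'_def
      by (auto simp: s_def[symmetric] divide_right_mono times_divide_eq_right[symmetric] simp del: times_divide_eq_right)
        (metis divide_right_mono less_imp_le times_divide_eq_right)
    have "(L ^^ n) \<psi> x = L ((L ^^ n) \<phi>) x - \<alpha> * (L ^^ n) \<phi> x" for x
    proof -
      have "\<psi> = (\<lambda>x. L \<phi> x + (- \<alpha>) * \<phi> x)" by (simp add: \<psi>_def fun_eq_iff)
      then have "(L ^^ n) \<psi> x = (L ^^ n) (L \<phi>) x + (- \<alpha>) * (L ^^ n) \<phi> x"
        unfolding L_def by (simp only: transfer_pow_add transfer_pow_cmult)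
      then show ?thesis by (simp add: funpow_swap1)
    qed
    then have *: "d \<le> L ((L ^^ n) \<phi>) x - \<alpha> * (L ^^ n) \<phi> x" for x using low[of x] by simp
    have L\<phi>': "L \<phi>' x = L ((L ^^ n) \<phi>) x / s" for x
      unfolding L_def transfer_def \<phi>'_def by (simp add: sum_divide_distrib)
    have "(\<alpha> + d / s * exp (- B)) * \<phi>' x \<le> L \<phi>' x" for x
    proof -
      have "d / s * exp (- B) * \<phi>' x \<le> d / s * exp (- B) * exp B"
        using normalized_cone_bounds(2)[OF K', of x] d s by (intro mult_left_mono) auto
      also have "\<dots> = d / s" by (simp add: mult_exp_exp)
      also have "\<dots> \<le> L \<phi>' x - \<alpha> * \<phi>' x"
        using divide_right_mono[OF *[of x], of s] s by (simp add: L\<phi>' \<phi>'_def diff_divide_distrib)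
      finally show ?thesis by (simp add: algebra_simps)
    qed
    then have "\<alpha> + d / s * exp (- B) \<in> I" using K' by (auto simp: I_def F_def)
    from \<alpha>_ge[OF this] d s show False by (simp add: mult_le_0_iff divide_le_0_iff)
  qed
  then have "L \<phi> x = \<alpha> * \<phi> x" for x by (simp add: \<psi>_def)
  then show ?thesis using that[OF \<alpha> \<phi>_pos B(1) lh] by (simp add: L_def)
qed

text \<open>
  The Collatz--Wielandt bounds for the main eigenvalue; they are tight enough to differentiate it.
\<close>

definition test_bounded :: "('a::finite \<Omega> \<Rightarrow> real) \<Rightarrow> real \<Rightarrow> bool" where
  "test_bounded A \<alpha> \<longleftrightarrow> (\<forall>\<psi> s. ucont \<psi> \<longrightarrow> (\<forall>x. 0 < \<psi> x) \<longrightarrow>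
    ((\<forall>x. transfer (\<lambda>x. exp (A x)) \<psi> x \<le> s * \<psi> x) \<longrightarrow> \<alpha> \<le> s) \<and>
    ((\<forall>x. s * \<psi> x \<le> transfer (\<lambda>x. exp (A x)) \<psi> x) \<longrightarrow> s \<le> \<alpha>))"

text \<open>
  Conjugating with the eigenfunction \<open>\<phi>\<close> normalizes the operator. A test function \<open>\<psi>\<close> bounds the
  eigenvalue because \<open>L \<psi> \<le> s \<psi>\<close> becomes \<open>\<alpha> * transfer J r \<le> s * r\<close> for \<open>r = \<psi> / \<phi>\<close>, and \<open>transfer J r\<close> and
  \<open>r\<close> have the same positive integral with respect to \<open>\<mu>\<^sub>J\<close>.
\<close>

lemma ex_normalization:
  fixes A :: "'a::finite \<Omega> \<Rightarrow> real"
  assumes A: "holder_potential A" and card: "2 \<le> CARD('a)"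
  obtains J \<phi> \<alpha> where "holder_jacobian J" "ucont \<phi>" "\<And>x. 0 < \<phi> x" "0 < \<alpha>"
    "\<And>x. ln (J x) = A x + ln (\<phi> x) - ln (\<phi> (left_shift x)) - ln \<alpha>" "test_bounded A \<alpha>"
proof -
  let ?T = "transfer (\<lambda>x. exp (A x))"
  obtain C \<theta> where c: "0 < \<theta>" "\<theta> < 1" "0 \<le> C" "exp_var C \<theta> A" using A by (rule exp_var_if_holder) blast
  obtain B \<alpha> \<phi> where \<alpha>: "0 < \<alpha>" and \<phi>: "\<And>x. 0 < \<phi> x" and B: "0 \<le> B" "log_holder B \<theta> \<phi>"
    and eig: "\<And>x. ?T \<phi> x = \<alpha> * \<phi> x"
    by (rule ex_eigenfunction[OF c]) blast
  note lnphi = ucont_if_log_holder(1)[OF c(1,2) B(2) \<phi>]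
  have u\<phi>: "ucont \<phi>" by (rule ucont_if_log_holder(2)[OF c(1,2) B(2) \<phi>])
  define G where "G x = A x + ln (\<phi> x) - ln (\<phi> (left_shift x)) - ln \<alpha>" for x
  define J where "J x = exp (G x)" for x
  have J_eq: "J x = exp (A x) * \<phi> x / (\<alpha> * \<phi> (left_shift x))" for x
    using \<phi> \<alpha> by (simp add: J_def G_def exp_add exp_diff field_simps)
  have tJ: "\<alpha> * \<phi> x * transfer J f x = ?T (\<lambda>x. \<phi> x * f x) x" for f x
    using \<alpha> \<phi>[of x] unfolding transfer_def J_eq sum_distrib_left by (intro sum.cong) (auto simp: field_simps)
  have sum1: "transfer J (\<lambda>_. 1) x = 1" for x
    using tJ[of x "\<lambda>_. 1"] eig[of x] \<alpha> \<phi>[of x] by simp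
  have less1: "J x < 1" for x
  proof -
    have "card (UNIV - {x 0}) = CARD('a) - 1" by simp
    then have "UNIV - {x 0} \<noteq> {}" using card by (metis One_nat_def Suc_1 card.empty diff_is_0_eq not_less_eq_eq)
    then have "0 < (\<Sum>a\<in>UNIV - {x 0}. J (scons a (left_shift x)))" by (intro sum_pos) (auto simp: J_def)
    moreover have "(\<Sum>a\<in>UNIV. J (scons a (left_shift x))) = 1" using sum1 by (simp add: transfer_def)
    then have "J (scons (x 0) (left_shift x)) + (\<Sum>a\<in>UNIV - {x 0}. J (scons a (left_shift x))) = 1"
      by (subst (asm) sum.remove[of _ "x 0"]) auto
    ultimately show ?thesis by simp
  qed
  define D where "D = C + B + B / \<theta>"
  have varG: "exp_var D \<theta> G"
    unfolding exp_var_def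
  proof (intro allI impI)
    fix n x y assume eq: "trunc n x = (trunc n y :: 'a \<Omega>)"
    have sh: "\<bar>ln (\<phi> (left_shift x)) - ln (\<phi> (left_shift y))\<bar> \<le> B / \<theta> * \<theta> ^ n"
    proof (cases n)
      case 0
      have "B * 1 \<le> B / \<theta> * 1" using c B by (simp add: field_simps mult_left_le)
      then show ?thesis using exp_varD[OF lnphi trunc_0_eq, of "left_shift x" "left_shift y"] 0 by simp
    next
      case (Suc k)
      then have "trunc k (left_shift x) = trunc k (left_shift y)" using eq by (simp add: trunc_Suc)
      from exp_varD[OF lnphi this] show ?thesis using Suc c by simp
    qed
    have "D * \<theta> ^ n = C * \<theta> ^ n + B * \<theta> ^ n + B / \<theta> * \<theta> ^ n" by (simp add: D_def algebra_simps)
    then show "\<bar>G x - G y\<bar> \<le> D * \<theta> ^ n"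
      using exp_varD[OF c(4) eq] exp_varD[OF lnphi eq] sh unfolding G_def by linarith
  qed
  have Jdiff: "J x - J y \<le> \<bar>G x - G y\<bar>" for x y
  proof -
    have "J x * (1 + (G y - G x)) \<le> J x * exp (G y - G x)"
      by (intro mult_left_mono exp_ge_add_one_self) (simp add: J_def)
    also have "\<dots> = J y" by (simp add: J_def exp_add[symmetric])
    finally have "J x - J y \<le> J x * (G x - G y)" by (simp add: algebra_simps)
    also have "\<dots> \<le> J x * \<bar>G x - G y\<bar>" by (intro mult_left_mono) (auto simp: J_def)
    also have "\<dots> \<le> 1 * \<bar>G x - G y\<bar>" using less1[of x] by (intro mult_right_mono) auto
    finally show ?thesis by simp
  qed
  have "exp_var D \<theta> J"
    unfolding exp_var_def
  proof (intro allI impI)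
    fix n x y assume eq: "trunc n x = (trunc n y :: 'a \<Omega>)"
    show "\<bar>J x - J y\<bar> \<le> D * \<theta> ^ n"
      using Jdiff[of x y] Jdiff[of y x] exp_varD[OF varG eq] by linarith
  qed
  then have "holder_potential J" using c B by (intro holder_if_exp_var[of \<theta> D]) (auto simp: D_def)
  moreover have "ruelle (\<lambda>x. ln (J x)) (\<lambda>_. 1) = (\<lambda>_. 1)"
    using ruelle_ln[of J] sum1 by (auto simp: J_def)
  ultimately have J: "holder_jacobian J"
    using less1 by (simp add: holder_jacobian_def) (simp add: J_def)
  then interpret J: jacobian J by unfold_locales
  have "ucont (\<lambda>x. \<psi> x / \<phi> x)" if "ucont \<psi>" for \<psi>
  proof -
    have "ucont (\<lambda>x. \<psi> x * exp (- 1 * ln (\<phi> x)))"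
      by (intro ucont_mult that ucont_exp ucont_cmult ucont_ln u\<phi> \<phi>)
    then show ?thesis using \<phi> by (simp add: exp_minus field_simps)
  qed note quot = this
  let ?m = "jacobian_measure J"
  have int_pos: "0 < (\<integral>x. r x \<partial>?m)" if r: "ucont r" "\<And>x. 0 < r x" for r
  proof -
    obtain R where R: "\<And>x. \<bar>ln (r x)\<bar> \<le> R" using ucont_bounded[OF ucont_ln[OF r]] by blast
    have "exp (- R) \<le> (\<integral>x. r x \<partial>?m)"
    proof (rule J.jm.integral_bounds(2)[OF r(1)])
      fix x
      have "- R \<le> ln (r x)" using R[of x] by (simp add: abs_le_iff)
      then have "exp (- R) \<le> exp (ln (r x))" by (simp only: exp_le_cancel_iff)
      then show "exp (- R) \<le> r x" using r(2)[of x] by simp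
    qed
    then show ?thesis using exp_gt_zero[of "- R"] by linarith
  qed
  have quot_transfer: "transfer J (\<lambda>x. \<psi> x / \<phi> x) x = ?T \<psi> x / (\<alpha> * \<phi> x)" for \<psi> x
  proof -
    have "(\<lambda>x. \<phi> x * (\<psi> x / \<phi> x)) = \<psi>" using \<phi> by (auto simp: fun_eq_iff less_imp_neq[symmetric])
    then show ?thesis using tJ[of x "\<lambda>x. \<psi> x / \<phi> x"] \<alpha> \<phi>[of x] by (simp add: field_simps)
  qed
  have "test_bounded A \<alpha>"
    unfolding test_bounded_def
  proof (intro allI impI conjI)
    fix \<psi> :: "'a \<Omega> \<Rightarrow> real" and s :: real
    assume \<psi>: "ucont \<psi>" "\<forall>x. 0 < \<psi> x"
    let ?r = "\<lambda>x. \<psi> x / \<phi> x"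
    have r: "ucont ?r" "ucont (transfer J ?r)" "ucont (\<lambda>x. s * ?r x)"
      by (intro quot \<psi> ucont_transfer J.ucont_J ucont_cmult)+
    have "0 < (\<integral>x. ?r x \<partial>?m)" using \<psi> \<phi> by (intro int_pos quot) auto
    note scale = mult_right_le_imp_le[OF _ this]
    have ts: "\<alpha> * transfer J ?r x = ?T \<psi> x / \<phi> x" for x
      using \<alpha> \<phi>[of x] by (simp add: quot_transfer)
    have int: "(\<integral>x. \<alpha> * transfer J ?r x \<partial>?m) = \<alpha> * (\<integral>x. ?r x \<partial>?m)"
      using J.integral_transfer[OF r(1)] by simp
    have ints: "(\<integral>x. s * ?r x \<partial>?m) = s * (\<integral>x. ?r x \<partial>?m)"
      by (rule integral_mult_right_zero)
    have ui: "integrable ?m (\<lambda>x. \<alpha> * transfer J ?r x)"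
      "integrable ?m (\<lambda>x. s * ?r x)"
      by (intro J.jm.integrable_ucont ucont_cmult r)+
    show "\<alpha> \<le> s" if *: "\<forall>x. ?T \<psi> x \<le> s * \<psi> x"
    proof (rule scale, unfold int[symmetric] ints[symmetric], intro integral_mono ui)
      show "\<alpha> * transfer J ?r x \<le> s * ?r x" for x
        unfolding ts using divide_right_mono[OF *[rule_format, of x], of "\<phi> x"] \<phi>[of x] by simp
    qed
    show "s \<le> \<alpha>" if *: "\<forall>x. s * \<psi> x \<le> ?T \<psi> x"
    proof (rule scale, unfold int[symmetric] ints[symmetric], intro integral_mono ui)
      show "s * ?r x \<le> \<alpha> * transfer J ?r x" for x
        unfolding ts using divide_right_mono[OF *[rule_format, of x], of "\<phi> x"] \<phi>[of x] by simp
    qed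
  qed
  moreover have "ln (J x) = A x + ln (\<phi> x) - ln (\<phi> (left_shift x)) - ln \<alpha>" for x
    by (simp add: J_def G_def)
  ultimately show ?thesis using that[OF J u\<phi> \<phi> \<alpha>] by blast
qed

section \<open>Entropy of finite-valued functions\<close>

definition ent :: "'a \<Omega> measure \<Rightarrow> ('a \<Omega> \<Rightarrow> 'b) \<Rightarrow> real" where
  "ent \<mu> X = (\<integral>x. - ln (measure \<mu> {y. X y = X x}) \<partial>\<mu>)"

context seq_prob
begin

lemma simple_sum_1: "simple_function \<mu> X \<Longrightarrow> (\<Sum>v\<in>range X. prob {x. X x = v}) = 1"
  using simple_integral_sum(1)[of X "\<lambda>_. 1"] by simp

lemma ent_sum:
  assumes "simple_function \<mu> X"
  shows "ent \<mu> X = (\<Sum>v\<in>range X. prob {x. X x = v} * - ln (prob {x. X x = v}))"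
  unfolding ent_def by (rule simple_integral_sum(1)[OF assms])

lemma ent_nonneg: "simple_function \<mu> X \<Longrightarrow> 0 \<le> ent \<mu> X"
proof -
  assume X: "simple_function \<mu> X"
  have "0 \<le> - ln (prob A)" for A
    using prob_le_1[of A] measure_nonneg[of \<mu> A] by (cases "prob A = 0") (auto simp: less_le)
  then show ?thesis unfolding ent_sum[OF X] by (intro sum_nonneg mult_nonneg_nonneg measure_nonneg)
qed

text \<open>
  Gibbs' inequality: a code adapted to a wrong distribution \<open>q\<close> costs at least the entropy. The
  subadditivity of entropy, its bound by conditional information and the generator theorem below
  all come from this inequality, each with its own choice of \<open>q\<close>.
\<close>

lemma gibbs:
  assumes X: "simple_function \<mu> X"
    and q: "\<And>v. 0 \<le> q v" "\<And>v. 0 < prob {x. X x = v} \<Longrightarrow> 0 < q v" "(\<Sum>v\<in>range X. q v) \<le> 1"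
  shows "ent \<mu> X \<le> (\<integral>x. - ln (q (X x)) \<partial>\<mu>)"
proof -
  let ?p = "\<lambda>v. prob {x. X x = v}"
  have termwise: "?p v * - ln (?p v) - ?p v * - ln (q v) \<le> q v - ?p v" for v
  proof (cases "?p v = 0")
    case True
    then show ?thesis using q(1)[of v] by simp
  next
    case False
    then have p: "0 < ?p v" by (simp add: less_le)
    have "ln (q v / ?p v) \<le> q v / ?p v - 1" using p q(2) by (intro ln_le_minus_one) auto
    then have "?p v * ln (q v / ?p v) \<le> ?p v * (q v / ?p v - 1)" using p by (intro mult_left_mono) auto
    moreover have "ln (q v / ?p v) = ln (q v) - ln (?p v)" using p q(2) by (simp add: ln_divide_pos)
    moreover have "?p v * (q v / ?p v - 1) = q v - ?p v" using p by (simp add: field_simps)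
    ultimately show ?thesis by (simp add: algebra_simps)
  qed
  have "ent \<mu> X - (\<integral>x. - ln (q (X x)) \<partial>\<mu>) = (\<Sum>v\<in>range X. ?p v * - ln (?p v) - ?p v * - ln (q v))"
    unfolding ent_sum[OF X] simple_integral_sum(1)[OF X, of "\<lambda>v. - ln (q v)"] by (rule sum_subtractf[symmetric])
  also have "\<dots> \<le> (\<Sum>v\<in>range X. q v - ?p v)" by (intro sum_mono termwise)
  also have "\<dots> \<le> 0" using q(3) simple_sum_1[OF X] by (simp add: sum_subtractf)
  finally show ?thesis by simp
qed

lemma ent_map_le:
  assumes X: "simple_function \<mu> X" shows "ent \<mu> (\<lambda>x. g (X x)) \<le> ent \<mu> X"
proof -
  let ?p = "\<lambda>v. prob {x. X x = v}" and ?r = "\<lambda>v. prob {x. g (X x) = v}"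
  have "?p v * - ln (?r (g v)) \<le> ?p v * - ln (?p v)" for v
  proof (cases "?p v = 0")
    case False
    then have p: "0 < ?p v" by (simp add: less_le)
    have "?p v \<le> ?r (g v)"
      using simple_sets[OF simple_map[OF X]] by (intro finite_measure_mono) auto
    then show ?thesis using p by (intro mult_left_mono) auto
  qed simp
  then show ?thesis
    unfolding ent_sum[OF X] unfolding ent_def
    by (subst simple_integral_sum(1)[OF X, of "\<lambda>v. - ln (?r (g v))"]) (intro sum_mono)
qed

text \<open>
  Gibbs' inequality for \<open>q (v, u) = P(X = v) * Q v u\<close>: once \<open>X\<close> is known, \<open>U\<close> is coded with the
  kernel \<open>Q\<close>.
\<close>

lemma ent_pair_le:
  assumes X: "simple_function \<mu> X" and U: "simple_function \<mu> U"
    and Q: "\<And>v u. 0 \<le> Q v u" "\<And>x. 0 < prob {y. X y = X x \<and> U y = U x} \<Longrightarrow> 0 < Q (X x) (U x)"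
      "\<And>x. (\<Sum>u\<in>range U. Q (X x) u) \<le> 1"
  shows "ent \<mu> (\<lambda>x. (X x, U x)) \<le> ent \<mu> X + (\<integral>x. - ln (Q (X x) (U x)) \<partial>\<mu>)"
proof -
  let ?Y = "\<lambda>x. (X x, U x)"
  have Y: "simple_function \<mu> ?Y" by (rule simple_function_Pair[OF X U])
  let ?p = "\<lambda>v. prob {x. X x = v}" and ?r = "\<lambda>v. prob {x. ?Y x = v}"
  let ?q = "\<lambda>v. ?p (fst v) * Q (fst v) (snd v)"
  have le: "?r v \<le> ?p (fst v)" for v
    using simple_sets[OF X] by (intro finite_measure_mono) auto
  have posQ: "0 < Q (fst v) (snd v)" if "0 < ?r v" for v
  proof -
    have "{x. ?Y x = v} \<noteq> {}" using that by (metis measure_empty less_irrefl)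
    then obtain x where x: "v = ?Y x" by blast
    show ?thesis using Q(2)[of x] that unfolding x by simp
  qed
  have "ent \<mu> ?Y \<le> (\<integral>x. - ln (?q (?Y x)) \<partial>\<mu>)"
  proof (rule gibbs[OF Y])
    show "0 \<le> ?q v" for v using Q(1) by simp
    show "0 < ?q v" if "0 < ?r v" for v
      using le[of v] posQ[OF that] that by (intro mult_pos_pos) auto
    have "(\<Sum>v\<in>range ?Y. ?q v) \<le> (\<Sum>v\<in>range X \<times> range U. ?q v)"
      using simple_finite[OF X] simple_finite[OF U] Q(1) by (intro sum_mono2) auto
    also have "\<dots> = (\<Sum>v\<in>range X. ?p v * (\<Sum>u\<in>range U. Q v u))"
      by (simp add: sum.cartesian_product' sum_distrib_left)
    also have "\<dots> \<le> (\<Sum>v\<in>range X. ?p v * 1)"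
      using Q(3) by (intro sum_mono mult_left_mono) auto
    also have "\<dots> = 1" using simple_sum_1[OF X] by simp
    finally show "(\<Sum>v\<in>range ?Y. ?q v) \<le> 1" .
  qed
  also have "(\<integral>x. - ln (?q (?Y x)) \<partial>\<mu>) = (\<integral>x. (\<lambda>v. - ln (?p (fst v)) + - ln (Q (fst v) (snd v))) (?Y x) \<partial>\<mu>)"
    unfolding simple_integral_sum(1)[OF Y, of "\<lambda>v. - ln (?q v)"]
      simple_integral_sum(1)[OF Y, of "\<lambda>v. - ln (?p (fst v)) + - ln (Q (fst v) (snd v))"]
  proof (intro sum.cong refl)
    fix v
    show "?r v * - ln (?q v) = ?r v * (- ln (?p (fst v)) + - ln (Q (fst v) (snd v)))"
    proof (cases "?r v = 0")
      case False
      then have r: "0 < ?r v" by (simp add: less_le)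
      then show ?thesis using posQ[OF r] le[of v] by (simp add: ln_mult_pos)
    qed simp
  qed
  also have "\<dots> = ent \<mu> X + (\<integral>x. - ln (Q (X x) (U x)) \<partial>\<mu>)"
    using simple_integral_sum(2)[OF X, of "\<lambda>v. - ln (?p v)"] simple_integral_sum(2)[OF Y, of "\<lambda>v. - ln (Q (fst v) (snd v))"]
    unfolding ent_def by (subst Bochner_Integration.integral_add[symmetric]) auto
  finally show ?thesis .
qed

lemma block_entropy_eq_ent:
  assumes "simple_function \<mu> (itinerary \<xi> n)"
  shows "block_entropy \<mu> \<xi> n = ent \<mu> (itinerary \<xi> n)"
proof -
  interpret information_space \<mu> "exp 1" by unfold_locales simp
  let ?X = "itinerary \<xi> n"
  have "simple_distributed \<mu> ?X (\<lambda>v. prob {x. ?X x = v})"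
    by (rule simple_distributedI[OF assms]) (auto simp: vimage_def)
  from entropy_simple_distributed[OF this]
  have "block_entropy \<mu> \<xi> n = - (\<Sum>v\<in>range ?X. prob {x. ?X x = v} * log (exp 1) (prob {x. ?X x = v}))"
    unfolding block_entropy_def by simp
  also have "\<dots> = ent \<mu> ?X"
    unfolding ent_sum[OF assms] by (simp add: log_def sum_negf)
  finally show ?thesis .
qed

end

subsection \<open>Itineraries\<close>

lemma funpow_left_shift: "(left_shift ^^ i) x = (\<lambda>j. x (i + j))"
  by (induction i arbitrary: x) (auto simp: left_shift_def fun_eq_iff)

lemma itinerary_0 [simp]: "itinerary \<xi> 0 x = []"
  by (simp add: itinerary_def)

lemma length_itinerary [simp]: "length (itinerary \<xi> n x) = n"
  by (simp add: itinerary_def)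

lemma nth_itinerary: "i < n \<Longrightarrow> itinerary \<xi> n x ! i = \<xi> ((left_shift ^^ i) x)"
  by (simp add: itinerary_def)

lemma itinerary_add: "itinerary \<xi> (n + m) x = itinerary \<xi> n x @ itinerary \<xi> m ((left_shift ^^ n) x)"
proof (rule nth_equalityI)
  fix i assume "i < length (itinerary \<xi> (n + m) x)"
  then have i: "i < n + m" by simp
  show "itinerary \<xi> (n + m) x ! i = (itinerary \<xi> n x @ itinerary \<xi> m ((left_shift ^^ n) x)) ! i"
  proof (cases "i < n")
    case False
    then have "(left_shift ^^ (i - n)) ((left_shift ^^ n) x) = (left_shift ^^ i) x"
      by (simp add: funpow_left_shift add.assoc[symmetric])
    then show ?thesis using i False by (simp add: nth_itinerary nth_append)
  qed (use i in \<open>simp add: nth_itinerary nth_append\<close>)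
qed simp

lemma itinerary_Suc: "itinerary \<xi> (Suc n) x = itinerary \<xi> n x @ [\<xi> ((left_shift ^^ n) x)]"
  using itinerary_add[of \<xi> n 1 x] by (simp add: itinerary_def)

lemma measurable_left_shift_pow: "left_shift ^^ n \<in> seq_space \<rightarrow>\<^sub>M seq_space"
  by (induction n) (auto intro: measurable_comp[OF _ measurable_left_shift])

text \<open>
  Fekete's lemma: division with remainder by an \<open>m\<close> at which \<open>u m / m\<close> is almost minimal bounds all
  later quotients.
\<close>

lemma subadditive_convergent:
  fixes u :: "nat \<Rightarrow> real"
  assumes nonneg: "\<And>n. 0 \<le> u n" and sub: "\<And>m n. u (m + n) \<le> u m + u n"
  shows "convergent (\<lambda>n. u n / real n)"
proof -
  define l where "l = (INF n\<in>{0<..}. u n / real n)"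
  have bdd: "bdd_below ((\<lambda>n. u n / real n) ` {0<..})"
    by (rule bdd_belowI[of _ 0]) (use nonneg in auto)
  have low: "l \<le> u n / real n" if "n > 0" for n
    unfolding l_def using that by (intro cINF_lower bdd) auto
  have mult: "u (q * m + r) \<le> real q * u m + u r" for q m r
  proof (induction q)
    case (Suc q)
    have "u (Suc q * m + r) \<le> u m + u (q * m + r)" using sub[of m "q * m + r"] by (simp add: add.assoc)
    then show ?case using Suc by (simp add: algebra_simps)
  qed simp
  have "(\<lambda>n. u n / real n) \<longlonglongrightarrow> l"
  proof (rule LIMSEQ_I)
    fix e :: real assume e: "e > 0"
    have "(INF n\<in>{0<..}. u n / real n) < l + e/2" using e by (simp add: l_def)
    then obtain m where m: "m > 0" "u m / real m < l + e/2"
      by (subst (asm) cINF_less_iff[OF _ bdd]) auto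
    define R where "R = Max (u ` {..<m})"
    have R: "u r \<le> R" if "r < m" for r unfolding R_def using that by (intro Max_ge) auto
    obtain N where N: "real N > 2 * R / e" using reals_Archimedean2 by blast
    have "norm (u n / real n - l) < e" if n: "n \<ge> Suc N" for n
    proof -
      have n0: "0 < real n" using n by simp
      have "u n \<le> real (n div m) * u m + u (n mod m)" using mult[of "n div m" m "n mod m"] by simp
      also have "\<dots> \<le> real n / real m * u m + R"
      proof (intro add_mono mult_right_mono nonneg R)
        show "real (n div m) \<le> real n / real m" by (rule of_nat_div_le_of_nat)
      qed (use m in auto)
      finally have "u n / real n \<le> (real n / real m * u m + R) / real n"
        using n0 by (intro divide_right_mono) auto
      also have "\<dots> = u m / real m + R / real n" using n0 m by (simp add: field_simps)
      also have "R / real n < e/2"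
      proof -
        have "2 * R / e < real n" using N n by linarith
        then have "2 * R < e * real n" using e by (simp add: field_simps)
        then show ?thesis using n0 by (simp add: field_simps)
      qed
      finally have "u n / real n < l + e" using m(2) by linarith
      moreover have "l \<le> u n / real n" using n by (intro low) auto
      ultimately show ?thesis by simp
    qed
    then show "\<exists>no. \<forall>n\<ge>no. norm (u n / real n - l) < e" by blast
  qed
  then show ?thesis by (rule convergentI)
qed

context shift_inv
begin

lemma simple_left_shift:
  assumes "simple_function \<mu> X" shows "simple_function \<mu> (\<lambda>x. X ((left_shift ^^ n) x))"
proof (rule simple_functionI)
  have "range (\<lambda>x. X ((left_shift ^^ n) x)) \<subseteq> range X" by auto
  then show "finite (range (\<lambda>x. X ((left_shift ^^ n) x)))"
    by (rule finite_subset) (rule simple_finite[OF assms])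
  have "X \<in> \<mu> \<rightarrow>\<^sub>M count_space UNIV" by (rule measurable_simple_function[OF assms])
  then have "X \<in> seq_space \<rightarrow>\<^sub>M count_space UNIV" by measurable
  from measurable_compose[OF measurable_left_shift_pow this, of n]
  show "(\<lambda>x. X ((left_shift ^^ n) x)) \<in> \<mu> \<rightarrow>\<^sub>M count_space UNIV" by measurable
qed

lemma integral_left_shift_pow:
  fixes f :: "_ \<Rightarrow> real"
  assumes "f \<in> borel_measurable seq_space"
  shows "(\<integral>x. f ((left_shift ^^ n) x) \<partial>\<mu>) = (\<integral>x. f x \<partial>\<mu>)"
proof (induction n)
  case (Suc n)
  have "(\<lambda>x. f ((left_shift ^^ n) x)) \<in> borel_measurable seq_space"
    by (rule measurable_compose[OF measurable_left_shift_pow assms])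
  then have "(\<lambda>x. f ((left_shift ^^ n) x)) \<in> borel_measurable \<mu>" by measurable
  from integral_left_shift[OF this] show ?case using Suc by (simp add: funpow_swap1)
qed simp

lemma borel_simple:
  fixes F :: "'b \<Rightarrow> real"
  assumes "simple_function \<mu> X" shows "(\<lambda>x. F (X x)) \<in> borel_measurable seq_space"
proof -
  have "X \<in> \<mu> \<rightarrow>\<^sub>M count_space UNIV" by (rule measurable_simple_function[OF assms])
  then have X: "X \<in> seq_space \<rightarrow>\<^sub>M count_space UNIV" by measurable
  show ?thesis by (rule measurable_compose[OF X]) simp
qed

lemma measure_left_shift_pow:
  assumes X: "simple_function \<mu> X"
  shows "prob {x. X ((left_shift ^^ n) x) = v} = prob {x. X x = v}"
proof -
  have "prob {x. X x = v} = (\<integral>x. (if X x = v then 1 else 0 :: real) \<partial>\<mu>)" if X: "simple_function \<mu> X" for X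
  proof -
    have "(\<integral>x. (if X x = v then 1 else 0 :: real) \<partial>\<mu>) = (\<integral>x. indicator {x. X x = v} x \<partial>\<mu>)"
      by (intro Bochner_Integration.integral_cong) (auto simp: indicator_def)
    then show ?thesis using simple_sets[OF X] by simp
  qed
  from this[OF X] this[OF simple_left_shift[OF X, of n]] show ?thesis
    using integral_left_shift_pow[OF borel_simple[OF X, of "\<lambda>u. if u = v then 1 else 0"], of n] by simp
qed

lemma ent_left_shift_pow:
  assumes X: "simple_function \<mu> X"
  shows "ent \<mu> (\<lambda>x. X ((left_shift ^^ n) x)) = ent \<mu> X"
  unfolding ent_def measure_left_shift_pow[OF X]
  by (rule integral_left_shift_pow[OF borel_simple[OF X, of "\<lambda>u. - ln (prob {y. X y = u})"]])

lemma simple_itinerary: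
  assumes "simple_function \<mu> \<xi>" shows "simple_function \<mu> (itinerary \<xi> n)"
proof (induction n)
  case 0
  have "itinerary \<xi> 0 = (\<lambda>_. [])" by (simp add: fun_eq_iff)
  then show ?case by simp
next
  case (Suc n)
  have "simple_function \<mu> (\<lambda>x. (\<lambda>p. fst p @ [snd p]) (itinerary \<xi> n x, \<xi> ((left_shift ^^ n) x)))"
    by (rule simple_map[OF simple_function_Pair[OF Suc.IH simple_left_shift[OF assms]]])
  then show ?case by (simp add: itinerary_Suc[abs_def])
qed

lemma ent_itinerary_subadditive:
  assumes \<xi>: "simple_function \<mu> \<xi>"
  shows "ent \<mu> (itinerary \<xi> (n + m)) \<le> ent \<mu> (itinerary \<xi> n) + ent \<mu> (itinerary \<xi> m)"
proof -
  let ?X = "itinerary \<xi> n" and ?U = "\<lambda>x. itinerary \<xi> m ((left_shift ^^ n) x)"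
  have X: "simple_function \<mu> ?X" and U: "simple_function \<mu> ?U"
    by (intro simple_itinerary simple_left_shift \<xi>)+
  let ?Q = "\<lambda>_ u. prob {x. ?U x = u}"
  have "ent \<mu> (\<lambda>x. (\<lambda>p. fst p @ snd p) (?X x, ?U x)) \<le> ent \<mu> (\<lambda>x. (?X x, ?U x))"
    by (rule ent_map_le[OF simple_function_Pair[OF X U]])
  also have "\<dots> \<le> ent \<mu> ?X + (\<integral>x. - ln (?Q (?X x) (?U x)) \<partial>\<mu>)"
  proof (rule ent_pair_le[OF X U])
    fix x assume "0 < prob {y. ?X y = ?X x \<and> ?U y = ?U x}"
    also have "\<dots> \<le> ?Q (?X x) (?U x)" using simple_sets[OF U] by (intro finite_measure_mono) auto
    finally show "0 < ?Q (?X x) (?U x)" .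
  qed (use simple_sum_1[OF U] in auto)
  also have "(\<integral>x. - ln (?Q (?X x) (?U x)) \<partial>\<mu>) = ent \<mu> (itinerary \<xi> m)"
    using ent_left_shift_pow[OF simple_itinerary[OF \<xi>], of m n] by (simp add: ent_def)
  finally show ?thesis by (simp add: itinerary_add[abs_def])
qed

lemma partition_entropy_limit:
  assumes \<xi>: "simple_function \<mu> \<xi>"
  shows "(\<lambda>n. ent \<mu> (itinerary \<xi> n) / real n) \<longlonglongrightarrow> partition_entropy \<mu> \<xi>"
proof -
  have "convergent (\<lambda>n. ent \<mu> (itinerary \<xi> n) / real n)"
    by (intro subadditive_convergent ent_nonneg simple_itinerary \<xi> ent_itinerary_subadditive)
  moreover have "(\<lambda>n. block_entropy \<mu> \<xi> n / real n) = (\<lambda>n. ent \<mu> (itinerary \<xi> n) / real n)"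
    by (simp add: block_entropy_eq_ent simple_itinerary \<xi>)
  ultimately show ?thesis
    unfolding partition_entropy_def by (simp add: convergent_LIMSEQ_iff)
qed

subsection \<open>Conditional information of the first letter\<close>

lemma measure_cyl_left_shift: "prob {x. left_shift x \<in> cyl k w} = prob (cyl k w)"
  by (rule measure_left_shift) simp

lemma sum_measure_cyl_scons: "(\<Sum>a\<in>UNIV. prob (cyl (Suc k) (scons a w))) = prob (cyl k w)"
proof -
  have "(\<Sum>a\<in>UNIV. prob (cyl (Suc k) (scons a w))) = prob (\<Union>a\<in>UNIV. cyl (Suc k) (scons a w))"
  proof (rule finite_measure_finite_Union[symmetric])
    show "(\<lambda>a. cyl (Suc k) (scons a w)) ` UNIV \<subseteq> sets \<mu>"
      using sets_cylinder[OF cyl_in_cylinders] by blast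
    show "disjoint_family_on (\<lambda>a. cyl (Suc k) (scons a w)) UNIV"
      by (auto simp: disjoint_family_on_def cyl_def trunc_Suc)
  qed simp
  also have "(\<Union>a\<in>UNIV. cyl (Suc k) (scons a w)) = {x. left_shift x \<in> cyl k w}"
    by (auto simp: cyl_def trunc_Suc)
  finally show ?thesis by (simp add: measure_cyl_left_shift)
qed

lemma measure_cyl_Suc_le: "prob (cyl (Suc k) w) \<le> prob (cyl k (left_shift w))"
proof -
  have "prob (cyl (Suc k) w) \<le> prob {x. left_shift x \<in> cyl k (left_shift w)}"
  proof (intro finite_measure_mono)
    have "{x \<in> space seq_space. left_shift x \<in> cyl k (left_shift w)} \<in> sets seq_space"
      using cylinders_sets[OF cyl_in_cylinders, of k "left_shift w"] by measurable
    then show "{x. left_shift x \<in> cyl k (left_shift w)} \<in> sets \<mu>" by (simp add: sets_eq)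
  qed (auto simp: cyl_def trunc_Suc)
  then show ?thesis by (simp add: measure_cyl_left_shift)
qed

text \<open>
  The conditional entropy of the first letter given the next \<open>k\<close> ones.
\<close>

definition cond_info :: "nat \<Rightarrow> real" where
  "cond_info k = (\<integral>x. - ln (prob (cyl (Suc k) x) / prob (cyl k (left_shift x))) \<partial>\<mu>)"

text \<open>
  Replacing the conditional law of the first letter, given the next \<open>N\<close> ones, by its conditional
  law given only the next \<open>k\<close> ones can only increase the cost.
\<close>

lemma ent_trunc_Suc_le:
  assumes "k \<le> N"
  shows "ent \<mu> (trunc (Suc N)) \<le> ent \<mu> (trunc N) + cond_info k"
proof -
  let ?X = "\<lambda>x. trunc N (left_shift x)" and ?U = "\<lambda>x. x 0"
  have X: "simple_function \<mu> ?X" by (rule simple_finitary[of _ "Suc N"]) (simp add: left_shift_trunc)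
  have U: "simple_function \<mu> ?U" by (rule simple_finitary[of _ 1]) (simp add: trunc_def)
  let ?Q = "\<lambda>v u. prob (cyl (Suc k) (scons u v)) / prob (cyl k v)"
  have c1: "cyl (Suc k) (scons (x 0) (?X x)) = cyl (Suc k) x" for x
    using assms by (simp add: cyl_def trunc_Suc min_absorb1)
  have c2: "cyl k (?X x) = cyl k (left_shift x)" for x
    using assms by (simp add: cyl_def min_absorb1)
  have "ent \<mu> (\<lambda>x. (\<lambda>p. scons (snd p) (fst p)) (?X x, ?U x)) \<le> ent \<mu> (\<lambda>x. (?X x, ?U x))"
    by (rule ent_map_le[OF simple_function_Pair[OF X U]])
  also have "\<dots> \<le> ent \<mu> ?X + (\<integral>x. - ln (?Q (?X x) (?U x)) \<partial>\<mu>)"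
  proof (rule ent_pair_le[OF X U])
    fix x
    assume *: "0 < prob {y. ?X y = ?X x \<and> ?U y = ?U x}"
    have "{y. ?X y = ?X x \<and> ?U y = ?U x} \<subseteq> cyl (Suc k) x"
      using assms by (auto simp: cyl_def trunc_Suc intro: trunc_eq_mono)
    then have "prob {y. ?X y = ?X x \<and> ?U y = ?U x} \<le> prob (cyl (Suc k) x)"
      by (intro finite_measure_mono) auto
    with * have "0 < prob (cyl (Suc k) x)" by linarith
    moreover from this have "0 < prob (cyl k (left_shift x))" using measure_cyl_Suc_le[of k x] by linarith
    ultimately show "0 < ?Q (?X x) (?U x)" unfolding c1 c2 by simp
  next
    fix x
    have "(\<Sum>u\<in>range ?U. ?Q (?X x) u) \<le> (\<Sum>u\<in>UNIV. ?Q (?X x) u)"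
      by (intro sum_mono2) auto
    also have "\<dots> \<le> 1" by (simp add: sum_divide_distrib[symmetric] sum_measure_cyl_scons)
    finally show "(\<Sum>u\<in>range ?U. ?Q (?X x) u) \<le> 1" .
  qed auto
  also have "(\<integral>x. - ln (?Q (?X x) (?U x)) \<partial>\<mu>) = cond_info k"
    unfolding c1 c2 cond_info_def ..
  also have "ent \<mu> ?X = ent \<mu> (trunc N)"
    using ent_left_shift_pow[OF simple_trunc, of N 1] by simp
  finally show ?thesis by (simp add: trunc_Suc[abs_def])
qed

lemma ent_trunc_le: "ent \<mu> (trunc n) \<le> ent \<mu> (trunc k) + real n * cond_info k"
proof -
  have "ent \<mu> (trunc n) = ent \<mu> (\<lambda>x. trunc n (trunc (n + k) x))" by simp
  also have "\<dots> \<le> ent \<mu> (trunc (n + k))" by (rule ent_map_le[OF simple_trunc])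
  also have "\<dots> \<le> ent \<mu> (trunc k) + real n * cond_info k"
  proof (induction n)
    case (Suc n)
    then show ?case using ent_trunc_Suc_le[of k "n + k"] by (simp add: algebra_simps)
  qed simp
  finally show ?thesis .
qed

text \<open>
  The letters of the \<open>\<xi>\<close>-itinerary are added one at a time; each of them is coded with \<open>Q\<close> from the
  letter at the same place of the \<open>\<zeta>\<close>-itinerary.
\<close>

lemma ent_pair_itinerary_le:
  assumes \<zeta>: "simple_function \<mu> \<zeta>" and \<xi>: "simple_function \<mu> \<xi>"
    and Q: "\<And>b a. b \<in> range \<xi> \<Longrightarrow> a \<in> range \<xi> \<Longrightarrow> 0 < Q b a" "\<And>b a. 0 \<le> Q b a"
      "\<And>b. b \<in> range \<xi> \<Longrightarrow> (\<Sum>a\<in>range \<xi>. Q b a) \<le> 1"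
    and sub: "range \<zeta> \<subseteq> range \<xi>" and "i \<le> n"
  shows "ent \<mu> (\<lambda>x. (itinerary \<zeta> n x, itinerary \<xi> i x))
    \<le> ent \<mu> (itinerary \<zeta> n) + real i * (\<integral>x. - ln (Q (\<zeta> x) (\<xi> x)) \<partial>\<mu>)"
  using \<open>i \<le> n\<close>
proof (induction i)
  case 0
  have "ent \<mu> (\<lambda>x. (\<lambda>l. (l, [])) (itinerary \<zeta> n x)) \<le> ent \<mu> (itinerary \<zeta> n)"
    by (rule ent_map_le[OF simple_itinerary[OF \<zeta>]])
  then show ?case by simp
next
  case (Suc i)
  let ?X = "\<lambda>x. (itinerary \<zeta> n x, itinerary \<xi> i x)" and ?U = "\<lambda>x. \<xi> ((left_shift ^^ i) x)"
  have X: "simple_function \<mu> ?X" by (intro simple_function_Pair simple_itinerary \<zeta> \<xi>)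
  have U: "simple_function \<mu> ?U" by (intro simple_left_shift \<xi>)
  let ?Q = "\<lambda>p u. Q (fst p ! i) u"
  have nth: "?Q (?X x) u = Q (\<zeta> ((left_shift ^^ i) x)) u" for x u
    using Suc.prems by (simp add: nth_itinerary)
  have \<zeta>_in: "\<zeta> y \<in> range \<xi>" for y using sub by auto
  have "ent \<mu> (\<lambda>x. (\<lambda>p. (fst (fst p), snd (fst p) @ [snd p])) (?X x, ?U x)) \<le> ent \<mu> (\<lambda>x. (?X x, ?U x))"
    by (rule ent_map_le[OF simple_function_Pair[OF X U]])
  also have "\<dots> \<le> ent \<mu> ?X + (\<integral>x. - ln (?Q (?X x) (?U x)) \<partial>\<mu>)"
  proof (rule ent_pair_le[OF X U])
    fix x
    show "0 < ?Q (?X x) (?U x)" unfolding nth using \<zeta>_in by (intro Q(1)) auto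
    have "(\<Sum>u\<in>range ?U. ?Q (?X x) u) \<le> (\<Sum>u\<in>range \<xi>. ?Q (?X x) u)"
      using simple_finite[OF \<xi>] Q(2) by (intro sum_mono2) auto
    also have "\<dots> \<le> 1" unfolding nth by (rule Q(3)[OF \<zeta>_in])
    finally show "(\<Sum>u\<in>range ?U. ?Q (?X x) u) \<le> 1" .
  qed (use Q(2) in auto)
  also have "(\<integral>x. - ln (?Q (?X x) (?U x)) \<partial>\<mu>) = (\<integral>x. - ln (Q (\<zeta> x) (\<xi> x)) \<partial>\<mu>)"
    unfolding nth
    using integral_left_shift_pow[OF borel_simple[OF simple_function_Pair[OF \<zeta> \<xi>], of "\<lambda>p. - ln (Q (fst p) (snd p))"], of i]
    by simp
  finally show ?case using Suc.IH Suc.prems by (simp add: itinerary_Suc[abs_def] algebra_simps)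
qed

lemma ent_itinerary_le_trunc:
  assumes \<zeta>: "\<And>x. \<zeta> (trunc m x) = \<zeta> x"
  shows "ent \<mu> (itinerary \<zeta> n) \<le> ent \<mu> (trunc (n + m))"
proof -
  have "itinerary \<zeta> n (trunc (n + m) x) = itinerary \<zeta> n x" for x
  proof (rule nth_equalityI)
    fix i assume "i < length (itinerary \<zeta> n (trunc (n + m) x))"
    then have i: "i < n" by simp
    have "trunc m ((left_shift ^^ i) (trunc (n + m) x)) = trunc m ((left_shift ^^ i) x)"
      using i by (auto simp: trunc_def funpow_left_shift)
    then show "itinerary \<zeta> n (trunc (n + m) x) ! i = itinerary \<zeta> n x ! i"
      using i by (simp add: nth_itinerary) (metis \<zeta>)
  qed simp
  then have "ent \<mu> (itinerary \<zeta> n) = ent \<mu> (\<lambda>x. itinerary \<zeta> n (trunc (n + m) x))" by simp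
  also have "\<dots> \<le> ent \<mu> (trunc (n + m))" by (rule ent_map_le[OF simple_trunc])
  finally show ?thesis .
qed

text \<open>
  Up to a small probability \<open>\<xi>\<close> equals a function \<open>\<zeta>\<close> of finitely many letters. The kernel \<open>Q\<close>
  below, which guesses \<open>\<xi> = \<zeta>\<close> but spreads a small weight \<open>e\<close> over all values, makes the correction
  from \<open>\<zeta>\<close> to \<open>\<xi>\<close> cheap; and itineraries of \<open>\<zeta>\<close> are functions of slightly longer words, whose
  entropy grows by at most \<open>cond_info k\<close> per letter. This is the Kolmogorov--Sinai theorem for the
  generator formed by the cylinders of length one.
\<close>

lemma partition_entropy_le_cond_info:
  assumes \<xi>: "simple_function \<mu> \<xi>"
  shows "partition_entropy \<mu> \<xi> \<le> cond_info k"
proof (rule field_le_epsilon)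
  fix \<eta> :: real assume \<eta>: "0 < \<eta>"
  let ?V = "range \<xi>"
  define K where "K = real (card ?V)"
  have "0 < card ?V" using simple_finite[OF \<xi>] by (simp add: card_gt_0_iff)
  then have K: "1 \<le> K" by (simp add: K_def)
  \<comment> \<open>A correct guess costs at most \<open>- ln (1 - e) = \<eta> / 2\<close>. A wrong one costs \<open>ln (K / e)\<close>, but its
    probability is below \<open>d\<close>, so wrong guesses add at most another \<open>\<eta> / 2\<close>.\<close>
  define e where "e = 1 - exp (- \<eta> / 2)"
  have e: "0 < e" "e < 1" "- ln (1 - e) = \<eta> / 2" using \<eta> by (simp_all add: e_def)
  have lnK: "0 \<le> ln (K / e)" using K e by (intro ln_ge_zero) (simp add: field_simps)
  define d where "d = \<eta> / 2 / (ln (K / e) + 1)"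
  have d: "0 < d" "d * ln (K / e) \<le> \<eta> / 2" using \<eta> lnK by (simp_all add: d_def field_simps)
  obtain \<zeta> m where \<zeta>: "\<And>x. \<zeta> (trunc m x) = \<zeta> x" "range \<zeta> \<subseteq> ?V" "prob {x. \<xi> x \<noteq> \<zeta> x} < d"
    using approx_finitary[OF \<xi> d(1)] by blast
  have s\<zeta>: "simple_function \<mu> \<zeta>" by (rule simple_finitary[of \<zeta> m, OF \<zeta>(1)])
  define Q where "Q b a = (if a = b then 1 - e else 0) + e / K" for b a :: nat
  have Qpos: "0 < Q b a" for b a using e K by (auto simp: Q_def intro: add_pos_pos)
  have Qsum: "(\<Sum>a\<in>?V. Q b a) \<le> 1" if "b \<in> ?V" for b
    using simple_finite[OF \<xi>] that K by (simp add: Q_def sum.distrib) (simp add: K_def)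
  define \<kappa> where "\<kappa> = (\<integral>x. - ln (Q (\<zeta> x) (\<xi> x)) \<partial>\<mu>)"
  have pair: "simple_function \<mu> (\<lambda>x. (\<zeta> x, \<xi> x))" by (rule simple_function_Pair[OF s\<zeta> \<xi>])
  have bad: "{x. \<xi> x \<noteq> \<zeta> x} \<in> sets \<mu>"
  proof -
    have [measurable]: "\<xi> \<in> \<mu> \<rightarrow>\<^sub>M count_space UNIV" "\<zeta> \<in> \<mu> \<rightarrow>\<^sub>M count_space UNIV"
      using \<xi> s\<zeta> by (auto intro: measurable_simple_function)
    have "{x \<in> space \<mu>. \<xi> x \<noteq> \<zeta> x} \<in> sets \<mu>" by measurable
    then show ?thesis by simp
  qed
  have bound: "- ln (Q (\<zeta> x) (\<xi> x)) \<le> \<eta> / 2 + ln (K / e) * indicator {x. \<xi> x \<noteq> \<zeta> x} x" for x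
  proof (cases "\<xi> x = \<zeta> x")
    case True
    have "ln (1 - e) \<le> ln (Q (\<zeta> x) (\<xi> x))" using e K True by (intro ln_mono) (auto simp: Q_def)
    then show ?thesis using True e(3) by simp
  next
    case False
    then have "- ln (Q (\<zeta> x) (\<xi> x)) = ln (K / e)" using e K by (simp add: Q_def ln_divide_pos)
    then show ?thesis using False \<eta> by simp
  qed
  have "\<kappa> \<le> (\<integral>x. \<eta> / 2 + ln (K / e) * indicator {x. \<xi> x \<noteq> \<zeta> x} x \<partial>\<mu>)"
    unfolding \<kappa>_def using bad simple_integral_sum(2)[OF pair, of "\<lambda>p. - ln (Q (fst p) (snd p))"]
    by (intro integral_mono bound) (auto simp: emeasure_eq_measure)
  also have "\<dots> = \<eta> / 2 + ln (K / e) * prob {x. \<xi> x \<noteq> \<zeta> x}"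
    using bad by (simp add: emeasure_eq_measure)
  also have "\<dots> \<le> \<eta> / 2 + ln (K / e) * d"
    using \<zeta>(3) lnK by (intro add_left_mono mult_left_mono) auto
  also have "\<dots> \<le> \<eta>" using d(2) by (simp add: mult.commute)
  finally have \<kappa>: "\<kappa> \<le> \<eta>" .
  define R where "R = ent \<mu> (trunc k) + real m * cond_info k"
  have le: "ent \<mu> (itinerary \<xi> n) \<le> R + real n * (cond_info k + \<eta>)" for n
  proof -
    have "ent \<mu> (\<lambda>x. snd (itinerary \<zeta> n x, itinerary \<xi> n x)) \<le> ent \<mu> (\<lambda>x. (itinerary \<zeta> n x, itinerary \<xi> n x))"
      by (rule ent_map_le) (intro simple_function_Pair simple_itinerary s\<zeta> \<xi>)
    also have "\<dots> \<le> ent \<mu> (itinerary \<zeta> n) + real n * \<kappa>"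
      unfolding \<kappa>_def using Qpos Qsum \<zeta>(2)
      by (intro ent_pair_itinerary_le[OF s\<zeta> \<xi>]) (auto simp: less_imp_le)
    also have "\<dots> \<le> (ent \<mu> (trunc k) + real (n + m) * cond_info k) + real n * \<eta>"
      using ent_itinerary_le_trunc[of \<zeta> m n, OF \<zeta>(1)] ent_trunc_le[of "n + m" k] \<kappa>
      by (intro add_mono mult_left_mono) auto
    also have "\<dots> = R + real n * (cond_info k + \<eta>)" by (simp add: R_def algebra_simps)
    finally show ?thesis by (simp add: eta_contract_eq)
  qed
  have "(\<lambda>n. R / real n + (cond_info k + \<eta>)) \<longlonglongrightarrow> 0 + (cond_info k + \<eta>)"
    by (intro tendsto_intros lim_const_over_n)
  moreover have "ent \<mu> (itinerary \<xi> n) / real n \<le> R / real n + (cond_info k + \<eta>)" if "n \<ge> 1" for n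
  proof -
    have "ent \<mu> (itinerary \<xi> n) / real n \<le> (R + real n * (cond_info k + \<eta>)) / real n"
      by (intro divide_right_mono le) simp
    then show ?thesis using that by (simp add: add_divide_distrib)
  qed
  ultimately show "partition_entropy \<mu> \<xi> \<le> cond_info k + \<eta>"
    using LIMSEQ_le[OF partition_entropy_limit[OF \<xi>]] by fastforce
qed

lemma ks_entropy_le_cond_info: "ks_entropy \<mu> \<le> ereal (cond_info k)"
  unfolding ks_entropy_def by (intro SUP_least) (auto intro: partition_entropy_le_cond_info)

end

section \<open>The variational principle\<close>

lemma sum_range_trunc_Suc:
  fixes F :: "'a::finite \<Omega> \<Rightarrow> real"
  shows "(\<Sum>w\<in>range (trunc (Suc k)). F w) = (\<Sum>v\<in>range (trunc k). \<Sum>a\<in>UNIV. F (scons a v))"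
proof -
  have bij: "bij_betw (\<lambda>(v, a). scons a v) (range (trunc k) \<times> UNIV) (range (trunc (Suc k) :: 'a \<Omega> \<Rightarrow> _))"
  proof (rule bij_betwI')
    show "\<exists>p\<in>range (trunc k) \<times> UNIV. w = (case p of (v, a) \<Rightarrow> scons a v)" if "w \<in> range (trunc (Suc k))" for w :: "'a \<Omega>"
    proof -
      from that obtain x where "w = scons (x 0) (trunc k (left_shift x))" by (auto simp: trunc_Suc)
      then show ?thesis by (intro bexI[of _ "(trunc k (left_shift x), x 0)"]) auto
    qed
    show "(case p of (v, a) \<Rightarrow> scons a v) \<in> range (trunc (Suc k))" if "p \<in> range (trunc k) \<times> UNIV" for p :: "'a \<Omega> \<times> 'a"
      using that by (auto simp flip: trunc_scons)
  qed auto
  have "(\<Sum>v\<in>range (trunc k). \<Sum>a\<in>UNIV. F (scons a v)) = (\<Sum>(v, a)\<in>range (trunc k) \<times> UNIV. F (scons a v))"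
    by (rule sum.cartesian_product)
  also have "\<dots> = (\<Sum>p\<in>range (trunc k) \<times> UNIV. F (case p of (v, a) \<Rightarrow> scons a v))"
    by (intro sum.cong) auto
  also have "\<dots> = (\<Sum>w\<in>range (trunc (Suc k)). F w)" by (rule sum.reindex_bij_betw[OF bij])
  finally show ?thesis ..
qed

lemma (in seq_prob) integral_trunc:
  fixes F :: "'a \<Omega> \<Rightarrow> real"
  shows "(\<integral>x. F (trunc k x) \<partial>\<mu>) = (\<Sum>w\<in>range (trunc k). measure \<mu> (cyl k w) * F w)"
proof -
  have "measure \<mu> {x. trunc k x = w} = measure \<mu> (cyl k w)" if "w \<in> range (trunc k)" for w :: "'a \<Omega>"
    using that by (auto simp: cyl_def)
  then show ?thesis using simple_integral_sum(1)[OF simple_trunc, of F k] by simp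
qed

lemma (in seq_prob) integral_trunc_near:
  assumes "ucont f"
  shows "\<bar>(\<integral>x. f (trunc k x) \<partial>\<mu>) - (\<integral>x. f x \<partial>\<mu>)\<bar> \<le> osc k f"
proof -
  have d: "ucont (\<lambda>x. f (trunc k x) - f x)" by (intro ucont_diff ucont_trunc assms)
  have "f (trunc k x) - f x \<le> osc k f" "f x - f (trunc k x) \<le> osc k f" for x
    by (intro osc_upper assms; simp)+
  then have "f (trunc k x) - f x \<le> osc k f" "- osc k f \<le> f (trunc k x) - f x" for x
    by (auto simp: algebra_simps)
  then have "(\<integral>x. f (trunc k x) - f x \<partial>\<mu>) \<le> osc k f" "- osc k f \<le> (\<integral>x. f (trunc k x) - f x \<partial>\<mu>)"
    by (intro integral_bounds d; simp)+
  moreover have "(\<integral>x. f (trunc k x) - f x \<partial>\<mu>) = (\<integral>x. f (trunc k x) \<partial>\<mu>) - (\<integral>x. f x \<partial>\<mu>)"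
    by (intro Bochner_Integration.integral_diff integrable_ucont ucont_trunc assms)
  ultimately show ?thesis by (simp add: abs_le_iff)
qed

context jacobian
begin

text \<open>
  The measure \<open>\<nu>\<close> and its first letter resampled with \<open>J\<close> give two probabilities \<open>P\<close> and \<open>Q\<close> on words of
  length \<open>k + 1\<close>. Up to the variation of \<open>ln J\<close>, \<open>cond_info k + \<integral> ln J d\<nu>\<close> is minus the relative
  entropy of \<open>P\<close> and \<open>Q\<close>, which dominates their squared Hellinger distance as \<open>ln t \<le> 2 (\<surd>t - 1)\<close>.
\<close>

lemma hellinger_le:
  assumes "shift_inv \<nu>"
  defines "P \<equiv> \<lambda>k w. measure \<nu> (cyl (Suc k) w)"
    and "Q \<equiv> \<lambda>k w. J w * measure \<nu> (cyl k (left_shift w))"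
  shows "(\<Sum>w\<in>range (trunc (Suc k)). (sqrt (P k w) - sqrt (Q k w))\<^sup>2)
      \<le> osc (Suc k) (\<lambda>x. ln (J x)) - (shift_inv.cond_info \<nu> k + (\<integral>x. ln (J x) \<partial>\<nu>))"
    and "(\<Sum>w\<in>range (trunc (Suc k)). P k w) = 1"
    and "(\<Sum>w\<in>range (trunc (Suc k)). Q k w) = 1"
proof -
  interpret N: shift_inv \<nu> by fact
  let ?R = "range (trunc (Suc k) :: 'a \<Omega> \<Rightarrow> _)"
  show sumP: "(\<Sum>w\<in>?R. P k w) = 1"
    using N.integral_trunc[of "\<lambda>_. 1" "Suc k"] by (simp add: P_def)
  have "(\<Sum>w\<in>?R. Q k w) = (\<Sum>v\<in>range (trunc k). measure \<nu> (cyl k v) * (\<Sum>a\<in>UNIV. J (scons a v)))"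
    unfolding sum_range_trunc_Suc by (simp add: Q_def sum_distrib_left mult.commute)
  also have "\<dots> = 1" using N.integral_trunc[of "\<lambda>_. 1" k] by (simp add: sum_eq_1)
  finally show sumQ: "(\<Sum>w\<in>?R. Q k w) = 1" .
  have nn: "0 \<le> P k w" "0 \<le> Q k w" for w by (simp_all add: P_def Q_def)
  have posQ: "0 < Q k w" if "0 < P k w" for w
    using that N.measure_cyl_Suc_le[of k w] by (simp add: P_def Q_def)
  have termwise: "P k w * ln (Q k w / P k w) \<le> 2 * sqrt (P k w) * sqrt (Q k w) - 2 * P k w" for w
  proof (cases "P k w = 0")
    case False
    then have p: "0 < P k w" using nn(1)[of w] by simp
    have "ln (Q k w / P k w) = 2 * ln (sqrt (Q k w / P k w))" using p posQ[OF p] by (simp add: ln_sqrt)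
    also have "\<dots> \<le> 2 * (sqrt (Q k w / P k w) - 1)"
      using p posQ[OF p] by (intro mult_left_mono ln_le_minus_one) auto
    finally have "P k w * ln (Q k w / P k w) \<le> P k w * (2 * (sqrt (Q k w / P k w) - 1))"
      using p by (intro mult_left_mono) auto
    also have "P k w * (sqrt (Q k w / P k w)) = sqrt (P k w) * sqrt (Q k w)"
      using p by (simp add: real_sqrt_divide field_simps)
    then have "P k w * (2 * (sqrt (Q k w / P k w) - 1)) = 2 * sqrt (P k w) * sqrt (Q k w) - 2 * P k w"
      by (simp add: algebra_simps)
    finally show ?thesis .
  qed simp
  have c: "cyl (Suc k) (trunc (Suc k) x) = cyl (Suc k) x" "cyl k (left_shift (trunc (Suc k) x)) = cyl k (left_shift x)" for x :: "'a \<Omega>"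
    by (auto simp: cyl_def left_shift_trunc)
  have "N.cond_info k = (\<integral>x. - ln (P k (trunc (Suc k) x) / measure \<nu> (cyl k (left_shift (trunc (Suc k) x)))) \<partial>\<nu>)"
    by (simp add: N.cond_info_def P_def c)
  also have "\<dots> = (\<Sum>w\<in>?R. P k w * - ln (P k w / measure \<nu> (cyl k (left_shift w))))"
    unfolding P_def by (rule N.integral_trunc[of "\<lambda>w. - ln (measure \<nu> (cyl (Suc k) w) / measure \<nu> (cyl k (left_shift w)))"])
  finally have ci: "N.cond_info k = (\<Sum>w\<in>?R. P k w * - ln (P k w / measure \<nu> (cyl k (left_shift w))))" .
  have lj: "(\<integral>x. ln (J (trunc (Suc k) x)) \<partial>\<nu>) = (\<Sum>w\<in>?R. P k w * ln (J w))"
    unfolding P_def by (rule N.integral_trunc[of "\<lambda>w. ln (J w)"])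
  have "N.cond_info k + (\<integral>x. ln (J x) \<partial>\<nu>)
      \<le> N.cond_info k + (\<integral>x. ln (J (trunc (Suc k) x)) \<partial>\<nu>) + osc (Suc k) (\<lambda>x. ln (J x))"
    using N.integral_trunc_near[OF ucont_ln_J, of "Suc k"] by linarith
  also have "N.cond_info k + (\<integral>x. ln (J (trunc (Suc k) x)) \<partial>\<nu>) = (\<Sum>w\<in>?R. P k w * ln (Q k w / P k w))"
    unfolding ci lj sum.distrib[symmetric]
  proof (intro sum.cong refl)
    fix w
    show "P k w * - ln (P k w / measure \<nu> (cyl k (left_shift w))) + P k w * ln (J w) = P k w * ln (Q k w / P k w)"
    proof (cases "P k w = 0")
      case False
      then have p: "0 < P k w" using nn(1)[of w] by simp
      then have m: "0 < measure \<nu> (cyl k (left_shift w))"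
        using N.measure_cyl_Suc_le[of k w] by (simp add: P_def)
      show ?thesis using p m posQ[OF p] by (simp add: Q_def ln_divide_pos ln_mult_pos algebra_simps)
    qed simp
  qed
  also have "\<dots> \<le> (\<Sum>w\<in>?R. 2 * sqrt (P k w) * sqrt (Q k w) - 2 * P k w)"
    by (intro sum_mono termwise)
  also have "\<dots> = (\<Sum>w\<in>?R. Q k w - P k w - (sqrt (P k w) - sqrt (Q k w))\<^sup>2)"
    by (intro sum.cong refl) (simp add: power2_diff nn)
  also have "\<dots> = - (\<Sum>w\<in>?R. (sqrt (P k w) - sqrt (Q k w))\<^sup>2)"
    by (simp add: sum_subtractf sumP sumQ)
  finally show "(\<Sum>w\<in>?R. (sqrt (P k w) - sqrt (Q k w))\<^sup>2)
      \<le> osc (Suc k) (\<lambda>x. ln (J x)) - (N.cond_info k + (\<integral>x. ln (J x) \<partial>\<nu>))"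
    by linarith
qed

lemma ks_entropy_le:
  assumes "shift_inv \<nu>"
  shows "ks_entropy \<nu> \<le> ereal (- (\<integral>x. ln (J x) \<partial>\<nu>))"
proof -
  interpret N: shift_inv \<nu> by fact
  have le: "ks_entropy \<nu> \<le> ereal (osc (Suc k) (\<lambda>x. ln (J x)) - (\<integral>x. ln (J x) \<partial>\<nu>))" for k
  proof -
    have "0 \<le> (\<Sum>w\<in>range (trunc (Suc k)). (sqrt (measure \<nu> (cyl (Suc k) w)) - sqrt (J w * measure \<nu> (cyl k (left_shift w))))\<^sup>2)"
      by (intro sum_nonneg) simp
    also note hellinger_le(1)[OF assms, of k]
    finally have "N.cond_info k \<le> osc (Suc k) (\<lambda>x. ln (J x)) - (\<integral>x. ln (J x) \<partial>\<nu>)" by simp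
    with N.ks_entropy_le_cond_info[of k] show ?thesis by (meson ereal_less_eq(3) order_trans)
  qed
  have "(\<lambda>k. ereal (osc (Suc k) (\<lambda>x. ln (J x)) - (\<integral>x. ln (J x) \<partial>\<nu>))) \<longlonglongrightarrow> ereal (0 - (\<integral>x. ln (J x) \<partial>\<nu>))"
    by (intro tendsto_ereal tendsto_diff LIMSEQ_Suc[OF osc_tendsto_0] ucont_ln_J tendsto_const)
  from LIMSEQ_le_const[OF this, of "ks_entropy \<nu>"] le show ?thesis by auto
qed

text \<open>
  In the case of equality the Hellinger distances of \<open>P k\<close> and \<open>Q k\<close> tend to \<open>0\<close>. In the limit \<open>P k\<close>
  integrates \<open>f\<close> and \<open>Q k\<close> integrates \<open>L f\<close>, so \<open>\<nu>\<close> is fixed by the dual of \<open>L\<close>.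
\<close>

lemma ks_entropy_eq_imp:
  assumes "shift_inv \<nu>" and ge: "ereal (- (\<integral>x. ln (J x) \<partial>\<nu>)) \<le> ks_entropy \<nu>"
  shows "\<nu> = \<mu>J"
proof (rule jacobian_measure_unique)
  interpret N: shift_inv \<nu> by fact
  show "seq_prob \<nu>" by (rule N.seq_prob_axioms)
  define P where "P k w = measure \<nu> (cyl (Suc k) w)" for k w
  define Q where "Q k w = J w * measure \<nu> (cyl k (left_shift w))" for k w
  define e where "e k = osc (Suc k) (\<lambda>x. ln (J x))" for k
  let ?R = "\<lambda>k. range (trunc (Suc k) :: 'a \<Omega> \<Rightarrow> _)"
  have e_nonneg: "0 \<le> e k" for k unfolding e_def by (intro osc_nonneg ucont_ln_J)
  have nn: "0 \<le> P k w" "0 \<le> Q k w" for k w by (simp_all add: P_def Q_def)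
  have sums: "(\<Sum>w\<in>?R k. P k w) = 1" "(\<Sum>w\<in>?R k. Q k w) = 1" for k
    using hellinger_le(2,3)[OF assms(1), of k] by (simp_all add: P_def Q_def)
  have hell: "(\<Sum>w\<in>?R k. (sqrt (P k w) - sqrt (Q k w))\<^sup>2) \<le> e k" for k
  proof -
    have "ereal (- (\<integral>x. ln (J x) \<partial>\<nu>)) \<le> ereal (N.cond_info k)"
      using ge N.ks_entropy_le_cond_info[of k] by (rule order_trans)
    then show ?thesis using hellinger_le(1)[OF assms(1), of k] by (simp add: P_def Q_def e_def)
  qed
  have L1: "(\<Sum>w\<in>?R k. \<bar>P k w - Q k w\<bar>) \<le> 2 * sqrt (e k)" for k
  proof -
    have eq: "\<bar>P k w - Q k w\<bar> = \<bar>sqrt (P k w) - sqrt (Q k w)\<bar> * \<bar>sqrt (P k w) + sqrt (Q k w)\<bar>" for w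
    proof -
      have "P k w - Q k w = (sqrt (P k w) - sqrt (Q k w)) * (sqrt (P k w) + sqrt (Q k w))"
        using nn[of k w] by (simp add: algebra_simps)
      then show ?thesis by (simp add: abs_mult)
    qed
    have "(\<Sum>w\<in>?R k. (sqrt (P k w) + sqrt (Q k w))\<^sup>2) \<le> (\<Sum>w\<in>?R k. 2 * (P k w + Q k w))"
    proof (rule sum_mono)
      fix w
      have "0 \<le> (sqrt (P k w) - sqrt (Q k w))\<^sup>2" by simp
      then show "(sqrt (P k w) + sqrt (Q k w))\<^sup>2 \<le> 2 * (P k w + Q k w)"
        using nn[of k w] by (simp add: power2_diff power2_sum)
    qed
    also have "\<dots> = 4" using sums[of k] by (simp add: sum_distrib_left[symmetric] sum.distrib)
    finally have 4: "(\<Sum>w\<in>?R k. (sqrt (P k w) + sqrt (Q k w))\<^sup>2) \<le> 4" .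
    have "(\<Sum>w\<in>?R k. \<bar>P k w - Q k w\<bar>)
        \<le> L2_set (\<lambda>w. sqrt (P k w) - sqrt (Q k w)) (?R k) * L2_set (\<lambda>w. sqrt (P k w) + sqrt (Q k w)) (?R k)"
      unfolding eq by (rule L2_set_mult_ineq)
    also have "\<dots> \<le> sqrt (e k) * sqrt 4"
      unfolding L2_set_def using hell[of k] 4 e_nonneg by (intro mult_mono real_sqrt_le_mono) (auto intro!: sum_nonneg)
    finally show ?thesis by simp
  qed
  fix f :: "'a \<Omega> \<Rightarrow> real" assume f: "ucont f"
  obtain B where B: "0 < B" "\<And>x. \<bar>f x\<bar> \<le> B" using ucont_bounded[OF f] by blast
  let ?Lf = "L f"
  have Lf: "ucont ?Lf" by (intro ucont_transfer ucont_J f)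
  have "\<bar>(\<integral>x. ?Lf x \<partial>\<nu>) - (\<integral>x. f x \<partial>\<nu>)\<bar> \<le> osc k ?Lf + osc (Suc k) f + B * (2 * sqrt (e k))" for k
  proof -
    have "(\<integral>x. f (trunc (Suc k) x) \<partial>\<nu>) = (\<Sum>w\<in>?R k. P k w * f w)"
      unfolding P_def by (rule N.integral_trunc)
    moreover have "(\<integral>x. ?Lf (trunc k x) \<partial>\<nu>) = (\<Sum>w\<in>?R k. Q k w * f w)"
      unfolding N.integral_trunc[of ?Lf k] sum_range_trunc_Suc
      by (simp add: Q_def transfer_def sum_distrib_left mult_ac)
    ultimately have "\<bar>(\<integral>x. ?Lf (trunc k x) \<partial>\<nu>) - (\<integral>x. f (trunc (Suc k) x) \<partial>\<nu>)\<bar> = \<bar>\<Sum>w\<in>?R k. (Q k w - P k w) * f w\<bar>"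
      by (simp add: sum_subtractf left_diff_distrib)
    also have "\<dots> \<le> (\<Sum>w\<in>?R k. \<bar>P k w - Q k w\<bar> * B)"
      using B(2) by (intro order_trans[OF sum_abs] sum_mono) (auto simp: abs_mult abs_minus_commute intro!: mult_left_mono)
    also have "\<dots> = B * (\<Sum>w\<in>?R k. \<bar>P k w - Q k w\<bar>)" by (simp add: sum_distrib_left mult.commute)
    also have "\<dots> \<le> B * (2 * sqrt (e k))" using B(1) L1[of k] by (intro mult_left_mono) auto
    finally show ?thesis
      using N.integral_trunc_near[OF f, of "Suc k"] N.integral_trunc_near[OF Lf, of k] by linarith
  qed
  moreover have "(\<lambda>k. osc k ?Lf + osc (Suc k) f + B * (2 * sqrt (e k))) \<longlonglongrightarrow> 0 + 0 + B * (2 * sqrt 0)"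
    unfolding e_def by (intro tendsto_intros osc_tendsto_0 LIMSEQ_Suc[OF osc_tendsto_0] Lf f ucont_ln_J)
  ultimately have "\<bar>(\<integral>x. ?Lf x \<partial>\<nu>) - (\<integral>x. f x \<partial>\<nu>)\<bar> \<le> 0 + 0 + B * (2 * sqrt 0)"
    by (intro LIMSEQ_le_const) auto
  then show "(\<integral>x. ?Lf x \<partial>\<nu>) = (\<integral>x. f x \<partial>\<nu>)" by simp
qed

text \<open>
  The Gibbs property, in the recursive form \<open>p (k + 1) x \<le> J x * exp (C * \<theta> ^ (k + 1)) * p k (\<sigma> x)\<close> for
  the measures \<open>p k x\<close> of cylinders, bounds the entropy of \<open>\<mu>\<^sub>J\<close> from below.
\<close>

lemma ent_trunc_jacobian_ge:
  obtains D where "\<And>n. - real n * (\<integral>x. ln (J x) \<partial>\<mu>J) - D \<le> ent \<mu>J (trunc n)"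
proof -
  let ?m = "\<mu>J"
  obtain C \<theta> where c: "0 < \<theta>" "\<theta> < 1" "0 \<le> C" "exp_var C \<theta> (\<lambda>x. ln (J x))" by (rule holder_ln_J) blast
  define p where "p n x = measure ?m (cyl n x)" for n x
  have p_pos: "0 < p n x" for n x unfolding p_def by (rule measure_cyl_pos)
  have ent_eq: "ent ?m (trunc n) = (\<integral>x. - ln (p n x) \<partial>?m)" for n
    by (simp add: ent_def p_def cyl_def)
  have u: "ucont (\<lambda>x. - ln (p n x))" for n
  proof -
    have "p n (trunc n x) = p n x" for x by (simp add: p_def cyl_def)
    then show ?thesis using ucont_trunc[of "\<lambda>x. - ln (p n x)" n] by simp
  qed
  have rec: "ln (p (Suc n) x) \<le> ln (J x) + C * \<theta> ^ Suc n + ln (p n (left_shift x))" for n x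
  proof -
    have "p (Suc n) x = (\<integral>y. J (scons (x 0) y) * indicator (cyl n (left_shift x)) y \<partial>?m)"
      unfolding p_def by (rule measure_cyl_Suc)
    also have "\<dots> \<le> (\<integral>y. (J x * exp (C * \<theta> ^ Suc n)) * indicator (cyl n (left_shift x)) y \<partial>?m)"
    proof (intro integral_mono jm.integrable_ucont ucont_cmult ucont_indicator_cyl ucont_J_scons_indicator)
      fix y
      show "J (scons (x 0) y) * indicator (cyl n (left_shift x)) y \<le> (J x * exp (C * \<theta> ^ Suc n)) * indicator (cyl n (left_shift x)) y"
      proof (cases "y \<in> cyl n (left_shift x)")
        case True
        then have "trunc (Suc n) (scons (x 0) y) = trunc (Suc n) x" by (simp add: trunc_Suc cyl_def)
        from exp_varD[OF c(4) this] have "ln (J (scons (x 0) y)) \<le> ln (J x) + C * \<theta> ^ Suc n" by linarith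
        then have "exp (ln (J (scons (x 0) y))) \<le> exp (ln (J x) + C * \<theta> ^ Suc n)" by (simp only: exp_le_cancel_iff)
        then show ?thesis using True by (simp add: exp_add)
      qed simp
    qed
    also have "\<dots> = J x * exp (C * \<theta> ^ Suc n) * p n (left_shift x)"
      by (simp add: p_def)
    finally have "ln (p (Suc n) x) \<le> ln (J x * exp (C * \<theta> ^ Suc n) * p n (left_shift x))"
      using p_pos by (intro ln_mono) auto
    also have "\<dots> = ln (J x) + C * \<theta> ^ Suc n + ln (p n (left_shift x))"
      using p_pos[of n "left_shift x"] by (simp add: ln_mult_pos)
    finally show ?thesis .
  qed
  let ?I = "\<integral>x. ln (J x) \<partial>?m"
  have step: "ent ?m (trunc n) - ?I - C * \<theta> ^ Suc n \<le> ent ?m (trunc (Suc n))" for n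
  proof -
    have "(\<integral>x. - ln (p n (left_shift x)) - (ln (J x) + C * \<theta> ^ Suc n) \<partial>?m) \<le> (\<integral>x. - ln (p (Suc n) x) \<partial>?m)"
    proof (intro integral_mono jm.integrable_ucont ucont_diff ucont_add ucont_ln_J ucont_const u)
      show "ucont (\<lambda>x. - ln (p n (left_shift x)))" by (rule ucont_left_shift[OF u])
    qed (use rec in \<open>smt (verit)\<close>)
    also have "(\<integral>x. - ln (p n (left_shift x)) - (ln (J x) + C * \<theta> ^ Suc n) \<partial>?m)
        = (\<integral>x. - ln (p n (left_shift x)) \<partial>?m) - (\<integral>x. ln (J x) + C * \<theta> ^ Suc n \<partial>?m)"
      by (intro Bochner_Integration.integral_diff jm.integrable_ucont ucont_left_shift[OF u] ucont_add ucont_ln_J ucont_const)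
    also have "(\<integral>x. ln (J x) + C * \<theta> ^ Suc n \<partial>?m) = ?I + C * \<theta> ^ Suc n"
      using ucont_ln_J by simp
    also have "(\<integral>x. - ln (p n (left_shift x)) \<partial>?m) = (\<integral>x. - ln (p n x) \<partial>?m)"
      by (rule jm.integral_left_shift[OF borel_measurable_integrable[OF jm.integrable_ucont[OF u]]])
    finally show ?thesis by (simp add: ent_eq)
  qed
  define D where "D n = C / (1 - \<theta>) * (1 - \<theta> ^ n)" for n
  have "- real n * ?I - D n \<le> ent ?m (trunc n)" for n
  proof (induction n)
    case 0
    then show ?case using jm.ent_nonneg[OF jm.simple_trunc, of 0] by (simp add: D_def)
  next
    case (Suc n)
    have "D (Suc n) - D n = C / (1 - \<theta>) * ((1 - \<theta> ^ Suc n) - (1 - \<theta> ^ n))"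
      by (simp only: D_def right_diff_distrib)
    also have "(1 - \<theta> ^ Suc n) - (1 - \<theta> ^ n) = \<theta> ^ n * (1 - \<theta>)" by (simp add: algebra_simps)
    also have "C / (1 - \<theta>) * (\<theta> ^ n * (1 - \<theta>)) = C * \<theta> ^ n" using c(2) by simp
    finally have "D (Suc n) = D n + C * \<theta> ^ n" by simp
    moreover have "C * \<theta> ^ Suc n \<le> C * \<theta> ^ n" using c by (intro mult_left_mono power_decreasing) auto
    ultimately show ?case using Suc step[of n] by (simp add: algebra_simps)
  qed
  moreover have "D n \<le> C / (1 - \<theta>)" for n
  proof -
    have "C / (1 - \<theta>) * (1 - \<theta> ^ n) \<le> C / (1 - \<theta>) * 1" using c by (intro mult_left_mono) auto
    then show ?thesis by (simp add: D_def)
  qed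
  ultimately have "- real n * ?I - C / (1 - \<theta>) \<le> ent ?m (trunc n)" for n
    by (smt (verit))
  then show ?thesis by (rule that)
qed

lemma ks_entropy_jacobian_measure:
  "ks_entropy \<mu>J = ereal (- (\<integral>x. ln (J x) \<partial>\<mu>J))"
proof (rule antisym)
  let ?m = "\<mu>J" and ?I = "\<integral>x. ln (J x) \<partial>\<mu>J"
  show "ks_entropy ?m \<le> ereal (- ?I)" by (rule ks_entropy_le[OF jm.shift_inv_axioms])
  obtain enc :: "'a \<Rightarrow> nat" where enc: "inj enc"
    using finite_imp_inj_to_nat_seg[of "UNIV :: 'a set"] by auto
  define \<xi> where "\<xi> x = enc (x 0)" for x :: "'a \<Omega>"
  have \<xi>: "simple_function ?m \<xi>" by (rule jm.simple_finitary[of _ 1]) (simp add: \<xi>_def trunc_def)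
  obtain D where D: "\<And>n. - real n * ?I - D \<le> ent ?m (trunc n)" by (rule ent_trunc_jacobian_ge) blast
  have ge: "- ?I - D / real n \<le> ent ?m (itinerary \<xi> n) / real n" if "n \<ge> 1" for n
  proof -
    have "trunc n x = (\<lambda>l i. if i < n then inv enc (l ! i) else undefined) (itinerary \<xi> n x)" for x
      by (auto simp: trunc_def fun_eq_iff nth_itinerary \<xi>_def funpow_left_shift inv_f_f[OF enc])
    then have "ent ?m (trunc n) = ent ?m (\<lambda>x. (\<lambda>l i. if i < n then inv enc (l ! i) else undefined) (itinerary \<xi> n x))"
      by presburger
    also have "\<dots> \<le> ent ?m (itinerary \<xi> n)" by (rule jm.ent_map_le[OF jm.simple_itinerary[OF \<xi>]])
    finally have "(- real n * ?I - D) / real n \<le> ent ?m (itinerary \<xi> n) / real n"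
      using D[of n] by (intro divide_right_mono) auto
    then show ?thesis using that by (simp add: diff_divide_distrib)
  qed
  have "(\<lambda>n. - ?I - D / real n) \<longlonglongrightarrow> - ?I - 0"
    by (intro tendsto_intros lim_const_over_n)
  then have "- ?I - 0 \<le> partition_entropy ?m \<xi>"
    by (rule LIMSEQ_le[OF _ jm.partition_entropy_limit[OF \<xi>]]) (use ge in blast)
  then have "ereal (- ?I) \<le> ereal (partition_entropy ?m \<xi>)" by simp
  also have "\<dots> \<le> ks_entropy ?m" unfolding ks_entropy_def by (rule SUP_upper) (simp add: \<xi>)
  finally show "ereal (- ?I) \<le> ks_entropy ?m" .
qed

text \<open>
  Coboundaries have integral zero for invariant measures.
\<close>

lemma integral_cohomologous:
  assumes "shift_inv \<nu>" "ucont A" "ucont u"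
    and A: "\<And>x. ln (J x) = A x + u x - u (left_shift x) - c"
  shows "(\<integral>x. ln (J x) \<partial>\<nu>) = (\<integral>x. A x \<partial>\<nu>) - c"
proof -
  interpret N: shift_inv \<nu> by fact
  note us = ucont_left_shift[OF assms(3)]
  have "(\<integral>x. ln (J x) \<partial>\<nu>) = (\<integral>x. (A x - c) + (u x - u (left_shift x)) \<partial>\<nu>)" by (simp add: A algebra_simps)
  also have "\<dots> = (\<integral>x. A x - c \<partial>\<nu>) + (\<integral>x. u x - u (left_shift x) \<partial>\<nu>)"
    using assms us by (intro Bochner_Integration.integral_add N.integrable_ucont ucont_diff) auto
  also have "(\<integral>x. u x - u (left_shift x) \<partial>\<nu>) = (\<integral>x. u x \<partial>\<nu>) - (\<integral>x. u (left_shift x) \<partial>\<nu>)"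
    using assms us by (intro Bochner_Integration.integral_diff N.integrable_ucont)
  also have "(\<integral>x. u (left_shift x) \<partial>\<nu>) = (\<integral>x. u x \<partial>\<nu>)"
    by (rule N.integral_left_shift[OF borel_measurable_integrable[OF N.integrable_ucont[OF assms(3)]]])
  also have "(\<integral>x. A x - c \<partial>\<nu>) = (\<integral>x. A x \<partial>\<nu>) - c"
    using assms by simp
  finally show ?thesis by simp
qed

lemma equilibrium_eq:
  assumes A: "ucont A" and u: "ucont u"
    and eq: "\<And>x. ln (J x) = A x + u x - u (left_shift x) - c"
  shows "equilibrium A = \<mu>J"
proof -
  let ?m = "\<mu>J"
  have int: "(\<integral>x. A x \<partial>\<nu>) = (\<integral>x. ln (J x) \<partial>\<nu>) + c" if "shift_inv \<nu>" for \<nu>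
    using integral_cohomologous[OF that A u eq] by simp
  have top: "ks_entropy ?m + ereal (\<integral>x. A x \<partial>?m) = ereal c"
    by (simp add: ks_entropy_jacobian_measure int[OF jm.shift_inv_axioms])
  have le: "ks_entropy \<nu> + ereal (\<integral>x. A x \<partial>\<nu>) \<le> ereal c" if "shift_inv \<nu>" for \<nu>
  proof -
    have "ks_entropy \<nu> + ereal (\<integral>x. A x \<partial>\<nu>) \<le> ereal (- (\<integral>x. ln (J x) \<partial>\<nu>)) + ereal (\<integral>x. A x \<partial>\<nu>)"
      by (intro add_right_mono ks_entropy_le that)
    then show ?thesis by (simp add: int[OF that])
  qed
  show ?thesis
    unfolding equilibrium_def
  proof (rule the_equality)
    show "is_equilibrium A ?m"
      unfolding is_equilibrium_def invariant_prob_iff using top le jm.shift_inv_axioms by simp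
    fix \<nu> assume "is_equilibrium A \<nu>"
    then have \<nu>: "shift_inv \<nu>" and "ereal c \<le> ks_entropy \<nu> + ereal (\<integral>x. A x \<partial>\<nu>)"
      unfolding is_equilibrium_def invariant_prob_iff using jm.shift_inv_axioms top by (blast, metis)
    then have "ereal (- (\<integral>x. ln (J x) \<partial>\<nu>)) \<le> ks_entropy \<nu>"
      by (cases "ks_entropy \<nu>") (auto simp: int[OF \<nu>])
    then show "\<nu> = ?m" by (rule ks_entropy_eq_imp[OF \<nu>])
  qed
qed

lemma equilibrium_ln_J: "equilibrium (\<lambda>x. ln (J x)) = \<mu>J"
  by (rule equilibrium_eq[of _ "\<lambda>_. 0" 0]) (auto simp: ucont_ln_J)

end

section \<open>The derivative of the pressure\<close>

lemma exp_quadratic_bound: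
  fixes t :: real
  assumes "\<bar>t\<bar> \<le> 1" shows "exp t \<le> 1 + t + t\<^sup>2"
proof (cases "0 \<le> t")
  case True
  then show ?thesis using assms by (intro exp_bound) auto
next
  case False
  have "1 - t \<le> exp (- t)" using exp_ge_add_one_self[of "- t"] by simp
  then have "exp t * (1 - t) \<le> 1" by (simp add: exp_minus field_simps)
  also have "1 \<le> (1 + t + t\<^sup>2) * (1 - t)"
  proof -
    have "(1 + t + t\<^sup>2) * (1 - t) = 1 - t ^ 3" by (simp add: power2_eq_square power3_eq_cube algebra_simps)
    moreover have "t ^ 3 \<le> 0" using False by (simp add: power_le_zero_eq)
    ultimately show ?thesis by simp
  qed
  finally show ?thesis using False by (simp add: mult_le_cancel_right)
qed

context jacobian
begin

text \<open>
  With the test function \<open>\<psi> = exp (l * u)\<close>, \<open>u = g' + L g' + \<dots> + L\<^sup>n\<^sup>-\<^sup>1 g'\<close> and \<open>g' = L g\<close>, the first order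
  term of \<open>L\<^sub>l \<psi> / \<psi>\<close> in \<open>l\<close> is \<open>L (g + u) - u = L\<^sup>n\<^sup>+\<^sup>1 g\<close>, which is uniformly close to the integral of
  \<open>g\<close>. Hence the eigenvalue of \<open>L\<^sub>l\<close> is \<open>1 + l * \<integral> g d\<mu>\<^sub>J\<close> up to \<open>o(l)\<close>.
\<close>

lemma transfer_test_function:
  assumes g: "ucont g" and e: "0 < e"
  obtains u B where "ucont u" "0 < B"
    "\<And>l x. 0 \<le> l \<Longrightarrow> l * B \<le> 1 \<Longrightarrow>
      \<bar>transfer (\<lambda>y. exp (ln (J y) + l * g y)) (\<lambda>y. exp (l * u y)) x
        - exp (l * u x) * (1 + l * (\<integral>x. g x \<partial>\<mu>J))\<bar> \<le> exp (l * u x) * (l * e + (l * B)\<^sup>2)"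
proof -
  let ?c = "\<integral>x. g x \<partial>\<mu>J"
  let ?g' = "L g"
  have g': "ucont ?g'" by (intro ucont_transfer ucont_J g)
  have c': "(\<integral>x. ?g' x \<partial>\<mu>J) = ?c" by (rule integral_transfer[OF g])
  obtain n where n: "\<And>x. \<bar>(L ^^ n) ?g' x - ?c\<bar> \<le> e"
    using transfer_pow_uniform_limit[OF g' e] unfolding c' by blast
  define u where "u x = (\<Sum>k<n. (L ^^ k) ?g' x)" for x
  have u: "ucont u"
    unfolding u_def[abs_def] by (intro ucont_sum ucont_transfer_pow ucont_J g')
  have Tu: "L u x = u x - ?g' x + (L ^^ n) ?g' x" for x
  proof -
    have "L u x = (\<Sum>k<n. (L ^^ Suc k) ?g' x)"
      unfolding transfer_def u_def by (simp add: sum_distrib_left transfer_def) (rule sum.swap)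
    also have "\<dots> = u x - ?g' x + (L ^^ n) ?g' x"
      using sum.lessThan_Suc_shift[of "\<lambda>k. (L ^^ k) ?g' x" n] by (simp add: u_def)
    finally show ?thesis .
  qed
  obtain B1 where B1: "0 < B1" "\<And>x. \<bar>g x\<bar> \<le> B1" using ucont_bounded[OF g] by blast
  obtain B2 where B2: "0 < B2" "\<And>x. \<bar>u x\<bar> \<le> B2" using ucont_bounded[OF u] by blast
  define B where "B = B1 + 2 * B2"
  have "\<bar>transfer (\<lambda>y. exp (ln (J y) + l * g y)) (\<lambda>y. exp (l * u y)) x - exp (l * u x) * (1 + l * ?c)\<bar>
      \<le> exp (l * u x) * (l * e + (l * B)\<^sup>2)" if l: "0 \<le> l" "l * B \<le> 1" for l x
  proof -
    define t where "t a = g (scons a x) + u (scons a x) - u x" for a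
    have t: "\<bar>t a\<bar> \<le> B" for a
      using B1(2)[of "scons a x"] B2(2)[of "scons a x"] B2(2)[of x] unfolding t_def B_def by linarith
    have lt: "\<bar>l * t a\<bar> \<le> l * B" for a using t l(1) by (simp add: abs_mult mult_left_mono)
    define S where "S = (\<Sum>a\<in>UNIV. J (scons a x) * exp (l * t a))"
    have S: "transfer (\<lambda>y. exp (ln (J y) + l * g y)) (\<lambda>y. exp (l * u y)) x = exp (l * u x) * S"
      unfolding S_def transfer_def sum_distrib_left
      by (intro sum.cong refl) (simp add: exp_add t_def algebra_simps exp_diff)
    define T where "T = (\<Sum>a\<in>UNIV. J (scons a x) * (1 + l * t a))"
    have "T = 1 + l * (\<Sum>a\<in>UNIV. J (scons a x) * t a)"
      by (simp add: T_def distrib_left sum.distrib sum_eq_1 sum_distrib_left mult_ac)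
    also have "(\<Sum>a\<in>UNIV. J (scons a x) * t a) = ?g' x + L u x - (\<Sum>a\<in>UNIV. J (scons a x)) * u x"
      by (simp add: t_def transfer_def sum.distrib sum_subtractf sum_distrib_left algebra_simps)
    also have "\<dots> = (L ^^ n) ?g' x" by (simp add: Tu sum_eq_1)
    finally have T: "T = 1 + l * (L ^^ n) ?g' x" .
    have "\<bar>T - (1 + l * ?c)\<bar> = l * \<bar>(L ^^ n) ?g' x - ?c\<bar>"
      using l(1) by (simp add: T abs_mult flip: right_diff_distrib)
    also have "\<dots> \<le> l * e" using n l(1) by (intro mult_left_mono) auto
    finally have 1: "\<bar>T - (1 + l * ?c)\<bar> \<le> l * e" .
    have 2: "T \<le> S"
      unfolding T_def S_def by (intro sum_mono mult_left_mono exp_ge_add_one_self) auto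
    have "S \<le> (\<Sum>a\<in>UNIV. J (scons a x) * (1 + l * t a + (l * B)\<^sup>2))"
      unfolding S_def
    proof (intro sum_mono mult_left_mono)
      fix a
      have "exp (l * t a) \<le> 1 + l * t a + (l * t a)\<^sup>2"
        using lt[of a] l by (intro exp_quadratic_bound) linarith
      also have "(l * t a)\<^sup>2 \<le> (l * B)\<^sup>2" using lt[of a] by (metis abs_le_square_iff abs_of_nonneg abs_ge_zero order_trans)
      finally show "exp (l * t a) \<le> 1 + l * t a + (l * B)\<^sup>2" by simp
    qed simp
    also have "\<dots> = T + (l * B)\<^sup>2"
      by (simp add: T_def distrib_left sum.distrib sum_eq_1 flip: sum_distrib_right)
    finally have 3: "S \<le> T + (l * B)\<^sup>2" .
    have "\<bar>S - (1 + l * ?c)\<bar> \<le> l * e + (l * B)\<^sup>2"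
      using 1 2 3 zero_le_power2[of "l * B"] by (simp add: abs_le_iff)
    then have "exp (l * u x) * \<bar>S - (1 + l * ?c)\<bar> \<le> exp (l * u x) * (l * e + (l * B)\<^sup>2)"
      by (intro mult_left_mono) auto
    then show ?thesis by (simp add: S abs_mult flip: right_diff_distrib)
  qed
  moreover have "0 < B" using B1 B2 by (simp add: B_def)
  ultimately show ?thesis using that[OF u] by blast
qed

text \<open>
  The two bounds by test functions are all that has to be known about the eigenvalue \<open>\<alpha> l\<close>: by the
  choice of \<open>\<psi>\<close> above they agree to first order in \<open>l\<close>.
\<close>

lemma eigenvalue_derivative:
  fixes \<alpha> :: "real \<Rightarrow> real"
  assumes g: "ucont g" and \<alpha>0: "\<alpha> 0 = 1"
    and bounds: "\<And>l. l \<in> {0..1} \<Longrightarrow> test_bounded (\<lambda>x. ln (J x) + l * g x) (\<alpha> l)"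
  shows "(\<alpha> has_real_derivative (\<integral>x. g x \<partial>\<mu>J)) (at 0 within {0..1})"
proof -
  let ?c = "\<integral>x. g x \<partial>\<mu>J"
  have "((\<lambda>l. (\<alpha> l - \<alpha> 0) / (l - 0)) \<longlongrightarrow> ?c) (at 0 within {0..1})"
  proof (rule tendstoI)
    fix r :: real assume r: "0 < r"
    obtain u B where u: "ucont u" and B: "0 < B"
      and uB: "\<And>l x. 0 \<le> l \<Longrightarrow> l * B \<le> 1 \<Longrightarrow>
        \<bar>transfer (\<lambda>y. exp (ln (J y) + l * g y)) (\<lambda>y. exp (l * u y)) x
          - exp (l * u x) * (1 + l * ?c)\<bar> \<le> exp (l * u x) * (l * (r / 2) + (l * B)\<^sup>2)"
      using transfer_test_function[OF g, of "r / 2"] r by auto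
    define d where "d = min (1 / B) (r / (2 * B\<^sup>2))"
    have d: "0 < d" using B r by (simp add: d_def)
    have "dist ((\<alpha> l - \<alpha> 0) / (l - 0)) ?c < r" if l: "l \<in> {0..1}" "l \<noteq> 0" "dist l 0 < d" for l
    proof -
      have l0: "0 < l" "l < 1 / B" "l < r / (2 * B\<^sup>2)" using l by (auto simp: dist_real_def d_def)
      have lB: "l * B \<le> 1" using l0(2) B by (simp add: field_simps)
      let ?\<psi> = "\<lambda>y. exp (l * u y)" and ?e = "l * (r / 2) + (l * B)\<^sup>2"
      have \<psi>: "ucont ?\<psi>" by (intro ucont_exp ucont_cmult u)
      let ?T = "transfer (\<lambda>y. exp (ln (J y) + l * g y)) ?\<psi>"
      have "\<forall>x. 0 < ?\<psi> x" by simp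
      note bound = bounds[OF l(1), unfolded test_bounded_def, THEN spec, THEN spec, THEN mp, THEN mp, OF \<psi> this]
      have near: "\<bar>?T x - ?\<psi> x * (1 + l * ?c)\<bar> \<le> ?\<psi> x * ?e" for x
        using uB[of l x] l0 lB by simp
      have "?T x \<le> (1 + l * ?c + ?e) * ?\<psi> x" for x
        using near[of x] by (simp add: algebra_simps abs_le_iff)
      then have "\<alpha> l \<le> 1 + l * ?c + ?e" using bound by blast
      moreover have "(1 + l * ?c - ?e) * ?\<psi> x \<le> ?T x" for x
        using near[of x] by (simp add: algebra_simps abs_le_iff)
      then have "1 + l * ?c - ?e \<le> \<alpha> l" using bound by blast
      ultimately have "\<bar>(\<alpha> l - 1) - l * ?c\<bar> \<le> ?e" by (simp add: abs_le_iff)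
      moreover have "?e < l * r"
      proof -
        have "l * (2 * B\<^sup>2) < r" using l0(3) B by (simp add: field_simps)
        then have "l * (l * (2 * B\<^sup>2)) < l * r" using l0(1) by (rule mult_strict_left_mono)
        then show ?thesis by (simp add: power_mult_distrib power2_eq_square algebra_simps)
      qed
      ultimately have "\<bar>(\<alpha> l - 1) - l * ?c\<bar> / l < l * r / l" using l0(1) by (intro divide_strict_right_mono) auto
      moreover have "\<bar>(\<alpha> l - 1) - l * ?c\<bar> / l = \<bar>(\<alpha> l - 1) / l - ?c\<bar>"
      proof -
        have "(\<alpha> l - 1) / l - ?c = ((\<alpha> l - 1) - l * ?c) / l" using l0(1) by (simp add: diff_divide_distrib)
        then show ?thesis using l0(1) by (simp only: abs_divide abs_of_pos)
      qed
      ultimately show ?thesis using l0(1) by (simp add: dist_real_def \<alpha>0)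
    qed
    then show "\<forall>\<^sub>F l in at 0 within {0..1}. dist ((\<alpha> l - \<alpha> 0) / (l - 0)) ?c < r"
      unfolding eventually_at using d by blast
  qed
  then show ?thesis by (simp add: has_field_derivative_iff)
qed

end

section \<open>Differentiating the Kullback--Leibler divergence\<close>

theorem proposition1p4:
  fixes J0 Jt1 J1 :: "(nat \<Rightarrow> 'a::finite) \<Rightarrow> real"
    and \<mu>1 :: "(nat \<Rightarrow> 'a) measure"
    and \<mu> :: "real \<Rightarrow> (nat \<Rightarrow> 'a) measure"
  assumes "holder_jacobian J0" and "holder_jacobian Jt1" and "holder_jacobian J1"
    and "\<mu>1 = jacobian_measure J1"
    and "\<And>l. l \<in> {0..1} \<Longrightarrow> \<mu> l = equilibrium (\<lambda>x. l * ln (Jt1 x) + (1 - l) * ln (J0 x))"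
  shows "\<mu> 0 = jacobian_measure J0 \<and> \<mu> 1 = jacobian_measure Jt1 \<and>
    ((\<lambda>l. D_KL \<mu>1 (\<mu> l)) has_real_derivative
       - (\<integral>x. (ln (Jt1 x) - ln (J0 x)) \<partial>\<mu>1) + (\<integral>x. (ln (Jt1 x) - ln (J0 x)) \<partial>(\<mu> 0)))
      (at 0 within {0..1}) \<and>
    (0 \<le> vector_derivative (\<lambda>l. D_KL \<mu>1 (\<mu> l)) (at 0 within {0..1}) \<longleftrightarrow>
      D_KL \<mu>1 (\<mu> 0) + D_KL (\<mu> 0) (jacobian_measure Jt1) \<le> D_KL \<mu>1 (jacobian_measure Jt1))"
proof -
  interpret j0: jacobian J0 by unfold_locales fact
  interpret jt: jacobian Jt1 by unfold_locales fact
  interpret j1: jacobian J1 by unfold_locales fact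
  define g where "g x = ln (Jt1 x) - ln (J0 x)" for x
  define A where "A l x = l * ln (Jt1 x) + (1 - l) * ln (J0 x)" for l x
  have g: "ucont g" unfolding g_def[abs_def] by (intro ucont_diff jt.ucont_ln_J j0.ucont_ln_J)
  have A_eq: "A l x = ln (J0 x) + l * g x" for l x by (simp add: A_def g_def algebra_simps)
  have hA: "holder_potential (A l)" for l
    unfolding A_def[abs_def] by (intro holder_combination jt.holder_potential_ln_J j0.holder_potential_ln_J)
  have \<mu>: "\<mu> l = equilibrium (A l)" if "l \<in> {0..1}" for l
    using assms(5)[OF that] by (simp add: A_def[abs_def])
  have \<mu>0: "\<mu> 0 = jacobian_measure J0"
    using \<mu>[of 0] j0.equilibrium_ln_J by (simp add: A_def[abs_def])
  have \<mu>1': "\<mu> 1 = jacobian_measure Jt1"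
    using \<mu>[of 1] jt.equilibrium_ln_J by (simp add: A_def[abs_def])
  have "\<exists>\<alpha>>0. test_bounded (A l) \<alpha> \<and> D_KL \<mu>1 (equilibrium (A l))
      = (\<integral>x. ln (J1 x) \<partial>\<mu>1) - (\<integral>x. A l x \<partial>\<mu>1) + ln \<alpha>" for l
  proof -
    obtain J \<phi> \<alpha> where J: "holder_jacobian J" and \<phi>: "ucont \<phi>" "\<And>x. 0 < \<phi> x" and \<alpha>: "0 < \<alpha>"
      and eq: "\<And>x. ln (J x) = A l x + ln (\<phi> x) - ln (\<phi> (left_shift x)) - ln \<alpha>"
      and tb: "test_bounded (A l) \<alpha>"
      by (rule ex_normalization[OF hA j0.two_letters]) blast
    interpret j: jacobian J by unfold_locales fact
    have uA: "ucont (A l)" by (rule ucont_if_holder[OF hA])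
    have u\<phi>: "ucont (\<lambda>x. ln (\<phi> x))" by (rule ucont_ln[OF \<phi>])
    have "equilibrium (A l) = jacobian_measure J" by (rule j.equilibrium_eq[OF uA u\<phi> eq])
    moreover have "D_KL \<mu>1 (jacobian_measure J) = (\<integral>x. ln (J1 x) \<partial>\<mu>1) - (\<integral>x. ln (J x) \<partial>\<mu>1)"
      unfolding assms(4) by (rule j.D_KL_eq[OF j1.jm.shift_inv_axioms refl assms(3)])
    moreover have "(\<integral>x. ln (J x) \<partial>\<mu>1) = (\<integral>x. A l x \<partial>\<mu>1) - ln \<alpha>"
      unfolding assms(4) by (rule j.integral_cohomologous[OF j1.jm.shift_inv_axioms uA u\<phi> eq])
    ultimately show ?thesis using \<alpha> tb by (intro exI[of _ \<alpha>]) simp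
  qed
  then obtain \<alpha> where \<alpha>: "\<And>l. 0 < \<alpha> l" "\<And>l. test_bounded (A l) (\<alpha> l)"
    and D: "\<And>l. D_KL \<mu>1 (equilibrium (A l)) = (\<integral>x. ln (J1 x) \<partial>\<mu>1) - (\<integral>x. A l x \<partial>\<mu>1) + ln (\<alpha> l)"
    by metis
  have \<alpha>0: "\<alpha> 0 = 1"
  proof -
    have "transfer (\<lambda>x. exp (A 0 x)) (\<lambda>_. 1) = (\<lambda>_. 1)" by (simp add: A_eq)
    then have "\<alpha> 0 \<le> 1" "1 \<le> \<alpha> 0"
      using \<alpha>(2)[of 0, unfolded test_bounded_def, rule_format, of "\<lambda>_. 1" 1] by simp_all
    then show ?thesis by simp
  qed
  let ?c = "\<integral>x. g x \<partial>\<mu> 0" and ?c1 = "\<integral>x. g x \<partial>\<mu>1"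
  have \<alpha>_der: "(\<alpha> has_real_derivative ?c) (at 0 within {0..1})"
    unfolding \<mu>0 using \<alpha>(2) by (intro j0.eigenvalue_derivative g \<alpha>0) (simp flip: A_eq)
  have "((\<lambda>l. ln (\<alpha> l)) has_real_derivative inverse (\<alpha> 0) * ?c) (at 0 within {0..1})"
    by (rule DERIV_chain2[OF DERIV_ln[OF \<alpha>(1)] \<alpha>_der])
  then have ln_der: "((\<lambda>l. ln (\<alpha> l)) has_real_derivative ?c) (at 0 within {0..1})"
    by (simp add: \<alpha>0)
  have int_A: "(\<integral>x. A l x \<partial>\<mu>1) = (\<integral>x. ln (J0 x) \<partial>\<mu>1) + l * ?c1" for l
    unfolding A_eq assms(4) using g j0.ucont_ln_J
    by (subst Bochner_Integration.integral_add) (auto intro: ucont_cmult)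
  have "((\<lambda>l. (\<integral>x. ln (J1 x) \<partial>\<mu>1) - (\<integral>x. A l x \<partial>\<mu>1) + ln (\<alpha> l)) has_real_derivative - ?c1 + ?c) (at 0 within {0..1})"
    unfolding int_A by (rule DERIV_add[OF _ ln_der]) (auto intro!: derivative_eq_intros)
  then have der: "((\<lambda>l. D_KL \<mu>1 (\<mu> l)) has_real_derivative - ?c1 + ?c) (at 0 within {0..1})"
    by (rule has_field_derivative_transform_within[of _ _ _ _ 1]) (auto simp: \<mu> D)
  have vd: "vector_derivative (\<lambda>l. D_KL \<mu>1 (\<mu> l)) (at 0 within {0..1}) = - ?c1 + ?c"
    using der by (intro vector_derivative_within_closed_interval)
      (auto simp: has_real_derivative_iff_has_vector_derivative)
  have KL: "D_KL \<mu>1 (\<mu> 0) = (\<integral>x. ln (J1 x) \<partial>\<mu>1) - (\<integral>x. ln (J0 x) \<partial>\<mu>1)"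
    "D_KL (\<mu> 0) (jacobian_measure Jt1) = (\<integral>x. ln (J0 x) \<partial>\<mu> 0) - (\<integral>x. ln (Jt1 x) \<partial>\<mu> 0)"
    "D_KL \<mu>1 (jacobian_measure Jt1) = (\<integral>x. ln (J1 x) \<partial>\<mu>1) - (\<integral>x. ln (Jt1 x) \<partial>\<mu>1)"
    unfolding \<mu>0 assms(4)
    by (rule j0.D_KL_eq jt.D_KL_eq, rule j0.jm.shift_inv_axioms j1.jm.shift_inv_axioms, rule refl, rule assms)+
  have c: "?c = (\<integral>x. ln (Jt1 x) \<partial>\<mu> 0) - (\<integral>x. ln (J0 x) \<partial>\<mu> 0)"
    "?c1 = (\<integral>x. ln (Jt1 x) \<partial>\<mu>1) - (\<integral>x. ln (J0 x) \<partial>\<mu>1)"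
    unfolding g_def \<mu>0 assms(4)
    by (intro Bochner_Integration.integral_diff j0.jm.integrable_ucont j1.jm.integrable_ucont
        j0.ucont_ln_J jt.ucont_ln_J)+
  have "0 \<le> - ?c1 + ?c \<longleftrightarrow>
      D_KL \<mu>1 (\<mu> 0) + D_KL (\<mu> 0) (jacobian_measure Jt1) \<le> D_KL \<mu>1 (jacobian_measure Jt1)"
    unfolding KL c by linarith
  with \<mu>0 \<mu>1' der vd show ?thesis by (simp add: g_def)
qed

end
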